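(* Any classical randomized algorithm that solves the \textsc{Forrelation} problem on functions $f,g:\{0,1\}^n\rightarrow\{-1,1\}$ with bounded probability of error must make $\Omega\left(\frac{\sqrt{N}}{\log N}\right)$ queries, where $N=2^n$.
   Context: For $f,g:\{0,1\}^n\to\{-1,1\}$ put $\Phi_{f,g}:=\frac{1}{2^{3n/2}}\sum_{x,y\in\{0,1\}^n}f(x)(-1)^{x\cdot y}g(y)$, where $x\cdot y$ is the inner product of bit strings. In \textsc{Forrelation}, one is given black-box (oracle) access to $f$ and $g$ (each classical query returns one value $f(x)$ or $g(y)$ at a point chosen by the algorithm, possibly adaptively), and must decide whether $|\Phi_{f,g}|\le\frac{1}{100}$ or $\Phi_{f,g}\ge\frac{3}{5}$, promised that one of these is the case. The number of queries is the maximum over all valid inputs. "Bounded probability of error" means error probability at most $1/2-\varepsilon$ on every valid input, for some constant $\varepsilon>0$. The asymptotics are as $n\to\infty$. *)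

theory Defs
  imports "HOL-Probability.Probability"
begin

definition cube :: "nat \<Rightarrow> bool list set" where
  "cube n = {x. length x = n}"

definition dot :: "nat \<Rightarrow> bool list \<Rightarrow> bool list \<Rightarrow> nat" where
  "dot n x y = (\<Sum>i<n. of_bool (x ! i) * of_bool (y ! i))"

definition sign_funs :: "nat \<Rightarrow> (bool list \<Rightarrow> real) set" where
  "sign_funs n = cube n \<rightarrow>\<^sub>E {-1, 1}"

definition forrelation :: "nat \<Rightarrow> (bool list \<Rightarrow> real) \<Rightarrow> (bool list \<Rightarrow> real) \<Rightarrow> real" where
  "forrelation n f g =
     1 / 2 powr (3 * real n / 2) * (\<Sum>x\<in>cube n. \<Sum>y\<in>cube n. f x * (-1) ^ dot n x y * g y)"

definition forrelation_inputs :: "nat \<Rightarrow> ((bool list \<Rightarrow> real) \<times> (bool list \<Rightarrow> real)) set" where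
  "forrelation_inputs n =
     {(f, g). f \<in> sign_funs n \<and> g \<in> sign_funs n \<and>
        (\<bar>forrelation n f g\<bar> \<le> 1/100 \<or> forrelation n f g \<ge> 3/5)}"

text \<open>
  Deterministic adaptive query algorithms, as decision trees. A query node carries the queried
  point, the continuation for the reply \<open>1\<close> and the continuation for the reply \<open>-1\<close>, in this order.
  The answer \<open>True\<close> stands for the claim that the forrelation is at least \<open>3/5\<close>.
\<close>

datatype query_tree =
    Answer bool
  | Query_f "bool list" query_tree query_tree
  | Query_g "bool list" query_tree query_tree

primrec wf_tree :: "nat \<Rightarrow> query_tree \<Rightarrow> bool" where
  "wf_tree n (Answer b) \<longleftrightarrow> True"
| "wf_tree n (Query_f x t u) \<longleftrightarrow> x \<in> cube n \<and> wf_tree n t \<and> wf_tree n u"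
| "wf_tree n (Query_g y t u) \<longleftrightarrow> y \<in> cube n \<and> wf_tree n t \<and> wf_tree n u"

primrec tree_output :: "query_tree \<Rightarrow> (bool list \<Rightarrow> real) \<Rightarrow> (bool list \<Rightarrow> real) \<Rightarrow> bool" where
  "tree_output (Answer b) f g = b"
| "tree_output (Query_f x t u) f g = (if f x = 1 then tree_output t f g else tree_output u f g)"
| "tree_output (Query_g y t u) f g = (if g y = 1 then tree_output t f g else tree_output u f g)"

primrec num_queries :: "query_tree \<Rightarrow> (bool list \<Rightarrow> real) \<Rightarrow> (bool list \<Rightarrow> real) \<Rightarrow> nat" where
  "num_queries (Answer b) f g = 0"
| "num_queries (Query_f x t u) f g =
     Suc (if f x = 1 then num_queries t f g else num_queries u f g)"
| "num_queries (Query_g y t u) f g =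
     Suc (if g y = 1 then num_queries t f g else num_queries u f g)"

text \<open>
  A randomized algorithm is a probability distribution on deterministic ones. As there are only
  countably many finite trees, a probability mass function is no loss of generality.
\<close>

type_synonym randomized_algorithm = "query_tree pmf"

definition error_prob ::
    "nat \<Rightarrow> randomized_algorithm \<Rightarrow> (bool list \<Rightarrow> real) \<Rightarrow> (bool list \<Rightarrow> real) \<Rightarrow> real" where
  "error_prob n A f g =
     measure_pmf.prob A {t. tree_output t f g \<noteq> (forrelation n f g \<ge> 3/5)}"

definition solves_forrelation :: "nat \<Rightarrow> real \<Rightarrow> randomized_algorithm \<Rightarrow> bool" where
  "solves_forrelation n \<delta> A \<longleftrightarrow>
     (\<forall>t\<in>set_pmf A. wf_tree n t) \<and>
     (\<forall>(f, g)\<in>forrelation_inputs n. error_prob n A f g \<le> \<delta>)"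

text \<open>
  The worst case over all promise inputs and all outcomes of the internal randomness; it is
  \<open>\<infinity>\<close> if there is no bound.
\<close>

definition max_queries :: "nat \<Rightarrow> randomized_algorithm \<Rightarrow> enat" where
  "max_queries n A =
     (SUP (f, g)\<in>forrelation_inputs n. SUP t\<in>set_pmf A. enat (num_queries t f g))"

end

theory Submission
  imports Defs "HOL-Real_Asymp.Real_Asymp"
begin

text \<open>
  The hard distribution: let \<open>v\<close> be a standard Gaussian vector indexed by the cube, \<open>w = H v\<close> its normalized
  Hadamard transform, \<open>f = sgn v\<close>, and let \<open>g(y)\<close> be independent signs with means \<open>\<psi>(w\<^sub>y)\<close>, where \<open>\<psi>\<close> is an
  odd sine polynomial bounded by \<open>\<rho> < 1\<close>. Its forrelation concentrates around \<open>E|z| E[z \<psi>(z)]\<close>, which can be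
  at most \<open>2/\<pi>\<close> and exceeds \<open>3/5\<close> for a suitable \<open>\<psi>\<close>; as \<open>f(x)\<close> depends on \<open>v\<^sub>x\<close> alone and \<open>\<psi>\<close> is trigonometric,
  the first two moments factor into characteristic functions. Uniform signs have forrelation close to \<open>0\<close>.

  For a leaf of a decision tree with queried sets \<open>A\<close>, \<open>B\<close>, the likelihood ratio of the two distributions is at
  least \<open>1 - C (|\<Sum> f(x) H(x,y) g(y)| + \<Sum>\<^sub>y (\<Sum>\<^sub>x f(x) H(x,y))\<^sup>2 + \<Sum>\<^sub>x (\<Sum>\<^sub>y H(x,y) g(y))\<^sup>2 + |A| |B| / N)\<close>:
  replacing \<open>w\<close> by the transform of an independent copy of \<open>v\<close> costs a small shift \<open>u\<close>, and
  \<open>1 + b \<psi>(w + u) \<ge> (1 + b \<psi>(w)) exp (b \<psi>'(w) u / (1 + b \<psi>(w)) - C u\<^sup>2)\<close> reduces everything to moments of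
  order two. Under uniform signs the bilinear form is a martingale along the tree, and an exponential moment bound,
  uniform over the \<open>2 N\<close> possible queries, controls its increments; this union bound is the source of \<open>log N\<close>.
\<close>

section \<open>The Hadamard transform\<close>

text \<open>If \<psi> were the sign function itself, the mean forrelation would approach 2/\<pi>,
  but likelihood factors would vanish wherever \<open>w\<close> has the wrong sign, and a small
  shift of \<open>w\<close> could not be controlled. The bound \<open>\<rho> < 1\<close> keeps every
  factor away from 0. The price is some forrelation, and as 3/5 is close to 2/\<pi> = 0.636...,
  \<psi> cannot be chosen carelessly.

  A lower bound for the ratio is enough: an algorithm that rejects uniform inputs with probability
  at least about 1/2 + \<epsilon> must reject hard inputs nearly as often, although correctness
  allows only about 1/2 - \<epsilon> there.

  The exponential moment bounds the square of every possible increment by order T n^2 / N on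
  average, so the T queries of a run together contribute T^2 n^2 / N. This is small exactly when T
  is a small multiple of sqrt N / n.

  The query bound concerns valid inputs only, whereas both distributions put some mass on inputs
  violating the promise. Trees are therefore truncated, and the invalid mass is removed by second
  moments.\<close>

lemma finite_cube [simp, intro]: "finite (cube n)"
proof -
  have "cube n = {xs. set xs \<subseteq> UNIV \<and> length xs = n}" by (auto simp: cube_def)
  thus ?thesis using finite_lists_length_eq[of "UNIV::bool set" n] by simp
qed

lemma card_cube: "card (cube n) = 2 ^ n"
proof -
  have "cube n = {xs. set xs \<subseteq> UNIV \<and> length xs = n}" by (auto simp: cube_def)
  thus ?thesis using card_lists_length_eq[of "UNIV::bool set" n] by simp
qed

lemma cube_Suc: "cube (Suc n) = (\<lambda>x. x @ [False]) ` cube n \<union> (\<lambda>x. x @ [True]) ` cube n"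
proof -
  have "x \<in> (\<lambda>x. x @ [False]) ` cube n \<union> (\<lambda>x. x @ [True]) ` cube n" if "x \<in> cube (Suc n)" for x
  proof -
    from that obtain y b where "x = y @ [b]" "y \<in> cube n"
      by (cases x rule: rev_cases) (auto simp: cube_def)
    thus ?thesis by (cases b) auto
  qed
  thus ?thesis by (auto simp: cube_def)
qed

lemma sum_cube_Suc:
  "(\<Sum>x\<in>cube (Suc n). F x) = (\<Sum>x\<in>cube n. F (x @ [False]) + F (x @ [True]))" for F :: "bool list \<Rightarrow> real"
proof -
  have "(\<Sum>x\<in>cube (Suc n). F x) =
      (\<Sum>x\<in>(\<lambda>x. x @ [False]) ` cube n. F x) + (\<Sum>x\<in>(\<lambda>x. x @ [True]) ` cube n. F x)"
    unfolding cube_Suc by (intro sum.union_disjoint) auto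
  thus ?thesis by (simp add: sum.reindex inj_on_def sum.distrib)
qed

lemma dot_append:
  assumes "x \<in> cube n"
  shows "dot (Suc n) (x @ [b]) y = dot n x y + of_bool b * of_bool (y ! n)"
  using assms by (simp add: dot_def cube_def nth_append)

lemma dot_commute: "dot n x y = dot n y x"
  by (simp add: dot_def mult.commute)

text \<open>Splitting off the last bit multiplies the sum by 2 if the last bits of \<open>y\<close>
  and \<open>z\<close> agree and by 0 if they differ.\<close>

lemma sum_character:
  assumes "y \<in> cube n" "z \<in> cube n"
  shows "(\<Sum>x\<in>cube n. (-1) ^ dot n x y * (-1) ^ dot n x z :: real) = (if y = z then 2 ^ n else 0)"
  using assms
proof (induction n arbitrary: y z)
  case 0
  thus ?case by (simp add: cube_def dot_def)
next
  case (Suc n)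
  obtain y' b where y: "y = y' @ [b]" "y' \<in> cube n"
    using Suc.prems(1) by (cases y rule: rev_cases) (auto simp: cube_def)
  obtain z' c where z: "z = z' @ [c]" "z' \<in> cube n"
    using Suc.prems(2) by (cases z rule: rev_cases) (auto simp: cube_def)
  have len: "length y' = n" "length z' = n" using y z by (auto simp: cube_def)
  have d: "dot n x (u @ [e]) = dot n x u" if "length u = n" for x u e
    using that by (simp add: dot_def nth_append)
  have "(\<Sum>x\<in>cube (Suc n). (-1) ^ dot (Suc n) x y * (-1) ^ dot (Suc n) x z :: real) =
      (\<Sum>x\<in>cube n. (-1) ^ dot n x y' * (-1) ^ dot n x z' * (1 + (-1) ^ of_bool b * (-1) ^ of_bool c))"
    unfolding sum_cube_Suc
    by (intro sum.cong) (auto simp: dot_append y z d len power_add algebra_simps nth_append)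
  also have "\<dots> = (if y' = z' then 2 ^ n else 0) * (1 + (-1) ^ of_bool b * (-1) ^ of_bool c)"
    by (simp only: sum_distrib_right [symmetric] Suc.IH[OF y(2) z(2)])
  also have "\<dots> = (if y = z then 2 ^ Suc n else 0)"
    by (cases b; cases c) (auto simp: y z)
  finally show ?case .
qed

definition had :: "nat \<Rightarrow> bool list \<Rightarrow> bool list \<Rightarrow> real" where
  "had n x y = (-1) ^ dot n x y / sqrt (2 ^ n)"

lemma had_commute: "had n x y = had n y x"
  by (simp add: had_def dot_commute)

lemma had_sq: "had n x y * had n x y = 1 / 2 ^ n"
  by (simp add: had_def power_divide flip: power_add mult_2)

lemma abs_had: "\<bar>had n x y\<bar> = 1 / sqrt (2 ^ n)"
  by (simp add: had_def power_abs)

lemma had_orthogonal: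
  assumes "y \<in> cube n" "z \<in> cube n"
  shows "(\<Sum>x\<in>cube n. had n x y * had n x z) = (if y = z then 1 else 0)"
proof -
  have "(\<Sum>x\<in>cube n. had n x y * had n x z) =
      (\<Sum>x\<in>cube n. (-1) ^ dot n x y * (-1) ^ dot n x z) / (sqrt (2 ^ n) * sqrt (2 ^ n))"
    by (simp add: had_def sum_divide_distrib)
  thus ?thesis by (simp add: sum_character[OF assms])
qed

lemma had_orthogonal':
  assumes "y \<in> cube n" "z \<in> cube n"
  shows "(\<Sum>x\<in>cube n. had n y x * had n z x) = (if y = z then 1 else 0)"
  using had_orthogonal[OF assms] by (simp add: had_commute)

text \<open>Restricted to the cube because the points of the product space
  \<open>gaussian (cube n)\<close> are extensional functions.\<close>

definition hadamard :: "nat \<Rightarrow> (bool list \<Rightarrow> real) \<Rightarrow> bool list \<Rightarrow> real" where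
  "hadamard n v = (\<lambda>y\<in>cube n. \<Sum>x\<in>cube n. had n x y * v x)"

lemma hadamard_apply: "y \<in> cube n \<Longrightarrow> hadamard n v y = (\<Sum>x\<in>cube n. had n x y * v x)"
  by (simp add: hadamard_def)

lemma hadamard_hadamard:
  assumes "y \<in> cube n"
  shows "hadamard n (hadamard n v) y = v y"
proof -
  have "hadamard n (hadamard n v) y = (\<Sum>x\<in>cube n. \<Sum>z\<in>cube n. had n x y * had n z x * v z)"
    using assms by (simp add: hadamard_apply sum_distrib_left mult.assoc)
  also have "\<dots> = (\<Sum>z\<in>cube n. (\<Sum>x\<in>cube n. had n x y * had n x z) * v z)"
    by (subst sum.swap) (simp add: sum_distrib_right had_commute[of n "z" for z])
  also have "\<dots> = (\<Sum>z\<in>cube n. if z = y then v z else 0)"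
    by (intro sum.cong refl) (use assms in \<open>auto simp: had_orthogonal\<close>)
  finally show ?thesis using assms by simp
qed

lemma sum_hadamard_sq:
  "(\<Sum>y\<in>cube n. (hadamard n v y)\<^sup>2) = (\<Sum>x\<in>cube n. (v x)\<^sup>2)"
proof -
  have "(\<Sum>y\<in>cube n. (hadamard n v y)\<^sup>2) =
      (\<Sum>y\<in>cube n. \<Sum>x\<in>cube n. hadamard n v y * (had n x y * v x))"
    by (simp add: power2_eq_square hadamard_apply sum_distrib_left)
  also have "\<dots> = (\<Sum>x\<in>cube n. v x * (\<Sum>y\<in>cube n. had n y x * hadamard n v y))"
    by (subst sum.swap) (simp add: sum_distrib_left had_commute mult_ac)
  also have "\<dots> = (\<Sum>x\<in>cube n. v x * hadamard n (hadamard n v) x)"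
    by (simp add: hadamard_apply)
  finally show ?thesis by (simp add: hadamard_hadamard power2_eq_square)
qed

section \<open>Invariance of the standard Gaussian measure under the Hadamard transform\<close>

abbreviation std_normal :: "real measure" where
  "std_normal \<equiv> std_normal_distribution"

abbreviation gaussian :: "'a set \<Rightarrow> ('a \<Rightarrow> real) measure" where
  "gaussian I \<equiv> PiM I (\<lambda>_. std_normal)"

lemma prob_space_std_normal: "prob_space std_normal"
  using real_dist_normal_dist by (simp add: real_distribution_def)

lemma product_prob_space_std_normal: "product_prob_space (\<lambda>_. std_normal)"
  by (intro product_prob_spaceI prob_space_std_normal)

lemma product_sigma_finite_std_normal: "product_sigma_finite (\<lambda>_. std_normal)"
  using product_prob_space_std_normal unfolding product_prob_space_def by blast

lemma prob_space_gaussian: "prob_space (gaussian I)"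
  by (intro prob_space_PiM prob_space_std_normal)

lemma sqrt2_double: "sqrt 2 * x - x / sqrt 2 = x / sqrt 2" 
  by (simp add: field_simps)

text \<open>The map preserves the sum of squares and hence the product density. The planar change of
  variables is done by two one-dimensional affine substitutions with Fubini in between; their
  factors \<open>sqrt 2\<close> and \<open>1 / sqrt 2\<close> cancel.\<close>

lemma std_normal_rotation:
  assumes [measurable]: "(\<lambda>(a, b). k a b) \<in> borel_measurable (borel \<Otimes>\<^sub>M borel)"
  shows "(\<integral>\<^sup>+a. \<integral>\<^sup>+b. k ((a + b) / sqrt 2) ((a - b) / sqrt 2) \<partial>std_normal \<partial>std_normal)
       = (\<integral>\<^sup>+a. \<integral>\<^sup>+b. k a b \<partial>std_normal \<partial>std_normal)"
proof -
  define \<phi> where "\<phi> x = ennreal (std_normal_density x)" for x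
  have [measurable]: "\<phi> \<in> borel_measurable borel" by (simp add: \<phi>_def [abs_def])
  have [measurable (raw)]: "(\<lambda>x. k (f x) (g x)) \<in> borel_measurable M"
    if "f \<in> borel_measurable M" "g \<in> borel_measurable M" for f g :: "'a \<Rightarrow> real" and M :: "'a measure"
    using measurable_compose[OF measurable_Pair[OF that] assms] by simp
  have \<phi>\<phi>: "\<phi> ((s + t) / sqrt 2) * \<phi> ((s - t) / sqrt 2) = \<phi> s * \<phi> t" for s t
  proof -
    have "- ((s + t) / sqrt 2)\<^sup>2 / 2 + (- ((s - t) / sqrt 2)\<^sup>2 / 2) = - s\<^sup>2 / 2 + (- t\<^sup>2 / 2)"
      by (simp add: power2_eq_square field_simps)
    hence "exp (- ((s + t) / sqrt 2)\<^sup>2 / 2) * exp (- ((s - t) / sqrt 2)\<^sup>2 / 2) = exp (- s\<^sup>2 / 2) * exp (- t\<^sup>2 / 2)"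
      by (simp only: exp_add [symmetric])
    thus ?thesis
      by (simp add: \<phi>_def std_normal_density_def divide_simps flip: ennreal_mult)
  qed
  have dens: "(\<integral>\<^sup>+a. \<integral>\<^sup>+b. q a b \<partial>std_normal \<partial>std_normal) =
      (\<integral>\<^sup>+a. \<integral>\<^sup>+b. \<phi> a * \<phi> b * q a b \<partial>lborel \<partial>lborel)"
    if [measurable]: "(\<lambda>(a, b). q a b) \<in> borel_measurable (borel \<Otimes>\<^sub>M borel)" for q :: "real \<Rightarrow> real \<Rightarrow> ennreal"
    by (simp add: nn_integral_density \<phi>_def [symmetric] nn_integral_cmult [symmetric] mult_ac)
  have "(\<integral>\<^sup>+a. \<integral>\<^sup>+b. k ((a + b) / sqrt 2) ((a - b) / sqrt 2) \<partial>std_normal \<partial>std_normal)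
     = (\<integral>\<^sup>+a. \<integral>\<^sup>+b. \<phi> a * \<phi> b * k ((a + b) / sqrt 2) ((a - b) / sqrt 2) \<partial>lborel \<partial>lborel)"
    by (rule dens) measurable
  also have "\<dots> = (\<integral>\<^sup>+b. \<integral>\<^sup>+a. \<phi> a * \<phi> b * k ((a + b) / sqrt 2) ((a - b) / sqrt 2) \<partial>lborel \<partial>lborel)"
    by (rule lborel_pair.Fubini') measurable
  \<comment> \<open>Substitutes s = (a + b) / sqrt 2 for \<open>a\<close>, with \<open>b\<close>
    fixed; the second argument of \<open>k\<close> becomes s - sqrt 2 b.\<close>
  also have "\<dots> = (\<integral>\<^sup>+b. ennreal (sqrt 2) * (\<integral>\<^sup>+s. \<phi> (sqrt 2 * s - b) * \<phi> b * k s (s - sqrt 2 * b) \<partial>lborel) \<partial>lborel)"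
  proof (intro nn_integral_cong)
    fix b :: real
    have "(\<integral>\<^sup>+a. \<phi> a * \<phi> b * k ((a + b) / sqrt 2) ((a - b) / sqrt 2) \<partial>lborel) =
      ennreal \<bar>sqrt 2\<bar> * (\<integral>\<^sup>+s. \<phi> (-b + sqrt 2 * s) * \<phi> b *
         k ((-b + sqrt 2 * s + b) / sqrt 2) ((-b + sqrt 2 * s - b) / sqrt 2) \<partial>lborel)"
      by (rule nn_integral_real_affine[where f = "\<lambda>a. \<phi> a * \<phi> b * k ((a + b) / sqrt 2) ((a - b) / sqrt 2)"
          and c = "sqrt 2" and t = "-b"]) auto
    moreover have "- b + sqrt 2 * s = sqrt 2 * s - b" "(sqrt 2 * s - b + b) / sqrt 2 = s"
      "(sqrt 2 * s - b - b) / sqrt 2 = s - sqrt 2 * b" for s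
      by (simp_all add: field_simps)
    ultimately show "(\<integral>\<^sup>+a. \<phi> a * \<phi> b * k ((a + b) / sqrt 2) ((a - b) / sqrt 2) \<partial>lborel) =
      ennreal (sqrt 2) * (\<integral>\<^sup>+s. \<phi> (sqrt 2 * s - b) * \<phi> b * k s (s - sqrt 2 * b) \<partial>lborel)"
      by (simp only:) simp
  qed
  also have "\<dots> = ennreal (sqrt 2) * (\<integral>\<^sup>+b. \<integral>\<^sup>+s. \<phi> (sqrt 2 * s - b) * \<phi> b * k s (s - sqrt 2 * b) \<partial>lborel \<partial>lborel)"
    by (rule nn_integral_cmult) measurable
  also have "(\<integral>\<^sup>+b. \<integral>\<^sup>+s. \<phi> (sqrt 2 * s - b) * \<phi> b * k s (s - sqrt 2 * b) \<partial>lborel \<partial>lborel) =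
     (\<integral>\<^sup>+s. \<integral>\<^sup>+b. \<phi> (sqrt 2 * s - b) * \<phi> b * k s (s - sqrt 2 * b) \<partial>lborel \<partial>lborel)"
    by (rule lborel_pair.Fubini') measurable
  \<comment> \<open>Substitutes t = s - sqrt 2 b for \<open>b\<close>, with \<open>s\<close>
    fixed.\<close>
  also have "\<dots> = (\<integral>\<^sup>+s. ennreal (1 / sqrt 2) * (\<integral>\<^sup>+t. \<phi> s * \<phi> t * k s t \<partial>lborel) \<partial>lborel)"
  proof (intro nn_integral_cong)
    fix s :: real
    have "(\<integral>\<^sup>+b. \<phi> (sqrt 2 * s - b) * \<phi> b * k s (s - sqrt 2 * b) \<partial>lborel) =
      ennreal \<bar>- (1 / sqrt 2)\<bar> * (\<integral>\<^sup>+t. \<phi> (sqrt 2 * s - (s / sqrt 2 + (- (1 / sqrt 2)) * t)) *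
         \<phi> (s / sqrt 2 + (- (1 / sqrt 2)) * t) * k s (s - sqrt 2 * (s / sqrt 2 + (- (1 / sqrt 2)) * t)) \<partial>lborel)"
      by (rule nn_integral_real_affine[where f = "\<lambda>b. \<phi> (sqrt 2 * s - b) * \<phi> b * k s (s - sqrt 2 * b)"
          and c = "- (1 / sqrt 2)" and t = "s / sqrt 2"]) auto
    moreover have "s / sqrt 2 + - (1 / sqrt 2) * t = (s - t) / sqrt 2" "s - sqrt 2 * ((s - t) / sqrt 2) = t"
      "sqrt 2 * s - (s - t) / sqrt 2 = (s + t) / sqrt 2" for t
      using sqrt2_double[of s] by (simp_all add: field_simps)
    ultimately show "(\<integral>\<^sup>+b. \<phi> (sqrt 2 * s - b) * \<phi> b * k s (s - sqrt 2 * b) \<partial>lborel) =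
       ennreal (1 / sqrt 2) * (\<integral>\<^sup>+t. \<phi> s * \<phi> t * k s t \<partial>lborel)"
      by (simp only: \<phi>\<phi>) simp
  qed
  also have "\<dots> = ennreal (1 / sqrt 2) * (\<integral>\<^sup>+s. \<integral>\<^sup>+t. \<phi> s * \<phi> t * k s t \<partial>lborel \<partial>lborel)"
    by (rule nn_integral_cmult) measurable
  also have "ennreal (sqrt 2) * (ennreal (1 / sqrt 2) * (\<integral>\<^sup>+s. \<integral>\<^sup>+t. \<phi> s * \<phi> t * k s t \<partial>lborel \<partial>lborel)) =
      (\<integral>\<^sup>+s. \<integral>\<^sup>+t. \<phi> s * \<phi> t * k s t \<partial>lborel \<partial>lborel)"
    by (simp add: mult.assoc [symmetric] ennreal_mult [symmetric])
  also have "\<dots> = (\<integral>\<^sup>+a. \<integral>\<^sup>+b. k a b \<partial>std_normal \<partial>std_normal)"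
    by (rule dens [symmetric]) measurable
  finally show ?thesis .
qed

text \<open>Integrating over the coordinates \<open>i\<close> and \<open>j\<close> innermost reduces
  this to the planar case. Nonnegative integrals avoid integrability questions, and indicator
  functions then give equality of the measures.\<close>

lemma gaussian_rotate:
  assumes "finite I" "i \<in> I" "j \<in> I" "i \<noteq> j"
  shows "distr (gaussian I) (gaussian I) (\<lambda>v. v(i := (v i + v j) / sqrt 2, j := (v i - v j) / sqrt 2))
       = gaussian I"
proof -
  define J where "J = I - {i, j}"
  have I: "I = insert j (insert i J)" "j \<notin> insert i J" "i \<notin> J" "finite J"
    using assms by (auto simp: J_def)
  define R where "R v = v(i := (v i + v j) / sqrt 2, j := (v i - v j) / sqrt 2)" for v :: "'a \<Rightarrow> real"
  have R [measurable]: "R \<in> gaussian I \<rightarrow>\<^sub>M gaussian I"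
  proof (rule measurable_PiM_single')
    fix l assume "l \<in> I"
    thus "(\<lambda>v. R v l) \<in> gaussian I \<rightarrow>\<^sub>M std_normal"
      using assms by (cases "l = i"; cases "l = j") (auto simp: R_def intro!: borel_measurable_divide)
  next
    show "R \<in> space (gaussian I) \<rightarrow> (\<Pi>\<^sub>E i\<in>I. space std_normal)"
      using assms by (auto simp: R_def space_PiM PiE_def extensional_def)
  qed
  interpret product_sigma_finite "\<lambda>_. std_normal" by (rule product_sigma_finite_std_normal)
  have unfold: "(\<integral>\<^sup>+v. h v \<partial>gaussian I) =
      (\<integral>\<^sup>+x. \<integral>\<^sup>+a. \<integral>\<^sup>+b. h (x(i := a, j := b)) \<partial>std_normal \<partial>std_normal \<partial>gaussian J)"
    if [measurable]: "h \<in> borel_measurable (gaussian I)" for h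
  proof -
    have "(\<integral>\<^sup>+v. h v \<partial>gaussian I) =
        (\<integral>\<^sup>+z. \<integral>\<^sup>+b. h (z(j := b)) \<partial>std_normal \<partial>gaussian (insert i J))"
      unfolding I(1) by (rule product_nn_integral_insert) (use I that in auto)
    also have "\<dots> = (\<integral>\<^sup>+x. \<integral>\<^sup>+a. \<integral>\<^sup>+b. h (x(i := a, j := b)) \<partial>std_normal \<partial>std_normal \<partial>gaussian J)"
    proof (rule product_nn_integral_insert)
      have [measurable]: "h \<in> borel_measurable (gaussian (insert j (insert i J)))"
        using that unfolding I(1) .
      show "(\<lambda>z. \<integral>\<^sup>+b. h (z(j := b)) \<partial>std_normal) \<in> borel_measurable (gaussian (insert i J))"
        by measurable
    qed (use I in auto)
    finally show ?thesis .
  qed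
  have inv: "(\<integral>\<^sup>+v. h (R v) \<partial>gaussian I) = (\<integral>\<^sup>+v. h v \<partial>gaussian I)"
    if [measurable]: "h \<in> borel_measurable (gaussian I)" for h
  proof -
    have "(\<integral>\<^sup>+v. h (R v) \<partial>gaussian I) =
      (\<integral>\<^sup>+x. \<integral>\<^sup>+a. \<integral>\<^sup>+b. h (R (x(i := a, j := b))) \<partial>std_normal \<partial>std_normal \<partial>gaussian J)"
      by (rule unfold) measurable
    also have "\<dots> = (\<integral>\<^sup>+x. \<integral>\<^sup>+a. \<integral>\<^sup>+b. h (x(i := a, j := b)) \<partial>std_normal \<partial>std_normal \<partial>gaussian J)"
    proof (rule nn_integral_cong)
      fix x assume x: "x \<in> space (gaussian J)"
      have eq: "R (x(i := a, j := b)) = x(i := (a + b) / sqrt 2, j := (a - b) / sqrt 2)" for a b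
        using assms(4) by (auto simp: R_def fun_upd_twist)
      have "(\<lambda>p. x(i := fst p, j := snd p)) \<in> borel \<Otimes>\<^sub>M borel \<rightarrow>\<^sub>M gaussian I"
      proof (rule measurable_PiM_single')
        fix l assume "l \<in> I"
        thus "(\<lambda>p. (x(i := fst p, j := snd p)) l) \<in> borel \<Otimes>\<^sub>M borel \<rightarrow>\<^sub>M std_normal"
          by (cases "l = i"; cases "l = j") auto
      next
        show "(\<lambda>p. x(i := fst p, j := snd p)) \<in> space (borel \<Otimes>\<^sub>M borel) \<rightarrow> (\<Pi>\<^sub>E i\<in>I. space std_normal)"
          using x assms by (auto simp: space_PiM PiE_def extensional_def I(1))
      qed
      from measurable_compose[OF this that]
      have "(\<lambda>(a, b). h (x(i := a, j := b))) \<in> borel_measurable (borel \<Otimes>\<^sub>M borel)"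
        by (simp add: case_prod_beta')
      from std_normal_rotation[OF this]
      show "(\<integral>\<^sup>+a. \<integral>\<^sup>+b. h (R (x(i := a, j := b))) \<partial>std_normal \<partial>std_normal) =
        (\<integral>\<^sup>+a. \<integral>\<^sup>+b. h (x(i := a, j := b)) \<partial>std_normal \<partial>std_normal)"
        by (simp only: eq)
    qed
    also have "\<dots> = (\<integral>\<^sup>+v. h v \<partial>gaussian I)" by (rule unfold [symmetric]) measurable
    finally show ?thesis .
  qed
  have "distr (gaussian I) (gaussian I) R = gaussian I"
  proof (rule measure_eqI)
    fix A assume "A \<in> sets (distr (gaussian I) (gaussian I) R)"
    hence A [measurable]: "A \<in> sets (gaussian I)" by simp
    have "emeasure (distr (gaussian I) (gaussian I) R) A =
        (\<integral>\<^sup>+v. indicator A v \<partial>distr (gaussian I) (gaussian I) R)" by simp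
    also have "\<dots> = (\<integral>\<^sup>+v. indicator A (R v) \<partial>gaussian I)"
      by (rule nn_integral_distr) measurable
    also have "\<dots> = (\<integral>\<^sup>+v. indicator A v \<partial>gaussian I)" by (rule inv) measurable
    finally show "emeasure (distr (gaussian I) (gaussian I) R) A = emeasure (gaussian I) A" by simp
  qed simp
  thus ?thesis unfolding R_def [abs_def] .
qed

text \<open>One level of the fast Walsh--Hadamard transform, restricted to the pairs indexed by \<open>S\<close>.\<close>

definition butterfly :: "nat \<Rightarrow> bool list set \<Rightarrow> (bool list \<Rightarrow> real) \<Rightarrow> bool list \<Rightarrow> real" where
  "butterfly k S v y = (if y[k := False] \<in> S
     then (v (y[k := False]) + (-1) ^ of_bool (y ! k) * v (y[k := True])) / sqrt 2 else v y)"

lemma measurable_distr_eq_comp: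
  assumes "f \<in> M \<rightarrow>\<^sub>M M" "g \<in> M \<rightarrow>\<^sub>M M" "distr M M f = M" "distr M M g = M"
  shows "(\<lambda>x. f (g x)) \<in> M \<rightarrow>\<^sub>M M \<and> distr M M (\<lambda>x. f (g x)) = M"
  using distr_distr[OF assms(1,2)] assms by (auto simp: comp_def)

text \<open>The pairs belonging to different elements of \<open>S\<close> are disjoint, so enlarging
  \<open>S\<close> by one element composes the map with one planar rotation.\<close>

lemma gaussian_butterfly:
  assumes "k < n" "S \<subseteq> {x \<in> cube n. \<not> x ! k}"
  shows "butterfly k S \<in> gaussian (cube n) \<rightarrow>\<^sub>M gaussian (cube n) \<and>
         distr (gaussian (cube n)) (gaussian (cube n)) (butterfly k S) = gaussian (cube n)"
proof -
  have "finite S" by (rule finite_subset[OF assms(2)]) simp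
  thus ?thesis using assms(2)
  proof induction
    case empty
    have "butterfly k {} = (\<lambda>v. v)" by (simp add: butterfly_def fun_eq_iff)
    thus ?case by (simp add: distr_id)
  next
    case (insert x S)
    define x' where "x' = x[k := True]"
    define R where "R v = v(x := (v x + v x') / sqrt 2, x' := (v x - v x') / sqrt 2)" for v :: "bool list \<Rightarrow> real"
    have x: "x \<in> cube n" "\<not> x ! k" "length x = n" using insert by (auto simp: cube_def)
    have x': "x' \<in> cube n" "x' ! k" "x' \<noteq> x" "x'[k := False] = x"
      using x assms(1) by (auto simp: x'_def cube_def list_update_same_conv)
    have upd: "x[k := False] = x" "x[k := True] = x'" "x'[k := True] = x'"
      using x assms(1) by (auto simp: x'_def list_update_same_conv)
    have eq: "butterfly k (insert x S) v = R (butterfly k S v)" for v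
    proof
      fix y
      consider "y = x" | "y = x'" | "y \<noteq> x" "y \<noteq> x'" by blast
      thus "butterfly k (insert x S) v y = R (butterfly k S v) y"
      proof cases
        case 1
        thus ?thesis using x x' insert(2) by (simp add: butterfly_def R_def upd)
      next
        case 2
        thus ?thesis using x x' insert(2) by (simp add: butterfly_def R_def upd)
      next
        case 3
        have "y[k := False] \<noteq> x"
        proof
          assume h: "y[k := False] = x"
          hence l: "length y = n" using x by auto
          have "y = x[k := y ! k]" using h[symmetric] l assms(1) by (simp add: list_update_same_conv)
          thus False using 3 x assms(1) by (cases "y ! k") (auto simp: x'_def list_update_same_conv)
        qed
        thus ?thesis using 3 by (simp add: butterfly_def R_def)
      qed
    qed
    have "distr (gaussian (cube n)) (gaussian (cube n)) R = gaussian (cube n)"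
      unfolding R_def [abs_def] by (rule gaussian_rotate) (use x x' in auto)
    moreover have "R \<in> gaussian (cube n) \<rightarrow>\<^sub>M gaussian (cube n)"
    proof (rule measurable_PiM_single')
      fix l assume "l \<in> cube n"
      thus "(\<lambda>v. R v l) \<in> gaussian (cube n) \<rightarrow>\<^sub>M std_normal"
        using x x' by (cases "l = x"; cases "l = x'") (auto simp: R_def intro!: borel_measurable_divide)
    next
      show "R \<in> space (gaussian (cube n)) \<rightarrow> (\<Pi>\<^sub>E i\<in>cube n. space std_normal)"
        using x x' by (auto simp: R_def space_PiM PiE_def extensional_def)
    qed
    ultimately have "(\<lambda>v. R (butterfly k S v)) \<in> gaussian (cube n) \<rightarrow>\<^sub>M gaussian (cube n) \<and>
        distr (gaussian (cube n)) (gaussian (cube n)) (\<lambda>v. R (butterfly k S v)) = gaussian (cube n)"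
      by (intro measurable_distr_eq_comp) (use insert in auto)
    moreover have "butterfly k (insert x S) = (\<lambda>v. R (butterfly k S v))" using eq by blast
    ultimately show ?case by simp
  qed
qed

text \<open>The normalized transform in the first \<open>k\<close> bits only: the identity for
  \<open>k = 0\<close>, the full transform for \<open>k = n\<close>, and one butterfly level between
  consecutive values.\<close>

definition partial_hadamard :: "nat \<Rightarrow> nat \<Rightarrow> (bool list \<Rightarrow> real) \<Rightarrow> bool list \<Rightarrow> real" where
  "partial_hadamard n k v = (\<lambda>y\<in>cube n. \<Sum>z\<in>cube k. had k z y * v (z @ drop k y))"

lemma had_append:
  assumes "z \<in> cube k"
  shows "had (Suc k) (z @ [b]) y = had k z y * ((-1) ^ (of_bool b * of_bool (y ! k)) / sqrt 2)"
  using assms by (simp add: had_def dot_append power_add real_sqrt_mult)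

lemma partial_hadamard_Suc:
  assumes "k < n"
  shows "partial_hadamard n (Suc k) v = butterfly k {x \<in> cube n. \<not> x ! k} (partial_hadamard n k v)"
proof
  fix y
  show "partial_hadamard n (Suc k) v y = butterfly k {x \<in> cube n. \<not> x ! k} (partial_hadamard n k v) y"
  proof (cases "y \<in> cube n")
    case False
    thus ?thesis by (auto simp: partial_hadamard_def butterfly_def cube_def)
  next
    case True
    have upd: "y[k := b] \<in> cube n" "drop k (y[k := b]) = b # drop (Suc k) y" "had k z (y[k := b]) = had k z y" for b z
      using True assms by (auto simp: cube_def had_def dot_def Cons_nth_drop_Suc [symmetric])
    have "partial_hadamard n (Suc k) v y =
      (\<Sum>z\<in>cube k. had k z y * (v (z @ False # drop (Suc k) y) +
        (-1) ^ of_bool (y ! k) * v (z @ True # drop (Suc k) y)) / sqrt 2)"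
      using True by (simp add: partial_hadamard_def sum_cube_Suc had_append) (auto intro!: sum.cong simp: field_simps)
    also have "\<dots> = (partial_hadamard n k v (y[k := False]) +
        (-1) ^ of_bool (y ! k) * partial_hadamard n k v (y[k := True])) / sqrt 2"
      by (simp add: partial_hadamard_def upd sum_divide_distrib sum_distrib_left sum.distrib [symmetric])
         (auto intro!: sum.cong simp: field_simps sum_subtractf [symmetric] sum.distrib [symmetric])
    also have "\<dots> = butterfly k {x \<in> cube n. \<not> x ! k} (partial_hadamard n k v) y"
      using upd True assms by (simp add: butterfly_def cube_def)
    finally show ?thesis .
  qed
qed

text \<open>Factoring the transform into butterfly levels means that invariance under planar
  rotations suffices; general orthogonal maps never appear.\<close>

lemma gaussian_hadamard:
  "hadamard n \<in> gaussian (cube n) \<rightarrow>\<^sub>M gaussian (cube n)"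
  "distr (gaussian (cube n)) (gaussian (cube n)) (hadamard n) = gaussian (cube n)"
proof -
  have "partial_hadamard n k \<in> gaussian (cube n) \<rightarrow>\<^sub>M gaussian (cube n) \<and>
      distr (gaussian (cube n)) (gaussian (cube n)) (partial_hadamard n k) = gaussian (cube n)" if "k \<le> n" for k
    using that
  proof (induction k)
    case 0
    have "partial_hadamard n 0 v = v" if "v \<in> space (gaussian (cube n))" for v
      using that by (auto simp: partial_hadamard_def cube_def had_def dot_def space_PiM PiE_def extensional_def fun_eq_iff)
    thus ?case
      by (simp add: distr_id cong: measurable_cong distr_cong)
  next
    case (Suc k)
    have "partial_hadamard n (Suc k) = (\<lambda>v. butterfly k {x \<in> cube n. \<not> x ! k} (partial_hadamard n k v))"
      using Suc.prems by (intro ext) (simp add: partial_hadamard_Suc)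
    thus ?case
      using measurable_distr_eq_comp gaussian_butterfly[of k n "{x \<in> cube n. \<not> x ! k}"] Suc by auto
  qed
  from this[of n] have "partial_hadamard n n \<in> gaussian (cube n) \<rightarrow>\<^sub>M gaussian (cube n) \<and>
      distr (gaussian (cube n)) (gaussian (cube n)) (partial_hadamard n n) = gaussian (cube n)" by simp
  moreover have "partial_hadamard n n = hadamard n"
    by (intro ext) (auto simp: partial_hadamard_def hadamard_def cube_def restrict_def)
  ultimately show "hadamard n \<in> gaussian (cube n) \<rightarrow>\<^sub>M gaussian (cube n)"
    "distr (gaussian (cube n)) (gaussian (cube n)) (hadamard n) = gaussian (cube n)" by auto
qed

section \<open>Reweighted normal distributions\<close>

text \<open>The value at 0 is -1, so that the result is always a sign. Oddness then holds only
  almost everywhere, which is why it appears below as an \<open>AE\<close> condition.\<close>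

definition sg :: "real \<Rightarrow> real" where
  "sg t = (if t > 0 then 1 else - 1)"

lemma sg_measurable [measurable]: "sg \<in> borel_measurable borel"
  unfolding sg_def [abs_def] by measurable

lemma abs_sg [simp]: "\<bar>sg t\<bar> = 1"
  by (simp add: sg_def)

lemma sg_sq [simp]: "sg t * sg t = 1"
  by (simp add: sg_def)

lemma integrable_std_normal_bounded:
  fixes h :: "real \<Rightarrow> 'b::{banach,second_countable_topology}"
  assumes [measurable]: "h \<in> borel_measurable borel" and "\<And>z. norm (h z) \<le> C"
  shows "integrable std_normal h"
proof -
  interpret prob_space std_normal by (rule prob_space_std_normal)
  show ?thesis using assms(2) by (intro integrable_const_bound[of _ C]) auto
qed

lemma integrable_moment_bounded:
  assumes [measurable]: "h \<in> borel_measurable borel" and "\<And>z. \<bar>h z\<bar> \<le> C"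
  shows "integrable std_normal (\<lambda>z. z ^ k * h z)"
proof (rule Bochner_Integration.integrable_bound)
  show "integrable std_normal (\<lambda>z. C * z ^ k)"
    using integrable_std_normal_distribution_moment[of k] by simp
  show "AE z in std_normal. norm (z ^ k * h z) \<le> norm (C * z ^ k)"
    using order_trans[OF assms(2) abs_ge_self]
    by (intro AE_I2) (simp add: abs_mult mult.commute mult_right_mono)
qed measurable

lemma std_normal_reflect:
  fixes h :: "real \<Rightarrow> real"
  assumes [measurable]: "h \<in> borel_measurable borel"
  shows "(\<integral>z. h (- z) \<partial>std_normal) = (\<integral>z. h z \<partial>std_normal)"
proof -
  have "(\<integral>z. h z \<partial>std_normal) = (\<integral>z. std_normal_density z * h z \<partial>lborel)"
    by (simp add: integral_density)
  also have "\<dots> = \<bar>-1\<bar> *\<^sub>R (\<integral>z. std_normal_density (0 + -1 * z) * h (0 + -1 * z) \<partial>lborel)"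
    by (rule lborel_integral_real_affine) simp
  also have "\<dots> = (\<integral>z. h (- z) \<partial>std_normal)"
    by (simp add: integral_density std_normal_density_def)
  finally show ?thesis by simp
qed

lemma std_normal_odd:
  fixes h :: "real \<Rightarrow> real"
  assumes "h \<in> borel_measurable borel" and "AE z in std_normal. h (- z) = - h z"
  shows "(\<integral>z. h z \<partial>std_normal) = 0"
proof -
  have "(\<integral>z. h (- z) \<partial>std_normal) = (\<integral>z. - h z \<partial>std_normal)"
    by (rule integral_cong_AE) (use assms in auto)
  thus ?thesis using std_normal_reflect[OF assms(1)] by simp
qed

lemma AE_std_normal_neq: "AE z in std_normal. z \<noteq> c"
proof -
  have "AE z in lborel. z \<noteq> c" by (rule AE_lborel_singleton)
  thus ?thesis by (subst AE_density) auto
qed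

text \<open>Mass, mean and second moment of the measure with density \<open>p\<close> relative to
  the standard normal one. With mass and second moment fixed at 1, the mean \<open>m\<close> is the
  only parameter, and the variance is 1 - m^2.\<close>

definition normal_weight :: "(real \<Rightarrow> real) \<Rightarrow> real \<Rightarrow> bool" where
  "normal_weight p m \<longleftrightarrow>
     has_bochner_integral std_normal p 1 \<and>
     has_bochner_integral std_normal (\<lambda>z. z * p z) m \<and>
     has_bochner_integral std_normal (\<lambda>z. z\<^sup>2 * p z) 1"

text \<open>An odd perturbation contributes nothing to the moments of order 0 and 2, by
  reflection.\<close>

lemma normal_weight_odd:
  assumes [measurable]: "h \<in> borel_measurable borel" and bd: "\<And>z. \<bar>h z\<bar> \<le> C"
    and odd: "AE z in std_normal. h (- z) = - h z"
  shows "normal_weight (\<lambda>z. 1 + b * h z) (b * (\<integral>z. z * h z \<partial>std_normal))"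
proof -
  interpret prob_space std_normal by (rule prob_space_std_normal)
  have int: "integrable std_normal (\<lambda>z. z ^ k * h z)" for k
    by (rule integrable_moment_bounded) (use assms in auto)
  have mom: "integrable std_normal (\<lambda>z. z ^ k)" for k :: nat
    by (rule integrable_std_normal_distribution_moment)
  define e where "e k = (\<integral>z. z ^ k * h z \<partial>std_normal)" for k
  have e: "e 0 = 0" "e 2 = 0"
    unfolding e_def using odd by (auto intro!: std_normal_odd)
  have "has_bochner_integral std_normal (\<lambda>z. z ^ k + b * (z ^ k * h z))
      ((\<integral>z. z ^ k \<partial>std_normal) + b * e k)" for k
    unfolding e_def
    by (intro has_bochner_integral_add has_bochner_integral_mult_right has_bochner_integral_integrable int mom)
  hence *: "has_bochner_integral std_normal (\<lambda>z. z ^ k * (1 + b * h z))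
      ((\<integral>z. z ^ k \<partial>std_normal) + b * e k)" for k
    by (simp add: algebra_simps)
  have "prob UNIV = 1" using prob_space by simp
  hence "(\<integral>z. z ^ 0 \<partial>std_normal) = 1" "(\<integral>z. z ^ 1 \<partial>std_normal) = 0"
    "(\<integral>z. z ^ 2 \<partial>std_normal) = 1"
    using integral_std_normal_distribution_moment_odd[of 1] std_normal_distribution_even_moments(1)[of 1]
    by (simp_all add: prob_space)
  thus ?thesis
    using *[of 0] *[of 1] *[of 2] e by (simp add: normal_weight_def e_def)
qed

lemma normal_weight_one: "normal_weight (\<lambda>_. 1) 0"
  using normal_weight_odd[of "\<lambda>_. 0" 0 0] by simp

lemma mean_sg: "(\<integral>z. z * sg z \<partial>std_normal) = sqrt (2 / pi)"
proof -
  have "z * sg z = \<bar>z\<bar> ^ (2 * 0 + 1)" for z by (simp add: sg_def)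
  thus ?thesis using std_normal_distribution_odd_moments_abs[of 0] by simp
qed

lemma normal_weight_sg: "normal_weight (\<lambda>z. 1 + b * sg z) (b * sqrt (2 / pi))"
proof -
  have "AE z in std_normal. sg (- z) = - sg z"
    using AE_std_normal_neq[of 0] by eventually_elim (auto simp: sg_def)
  from normal_weight_odd[of sg 1, OF _ _ this] show ?thesis by (simp add: mean_sg)
qed

section \<open>Moments under products of coordinate weights\<close>

lemma gaussian_prod:
  fixes p :: "'i \<Rightarrow> real \<Rightarrow> 'b::{real_normed_field,banach,second_countable_topology}"
  assumes "finite I" "\<And>i. i \<in> I \<Longrightarrow> has_bochner_integral std_normal (p i) (e i)"
  shows "has_bochner_integral (gaussian I) (\<lambda>w. \<Prod>i\<in>I. p i (w i)) (\<Prod>i\<in>I. e i)"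
proof -
  interpret product_sigma_finite "\<lambda>_::'i. std_normal" by (rule product_sigma_finite_std_normal)
  show ?thesis
    using product_integrable_prod[of I p] product_integral_prod[of I p] assms
    by (auto simp: has_bochner_integral_iff)
qed

text \<open>Absorbing the coordinate \<open>w a\<close> into the factor at \<open>a\<close> keeps
  the integrand a product over coordinates, so independence still applies.\<close>

lemma gaussian_prod_linear:
  fixes p :: "'i \<Rightarrow> real \<Rightarrow> real"
  assumes "finite I" "a \<in> I" "\<And>i. i \<in> I \<Longrightarrow> has_bochner_integral std_normal (p i) (e i)"
    and "has_bochner_integral std_normal (\<lambda>z. z * p a z) m"
  shows "has_bochner_integral (gaussian I) (\<lambda>w. w a * (\<Prod>i\<in>I. p i (w i))) (m * (\<Prod>i\<in>I - {a}. e i))"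
proof -
  have "has_bochner_integral (gaussian I) (\<lambda>w. \<Prod>i\<in>I. (p(a := \<lambda>z. z * p a z)) i (w i)) (\<Prod>i\<in>I. (e(a := m)) i)"
    by (rule gaussian_prod) (use assms in auto)
  moreover have "(\<Prod>i\<in>I. (p(a := \<lambda>z. z * p a z)) i (w i)) = w a * (\<Prod>i\<in>I. p i (w i))" for w
    using assms by (simp add: prod.remove[of I a])
  moreover have "(\<Prod>i\<in>I. (e(a := m)) i) = m * (\<Prod>i\<in>I - {a}. e i)"
    using assms by (simp add: prod.remove[of I a])
  ultimately show ?thesis by simp
qed

lemma gaussian_weight_linear:
  assumes "finite I" "a \<in> I" "\<And>i. i \<in> I \<Longrightarrow> normal_weight (p i) (m i)"
  shows "has_bochner_integral (gaussian I) (\<lambda>w. w a * (\<Prod>i\<in>I. p i (w i))) (m a)"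
  using gaussian_prod_linear[of I a p "\<lambda>_. 1" "m a"] assms by (simp add: normal_weight_def)

lemma gaussian_weight_quadratic:
  assumes "finite I" "a \<in> I" "b \<in> I" "\<And>i. i \<in> I \<Longrightarrow> normal_weight (p i) (m i)"
  shows "has_bochner_integral (gaussian I) (\<lambda>w. w a * w b * (\<Prod>i\<in>I. p i (w i)))
     (if a = b then 1 else m a * m b)"
proof (cases "a = b")
  case True
  have "has_bochner_integral (gaussian I) (\<lambda>w. \<Prod>i\<in>I. (p(a := \<lambda>z. z\<^sup>2 * p a z)) i (w i)) (\<Prod>i\<in>I. 1)"
    by (rule gaussian_prod) (use assms in \<open>auto simp: normal_weight_def\<close>)
  moreover have "(\<Prod>i\<in>I. (p(a := \<lambda>z. z\<^sup>2 * p a z)) i (w i)) = w a * w b * (\<Prod>i\<in>I. p i (w i))" for w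
    using assms True by (simp add: prod.remove[of I a] power2_eq_square)
  ultimately show ?thesis using True by simp
next
  case False
  have "has_bochner_integral (gaussian I) (\<lambda>w. w a * (\<Prod>i\<in>I. (p(b := \<lambda>z. z * p b z)) i (w i)))
      (m a * (\<Prod>i\<in>I - {a}. ((\<lambda>_. 1)(b := m b)) i))"
    by (rule gaussian_prod_linear) (use assms False in \<open>auto simp: normal_weight_def\<close>)
  moreover have "(\<Prod>i\<in>I. (p(b := \<lambda>z. z * p b z)) i (w i)) = w b * (\<Prod>i\<in>I. p i (w i))" for w
    using assms False by (simp add: prod.remove[of I b])
  moreover have "(\<Prod>i\<in>I - {a}. ((\<lambda>_. 1)(b := m b)) i) = m b"
    using assms False by (simp add: prod.remove[of "I - {a}" b])
  ultimately show ?thesis using False by (simp add: mult.assoc)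
qed

text \<open>Squared mean plus variance of a linear form in independent variables with means
  \<open>m\<close> and second moments 1. It serves both for weighted Gaussians and for random
  signs.\<close>

lemma sum_pairwise_uncorrelated:
  fixes c m :: "'i \<Rightarrow> real"
  assumes "finite I"
  shows "(\<Sum>a\<in>I. \<Sum>b\<in>I. c a * c b * (if a = b then 1 else m a * m b)) =
     (\<Sum>a\<in>I. c a * m a)\<^sup>2 + (\<Sum>a\<in>I. (c a)\<^sup>2 * (1 - (m a)\<^sup>2))"
proof -
  have "(\<Sum>b\<in>I. c a * c b * (if a = b then 1 else m a * m b)) =
      (\<Sum>b\<in>I. c a * m a * (c b * m b)) + (c a)\<^sup>2 * (1 - (m a)\<^sup>2)" if "a \<in> I" for a
  proof -
    have "(\<Sum>b\<in>I. c a * c b * (if a = b then 1 else m a * m b)) =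
      (\<Sum>b\<in>I. c a * m a * (c b * m b) + (if b = a then (c a)\<^sup>2 * (1 - (m a)\<^sup>2) else 0))"
      by (intro sum.cong) (auto simp: algebra_simps power2_eq_square)
    thus ?thesis using that assms by (simp add: sum.distrib)
  qed
  thus ?thesis by (simp add: sum.distrib power2_eq_square sum_product)
qed

lemma gaussian_weight_square:
  assumes "finite I" "\<And>i. i \<in> I \<Longrightarrow> normal_weight (p i) (m i)"
  shows "has_bochner_integral (gaussian I) (\<lambda>w. (\<Sum>i\<in>I. c i * w i)\<^sup>2 * (\<Prod>i\<in>I. p i (w i)))
     ((\<Sum>i\<in>I. c i * m i)\<^sup>2 + (\<Sum>i\<in>I. (c i)\<^sup>2 * (1 - (m i)\<^sup>2)))"
proof -
  have "has_bochner_integral (gaussian I) (\<lambda>w. \<Sum>a\<in>I. \<Sum>b\<in>I. c a * c b * (w a * w b * (\<Prod>i\<in>I. p i (w i))))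
     (\<Sum>a\<in>I. \<Sum>b\<in>I. c a * c b * (if a = b then 1 else m a * m b))"
    by (intro has_bochner_integral_sum has_bochner_integral_mult_right gaussian_weight_quadratic) (use assms in auto)
  moreover have "(\<Sum>a\<in>I. \<Sum>b\<in>I. c a * c b * (w a * w b * (\<Prod>i\<in>I. p i (w i)))) =
     (\<Sum>i\<in>I. c i * w i)\<^sup>2 * (\<Prod>i\<in>I. p i (w i))" for w
    unfolding power2_eq_square sum_product sum_distrib_right by (intro sum.cong refl) (simp add: sum_distrib_left mult_ac)
  ultimately show ?thesis by (simp add: sum_pairwise_uncorrelated[OF assms(1)])
qed

section \<open>Smooth rounding functions and their reaction to a shift\<close>

locale rounding =
  fixes \<psi> \<psi>' \<psi>'' :: "real \<Rightarrow> real" and \<rho> D :: real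
  assumes deriv: "(\<psi> has_real_derivative \<psi>' z) (at z)"
    and deriv': "(\<psi>' has_real_derivative \<psi>'' z) (at z)"
    and bound: "\<bar>\<psi> z\<bar> \<le> \<rho>" and \<rho>: "\<rho> < 1"
    and bound': "\<bar>\<psi>' z\<bar> \<le> D" and bound'': "\<bar>\<psi>'' z\<bar> \<le> D"
    and odd: "\<psi> (- z) = - \<psi> z" and even: "\<psi>' (- z) = \<psi>' z"
begin

lemma measurable_psi [measurable]:
  "\<psi> \<in> borel_measurable borel" "\<psi>' \<in> borel_measurable borel"
  using deriv deriv' by (auto intro!: borel_measurable_continuous_onI continuous_at_imp_continuous_on
      intro: DERIV_isCont)

lemma D_nonneg: "D \<ge> 0"
  using bound'[of 0] by simp

lemma weight_pos: "\<bar>b\<bar> = 1 \<Longrightarrow> 1 + b * \<psi> z \<ge> 1 - \<rho>"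
  using bound[of z] by (auto simp: abs_if split: if_splits)

text \<open>With q = 1 + b \<psi> and d = D / (1 - \<rho>), the second derivative of ln q is q''/q -
  (q'/q)^2, which is at least -(d + d^2) = -\<open>curv\<close>. Hence adding
  \<open>curv * t\<^sup>2\<close> to ln q makes it convex.\<close>

definition curv :: real where
  "curv = (D / (1 - \<rho>))\<^sup>2 + D / (1 - \<rho>)"

lemma curv_nonneg: "curv \<ge> 0"
  using D_nonneg \<rho> by (simp add: curv_def)

text \<open>The function ln (1 + b \<psi>(w + t)) + curv t^2 of \<open>t\<close> is convex and lies
  above its tangent at 0. Exponentiating the tangent inequality gives the claim.\<close>

lemma weight_shift:
  assumes b: "\<bar>b\<bar> = 1"
  shows "(1 + b * \<psi> w) * exp (b * \<psi>' w / (1 + b * \<psi> w) * u - curv * u\<^sup>2) \<le> 1 + b * \<psi> (w + u)"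
proof -
  define q where "q t = 1 + b * \<psi> (w + t)" for t
  have q: "q t \<ge> 1 - \<rho>" "q t > 0" for t
    using weight_pos[OF b, of "w + t"] \<rho> by (auto simp: q_def)
  have dq: "(q has_real_derivative b * \<psi>' (w + t)) (at t)" for t
    unfolding q_def [abs_def] by (auto intro!: derivative_eq_intros DERIV_chain'[OF _ deriv, of _ 1, simplified])
  have dq': "((\<lambda>t. b * \<psi>' (w + t)) has_real_derivative b * \<psi>'' (w + t)) (at t)" for t
    by (auto intro!: derivative_eq_intros DERIV_chain'[OF _ deriv', of _ 1, simplified])
  define h where "h t = ln (q t) + curv * t\<^sup>2" for t
  define h' where "h' t = b * \<psi>' (w + t) / q t + 2 * curv * t" for t
  define h'' where "h'' t = (b * \<psi>'' (w + t) * q t - (b * \<psi>' (w + t)) * (b * \<psi>' (w + t))) / (q t * q t) + 2 * curv" for t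
  have dh: "(h has_real_derivative h' t) (at t)" for t
    unfolding h_def [abs_def] h'_def using q(2)[of t]
    by (auto intro!: derivative_eq_intros dq simp: field_simps)
  have dh': "(h' has_real_derivative h'' t) (at t)" for t
    unfolding h'_def [abs_def] h''_def using q(2)[of t]
    by (intro DERIV_add DERIV_divide dq' dq DERIV_cmult_Id) simp
  define d where "d = D / (1 - \<rho>)"
  have curv: "curv = d\<^sup>2 + d" by (simp add: curv_def d_def)
  have "h'' t \<ge> 0" for t
  proof -
    have 1: "\<bar>b * \<psi>' (w + t) / q t\<bar> \<le> d" "\<bar>b * \<psi>'' (w + t) / q t\<bar> \<le> d"
      unfolding d_def
      using b bound'[of "w + t"] bound''[of "w + t"] q[of t] \<rho> by (auto simp: abs_mult intro!: frac_le)
    define r s where "r = b * \<psi>' (w + t) / q t" and "s = b * \<psi>'' (w + t) / q t"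
    have "r\<^sup>2 \<le> d\<^sup>2"
      using 1(1) unfolding r_def [symmetric] by (metis abs_ge_zero power2_abs power_mono)
    moreover have "- s \<le> d"
      using 1(2) unfolding s_def [symmetric] by simp
    moreover have "h'' t = s - r\<^sup>2 + 2 * curv"
      using q(2)[of t] by (simp add: h''_def r_def s_def field_simps power2_eq_square)
    ultimately show ?thesis using curv_nonneg unfolding curv by (simp add: algebra_simps)
  qed
  hence "convex_on UNIV h"
    by (intro f''_ge0_imp_convex[of _ _ h' h'']) (use dh dh' in auto)
  hence "h' 0 * (u - 0) \<le> h u - h 0"
    by (rule convex_on_imp_above_tangent) (use dh in auto)
  hence "ln (q 0) + (b * \<psi>' w / q 0 * u - curv * u\<^sup>2) \<le> ln (q u)"
    by (simp add: h_def h'_def)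
  hence "exp (ln (q 0) + (b * \<psi>' w / q 0 * u - curv * u\<^sup>2)) \<le> exp (ln (q u))"
    by (simp only: exp_le_cancel_iff)
  hence "q 0 * exp (b * \<psi>' w / q 0 * u - curv * u\<^sup>2) \<le> q u"
    using q(2) by (simp only: exp_add exp_ln)
  thus ?thesis by (simp add: q_def)
qed

text \<open>The exponents of the factors are added before exp e \<ge> 1 + e is applied once to their
  sum. Multiplying out cancels the denominator 1 + b \<psi>, so each linear term is again a product
  over coordinates, with \<psi>' in place of the factor at \<open>y\<close>; such terms integrate by
  independence.\<close>

lemma prod_weight_shift:
  assumes "finite B" and b: "\<And>y. y \<in> B \<Longrightarrow> \<bar>b y\<bar> = 1"
  shows "(\<Prod>y\<in>B. 1 + b y * \<psi> (w y))
      + (\<Sum>y\<in>B. u y * (b y * \<psi>' (w y) * (\<Prod>z\<in>B - {y}. 1 + b z * \<psi> (w z))))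
      - curv * (\<Sum>y\<in>B. (u y)\<^sup>2) * (\<Prod>y\<in>B. 1 + b y * \<psi> (w y))
    \<le> (\<Prod>y\<in>B. 1 + b y * \<psi> (w y + u y))"
proof -
  define q where "q y = 1 + b y * \<psi> (w y)" for y
  have q: "q y > 0" if "y \<in> B" for y
    using weight_pos[OF b[OF that], of "w y"] \<rho> by (simp add: q_def)
  define e where "e y = b y * \<psi>' (w y) / q y * u y - curv * (u y)\<^sup>2" for y
  have "prod q B * (1 + (\<Sum>y\<in>B. e y)) \<le> prod q B * exp (\<Sum>y\<in>B. e y)"
    by (intro mult_left_mono exp_ge_add_one_self prod_nonneg) (use q in \<open>auto intro: less_imp_le\<close>)
  also have "\<dots> = (\<Prod>y\<in>B. q y * exp (e y))"
    by (simp add: exp_sum[OF assms(1)] prod.distrib)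
  also have "\<dots> \<le> (\<Prod>y\<in>B. 1 + b y * \<psi> (w y + u y))"
    using q weight_shift[OF b, of _ "w _" "u _"] by (intro prod_mono) (auto simp: q_def e_def less_imp_le)
  finally have "prod q B * (1 + (\<Sum>y\<in>B. e y)) \<le> (\<Prod>y\<in>B. 1 + b y * \<psi> (w y + u y))" .
  moreover have "prod q B * (b y * \<psi>' (w y) / q y * u y) = u y * (b y * \<psi>' (w y) * prod q (B - {y}))" if "y \<in> B" for y
    using q[OF that] assms(1) that by (simp add: prod.remove[of B y])
  hence "prod q B * (1 + (\<Sum>y\<in>B. e y)) = prod q B + (\<Sum>y\<in>B. u y * (b y * \<psi>' (w y) * prod q (B - {y})))
      - curv * (\<Sum>y\<in>B. (u y)\<^sup>2) * prod q B"
    by (simp add: e_def sum_subtractf sum_distrib_left algebra_simps)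
  ultimately show ?thesis by (simp add: q_def [abs_def])
qed

end

section \<open>The likelihood ratio of a leaf\<close>

lemma mean_abs_bounded:
  assumes [measurable]: "h \<in> borel_measurable borel" and "\<And>z. \<bar>h z\<bar> \<le> 1"
  shows "\<bar>\<integral>z. z * h z \<partial>std_normal\<bar> \<le> 1"
proof -
  have k: "sqrt (2 / pi) \<le> 1" using pi_gt3 by simp
  have i: "integrable std_normal (\<lambda>z. \<bar>z\<bar>)"
    using integrable_abs[OF integrable_std_normal_distribution_moment[of 1]] by simp
  have "\<bar>\<integral>z. z * h z \<partial>std_normal\<bar> \<le> (\<integral>z. \<bar>z * h z\<bar> \<partial>std_normal)"
    by (rule integral_abs_bound)
  also have "\<dots> \<le> (\<integral>z. \<bar>z\<bar> \<partial>std_normal)"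
    using integrable_abs[OF integrable_moment_bounded[OF assms, of 1]] i assms(2)
    by (intro integral_mono) (auto simp: abs_mult mult_left_le)
  also have "\<dots> = sqrt (2 / pi)" using std_normal_distribution_odd_moments_abs[of 0] by simp
  finally show ?thesis using k by linarith
qed

lemma abs_prod_le:
  fixes p :: "'i \<Rightarrow> real"
  assumes "\<And>x. x \<in> A \<Longrightarrow> \<bar>p x\<bar> \<le> 2"
  shows "\<bar>prod p A\<bar> \<le> 2 ^ card A"
proof -
  have "\<bar>prod p A\<bar> = (\<Prod>x\<in>A. \<bar>p x\<bar>)" by (rule abs_prod)
  also have "\<dots> \<le> (\<Prod>x\<in>A. 2)" by (rule prod_mono) (use assms in auto)
  finally show ?thesis by simp
qed

context rounding begin

text \<open>The mean of the factor \<psi>' in the linear terms of the shift; \<open>gain\<close> is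
  the mean which the weight 1 + \<psi> gives to a coordinate.\<close>

definition drift :: real where "drift = (\<integral>z. \<psi>' z \<partial>std_normal)"

definition gain :: real where "gain = (\<integral>z. z * \<psi> z \<partial>std_normal)"

lemma weight_psi: "normal_weight (\<lambda>z. 1 + b * \<psi> z) (b * gain)"
  unfolding gain_def by (rule normal_weight_odd[of \<psi> \<rho>]) (auto simp: bound odd)

lemma weight_deriv:
  "has_bochner_integral std_normal (\<lambda>z. b * \<psi>' z) (b * drift)"
  "has_bochner_integral std_normal (\<lambda>z. z * (b * \<psi>' z)) 0"
proof -
  have int: "integrable std_normal (\<lambda>z. z ^ k * \<psi>' z)" for k
    by (rule integrable_moment_bounded[of _ D]) (auto simp: bound')
  show "has_bochner_integral std_normal (\<lambda>z. b * \<psi>' z) (b * drift)"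
    unfolding drift_def using int[of 0] by (intro has_bochner_integral_mult_right has_bochner_integral_integrable) simp
  have "(\<integral>z. z * \<psi>' z \<partial>std_normal) = 0"
    by (rule std_normal_odd) (auto simp: even)
  thus "has_bochner_integral std_normal (\<lambda>z. z * (b * \<psi>' z)) 0"
    using int[of 1] by (auto simp: has_bochner_integral_iff mult.left_commute[of _ b])
qed

lemma abs_drift_le: "\<bar>drift\<bar> \<le> D"
proof -
  interpret prob_space std_normal by (rule prob_space_std_normal)
  have "\<bar>drift\<bar> \<le> (\<integral>z. \<bar>\<psi>' z\<bar> \<partial>std_normal)"
    unfolding drift_def by (rule integral_abs_bound)
  also have "\<dots> \<le> (\<integral>z. D \<partial>std_normal)"
    by (rule integral_mono) (auto simp: bound' intro!: integrable_std_normal_bounded[of _ D])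
  also have "prob UNIV = 1" using prob_space by simp
  hence "(\<integral>z. D \<partial>std_normal) = D" by simp
  finally show ?thesis .
qed

lemma abs_gain_le: "\<bar>gain\<bar> \<le> 1"
  unfolding gain_def using bound \<rho> by (intro mean_abs_bounded) (auto intro: order_trans less_imp_le)

text \<open>Likelihood of the answers on \<open>A\<close> and \<open>B\<close> given
  \<open>v\<close>, relative to uniform signs: each factor is twice the conditional probability of
  one answer. Averaging over \<open>v\<close> gives the likelihood ratio
  \<open>ratio\<close>.\<close>

definition lik :: "nat \<Rightarrow> bool list set \<Rightarrow> bool list set \<Rightarrow> (bool list \<Rightarrow> real) \<Rightarrow> (bool list \<Rightarrow> real) \<Rightarrow>
    (bool list \<Rightarrow> real) \<Rightarrow> real" where
  "lik n A B f g v = (\<Prod>x\<in>A. 1 + f x * sg (v x)) * (\<Prod>y\<in>B. 1 + g y * \<psi> (hadamard n v y))"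

definition ratio :: "nat \<Rightarrow> bool list set \<Rightarrow> bool list set \<Rightarrow> (bool list \<Rightarrow> real) \<Rightarrow> (bool list \<Rightarrow> real) \<Rightarrow> real" where
  "ratio n A B f g = (\<integral>v. lik n A B f g v \<partial>gaussian (cube n))"

lemma weights_le_2: "\<bar>b\<bar> = 1 \<Longrightarrow> \<bar>1 + b * \<psi> z\<bar> \<le> 2" "\<bar>b\<bar> = 1 \<Longrightarrow> \<bar>1 + b * sg z\<bar> \<le> 2"
  using bound[of z] \<rho> by (auto simp: abs_if sg_def split: if_splits)

lemma measurable_lik [measurable]:
  assumes "A \<subseteq> cube n" "B \<subseteq> cube n"
  shows "lik n A B f g \<in> borel_measurable (gaussian (cube n))"
proof -
  have v [measurable]: "(\<lambda>v. v x) \<in> borel_measurable (gaussian (cube n))" if "x \<in> cube n" for x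
    using measurable_component_singleton[OF that, of "\<lambda>_. std_normal"] by simp
  have w [measurable]: "(\<lambda>v. hadamard n v y) \<in> borel_measurable (gaussian (cube n))" if "y \<in> cube n" for y
    using measurable_compose[OF gaussian_hadamard(1) v[OF that]] .
  show ?thesis
    unfolding lik_def [abs_def] using assms
    by (intro borel_measurable_times borel_measurable_prod borel_measurable_add borel_measurable_const
        measurable_compose[OF v sg_measurable] measurable_compose[OF w measurable_psi(1)]) auto
qed

lemma abs_lik_le:
  assumes "\<And>x. x \<in> A \<Longrightarrow> \<bar>f x\<bar> = 1" "\<And>y. y \<in> B \<Longrightarrow> \<bar>g y\<bar> = 1"
  shows "\<bar>lik n A B f g v\<bar> \<le> 2 ^ card A * 2 ^ card B"
  unfolding lik_def abs_mult
  by (intro mult_mono abs_prod_le weights_le_2) (use assms in auto)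

lemma integrable_lik:
  assumes "A \<subseteq> cube n" "B \<subseteq> cube n" "\<And>x. x \<in> A \<Longrightarrow> \<bar>f x\<bar> = 1" "\<And>y. y \<in> B \<Longrightarrow> \<bar>g y\<bar> = 1"
  shows "integrable (gaussian (cube n)) (lik n A B f g)"
proof -
  interpret prob_space "gaussian (cube n)" by (rule prob_space_gaussian)
  show ?thesis
    using abs_lik_le[of A f B g n] assms by (intro integrable_const_bound[of _ "2 ^ card A * 2 ^ card B"]) auto
qed

text \<open>With v' = \<open>hadamard n w\<close>, this is the transform at \<open>y\<close> of v'
  after its coordinates in \<open>A\<close> have been overwritten by \<open>a\<close>.\<close>

definition resample :: "nat \<Rightarrow> bool list set \<Rightarrow> (bool list \<Rightarrow> real) \<Rightarrow> (bool list \<Rightarrow> real) \<Rightarrow> bool list \<Rightarrow> real" where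
  "resample n A a w y = w y + (\<Sum>x\<in>A. had n x y * (a x - hadamard n w x))"

text \<open>The coordinates of \<open>v\<close> in \<open>A\<close> and the transform \<open>w\<close> of an independent copy are made independent; the
  transform of \<open>v\<close> is then a small perturbation of \<open>w\<close>.\<close>

lemma ratio_resample:
  assumes "A \<subseteq> cube n" "B \<subseteq> cube n" and f: "\<And>x. x \<in> A \<Longrightarrow> \<bar>f x\<bar> = 1" and g: "\<And>y. y \<in> B \<Longrightarrow> \<bar>g y\<bar> = 1"
  defines "G \<equiv> \<lambda>a. \<integral>w. (\<Prod>y\<in>B. 1 + g y * \<psi> (resample n A a w y)) \<partial>gaussian (cube n)"
  shows "ratio n A B f g = (\<integral>a. (\<Prod>x\<in>A. 1 + f x * sg (a x)) * G a \<partial>gaussian A)"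
    and "integrable (gaussian A) (\<lambda>a. (\<Prod>x\<in>A. 1 + f x * sg (a x)) * G a)"
    and "a \<in> space (gaussian A) \<Longrightarrow> integrable (gaussian (cube n)) (\<lambda>w. \<Prod>y\<in>B. 1 + g y * \<psi> (resample n A a w y))"
proof -
  define J where "J = cube n - A"
  have AJ: "A \<union> J = cube n" "A \<inter> J = {}" "finite A" "finite J"
    using assms(1) finite_subset by (auto simp: J_def)
  interpret P: product_prob_space "\<lambda>_. std_normal" by (rule product_prob_space_std_normal)
  interpret prob_space "gaussian (cube n)" by (rule prob_space_gaussian)
  interpret pA: prob_space "gaussian A" by (rule prob_space_gaussian)
  interpret pJ: prob_space "gaussian J" by (rule prob_space_gaussian)
  define H where "H v = (\<Prod>y\<in>B. 1 + g y * \<psi> (hadamard n v y))" for v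
  have Hlik: "H = lik n {} B f g" by (simp add: H_def lik_def fun_eq_iff)
  have [measurable]: "H \<in> borel_measurable (gaussian (cube n))" unfolding Hlik using assms(2) by simp
  have Hb: "\<bar>H v\<bar> \<le> 2 ^ card B" for v using abs_lik_le[of "{}" f B g n v] g by (simp add: Hlik)
  have [measurable]: "merge A J \<in> gaussian A \<Otimes>\<^sub>M gaussian J \<rightarrow>\<^sub>M gaussian (cube n)"
    using measurable_merge[of A J "\<lambda>_. std_normal"] AJ(1) by simp
  have res: "(\<lambda>v. restrict v J) \<in> gaussian (cube n) \<rightarrow>\<^sub>M gaussian J"
    by (rule measurable_restrict_subset) (simp add: J_def)
  \<comment> \<open>The coordinates outside \<open>A\<close> are read off the transform of a fresh
    Gaussian \<open>w\<close>. As the transform preserves the measure, they keep their law and are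
    independent of \<open>a\<close>.\<close>
  define T where "T w = restrict (hadamard n w) J" for w
  have T [measurable]: "T \<in> gaussian (cube n) \<rightarrow>\<^sub>M gaussian J"
    unfolding T_def [abs_def] by (rule measurable_compose[OF gaussian_hadamard(1) res])
  have dT: "distr (gaussian (cube n)) (gaussian J) T = gaussian J"
  proof -
    have "gaussian J = distr (gaussian (cube n)) (gaussian J) (\<lambda>v. restrict v J)"
      by (rule P.distr_restrict) (auto simp: J_def)
    also have "\<dots> = distr (distr (gaussian (cube n)) (gaussian (cube n)) (hadamard n)) (gaussian J) (\<lambda>v. restrict v J)"
      by (simp add: gaussian_hadamard(2))
    also have "\<dots> = distr (gaussian (cube n)) (gaussian J) T"
      using distr_distr[OF res gaussian_hadamard(1)] by (simp add: comp_def T_def [abs_def])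
    finally show ?thesis by simp
  qed
  \<comment> \<open>Transforming twice returns \<open>w\<close>; only the coordinates in
    \<open>A\<close>, where \<open>a\<close> replaces the transform of \<open>w\<close>, leave a
    correction.\<close>
  have shift: "hadamard n (merge A J (a, T w)) y = resample n A a w y" if "y \<in> cube n" for a w y
  proof -
    have "hadamard n (merge A J (a, T w)) y =
        (\<Sum>x\<in>cube n. had n x y * hadamard n w x + (if x \<in> A then had n x y * (a x - hadamard n w x) else 0))"
      using that by (subst hadamard_apply) (auto intro!: sum.cong simp: merge_def T_def J_def algebra_simps)
    also have "\<dots> = hadamard n (hadamard n w) y + (\<Sum>x\<in>A. had n x y * (a x - hadamard n w x))"
      using that assms(1) by (simp add: hadamard_apply[of y n "hadamard n w"] sum.distrib sum.If_cases Int_absorb1)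
    finally show ?thesis using that by (simp add: hadamard_hadamard resample_def)
  qed
  have HG: "(\<Prod>y\<in>B. 1 + g y * \<psi> (resample n A a w y)) = H (merge A J (a, T w))" for a w
    unfolding H_def using assms(2) by (intro prod.cong) (auto simp: shift)
  have sec [measurable]: "(\<lambda>b. H (merge A J (a, b))) \<in> borel_measurable (gaussian J)" if "a \<in> space (gaussian A)" for a
    using measurable_compose[OF measurable_Pair1'[OF that, of "gaussian J"]] by measurable
  have inner: "(\<integral>b. H (merge A J (a, b)) \<partial>gaussian J) = G a" if "a \<in> space (gaussian A)" for a
  proof -
    have "(\<integral>b. H (merge A J (a, b)) \<partial>gaussian J) = (\<integral>b. H (merge A J (a, b)) \<partial>distr (gaussian (cube n)) (gaussian J) T)"
      by (simp add: dT)
    also have "\<dots> = (\<integral>w. H (merge A J (a, T w)) \<partial>gaussian (cube n))"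
      by (rule integral_distr) (use sec[OF that] T in auto)
    finally show ?thesis by (simp add: G_def HG)
  qed
  have mA: "(\<Prod>x\<in>A. 1 + f x * sg (merge A J (a, b) x)) = (\<Prod>x\<in>A. 1 + f x * sg (a x))" for a b
    by (intro prod.cong) (auto simp: merge_def)
  have "ratio n A B f g = (\<integral>v. lik n A B f g v \<partial>gaussian (A \<union> J))"
    by (simp add: ratio_def AJ(1))
  also have "\<dots> = (\<integral>a. \<integral>b. lik n A B f g (merge A J (a, b)) \<partial>gaussian J \<partial>gaussian A)"
    by (rule P.product_integral_fold) (use AJ integrable_lik assms in auto)
  also have "\<dots> = (\<integral>a. (\<Prod>x\<in>A. 1 + f x * sg (a x)) * G a \<partial>gaussian A)"
    by (intro Bochner_Integration.integral_cong refl) (simp add: lik_def mA H_def [symmetric] inner)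
  finally show "ratio n A B f g = (\<integral>a. (\<Prod>x\<in>A. 1 + f x * sg (a x)) * G a \<partial>gaussian A)" .
  have int: "integrable (gaussian (cube n)) (\<lambda>w. H (merge A J (a, T w)))" if "a \<in> space (gaussian A)" for a
    using sec[OF that] Hb by (intro integrable_const_bound[of _ "2 ^ card B"]) auto
  thus "integrable (gaussian (cube n)) (\<lambda>w. \<Prod>y\<in>B. 1 + g y * \<psi> (resample n A a w y))" if "a \<in> space (gaussian A)"
    unfolding HG using that .
  have Gb: "\<bar>G a\<bar> \<le> 2 ^ card B" if "a \<in> space (gaussian A)" for a
  proof -
    have "\<bar>G a\<bar> \<le> (\<integral>w. \<bar>H (merge A J (a, T w))\<bar> \<partial>gaussian (cube n))"
      unfolding G_def HG by (rule integral_abs_bound)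
    also have "\<dots> \<le> 2 ^ card B"
      by (rule integral_le_const) (use Hb int[OF that] in auto)
    finally show ?thesis .
  qed
  have [measurable]: "(\<lambda>a. \<Prod>x\<in>A. 1 + f x * sg (a x)) \<in> borel_measurable (gaussian A)"
    by (intro borel_measurable_prod) measurable
  have "(\<lambda>a. \<integral>b. H (merge A J (a, b)) \<partial>gaussian J) \<in> borel_measurable (gaussian A)"
    by (intro pJ.borel_measurable_lebesgue_integral) measurable
  hence [measurable]: "G \<in> borel_measurable (gaussian A)"
    by (subst measurable_cong[OF inner [symmetric]]) auto
  have "\<bar>(\<Prod>x\<in>A. 1 + f x * sg (a x)) * G a\<bar> \<le> 2 ^ card A * 2 ^ card B" if "a \<in> space (gaussian A)" for a
    unfolding abs_mult by (intro mult_mono abs_prod_le weights_le_2 Gb that) (use f in auto)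
  thus "integrable (gaussian A) (\<lambda>a. (\<Prod>x\<in>A. 1 + f x * sg (a x)) * G a)"
    by (intro pA.integrable_const_bound[of _ "2 ^ card A * 2 ^ card B"]) auto
qed

end

section \<open>Restricted transforms and the projection kernel\<close>

definition transform_on :: "nat \<Rightarrow> bool list set \<Rightarrow> (bool list \<Rightarrow> real) \<Rightarrow> bool list \<Rightarrow> real" where
  "transform_on n A f y = (\<Sum>x\<in>A. f x * had n x y)"

definition corr :: "nat \<Rightarrow> bool list set \<Rightarrow> bool list set \<Rightarrow> (bool list \<Rightarrow> real) \<Rightarrow> (bool list \<Rightarrow> real) \<Rightarrow> real" where
  "corr n A B f g = (\<Sum>y\<in>B. g y * transform_on n A f y)"

text \<open>The projection onto the coordinates in \<open>A\<close>, conjugated by the Hadamard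
  matrix. Resampling subtracts exactly this part of \<open>w\<close>.\<close>

definition kernel_on :: "nat \<Rightarrow> bool list set \<Rightarrow> bool list \<Rightarrow> bool list \<Rightarrow> real" where
  "kernel_on n A y z = (\<Sum>x\<in>A. had n x y * had n x z)"

lemma kernel_on_diag: "kernel_on n A y y = card A / 2 ^ n"
  by (simp add: kernel_on_def had_sq)

lemma kernel_on_quadratic:
  "(\<Sum>z\<in>B. kernel_on n A y z * g z) = (\<Sum>x\<in>A. had n x y * transform_on n B g x)"
proof -
  have "(\<Sum>z\<in>B. kernel_on n A y z * g z) = (\<Sum>z\<in>B. \<Sum>x\<in>A. had n x y * (g z * had n z x))"
    unfolding kernel_on_def sum_distrib_right
    by (intro sum.cong refl) (simp add: had_commute mult_ac)
  also have "\<dots> = (\<Sum>x\<in>A. \<Sum>z\<in>B. had n x y * (g z * had n z x))" by (rule sum.swap)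
  finally show ?thesis by (simp add: transform_on_def sum_distrib_left)
qed

lemma kernel_on_form:
  "(\<Sum>y\<in>B. g y * (\<Sum>z\<in>B. kernel_on n A y z * g z)) = (\<Sum>x\<in>A. (transform_on n B g x)\<^sup>2)"
proof -
  have "(\<Sum>y\<in>B. g y * (\<Sum>z\<in>B. kernel_on n A y z * g z)) =
      (\<Sum>y\<in>B. \<Sum>x\<in>A. g y * had n y x * transform_on n B g x)"
    unfolding kernel_on_quadratic sum_distrib_left
    by (intro sum.cong refl) (simp add: had_commute mult_ac)
  also have "\<dots> = (\<Sum>x\<in>A. \<Sum>y\<in>B. g y * had n y x * transform_on n B g x)" by (rule sum.swap)
  finally show ?thesis
    by (simp add: transform_on_def power2_eq_square sum_distrib_right)
qed

text \<open>For a symmetric idempotent matrix the sum of squares along a row is the diagonal entry;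
  here this comes from orthogonality of the rows of \<open>had\<close>.\<close>

lemma kernel_on_row:
  assumes "A \<subseteq> cube n"
  shows "(\<Sum>z\<in>cube n. (kernel_on n A y z)\<^sup>2) = card A / 2 ^ n"
proof -
  have fin: "finite A" using assms finite_subset by auto
  have "(\<Sum>z\<in>cube n. (kernel_on n A y z)\<^sup>2) =
      (\<Sum>z\<in>cube n. \<Sum>x\<in>A. \<Sum>x'\<in>A. had n x y * had n x' y * (had n x z * had n x' z))"
    by (simp add: kernel_on_def power2_eq_square sum_product mult_ac)
  also have "\<dots> = (\<Sum>x\<in>A. \<Sum>z\<in>cube n. \<Sum>x'\<in>A. had n x y * had n x' y * (had n x z * had n x' z))"
    by (rule sum.swap)
  also have "\<dots> = (\<Sum>x\<in>A. \<Sum>x'\<in>A. \<Sum>z\<in>cube n. had n x y * had n x' y * (had n x z * had n x' z))"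
    by (intro sum.cong refl sum.swap)
  also have "\<dots> = (\<Sum>x\<in>A. \<Sum>x'\<in>A. had n x y * had n x' y * (if x = x' then 1 else 0))"
  proof (intro sum.cong refl)
    fix x x' assume "x \<in> A" "x' \<in> A"
    hence "(\<Sum>z\<in>cube n. had n x z * had n x' z) = (if x = x' then 1 else 0)"
      using assms by (intro had_orthogonal') auto
    thus "(\<Sum>z\<in>cube n. had n x y * had n x' y * (had n x z * had n x' z)) =
        had n x y * had n x' y * (if x = x' then 1 else 0)"
      by (simp only: sum_distrib_left [symmetric])
  qed
  also have "\<dots> = (\<Sum>x\<in>A. \<Sum>x'\<in>A. if x' = x then had n x y * had n x y else 0)"
    by (intro sum.cong refl) auto
  also have "\<dots> = card A / 2 ^ n" using fin by (simp add: had_sq)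
  finally show ?thesis .
qed

context rounding begin

text \<open>The shift at \<open>y\<close> is P y a - q y w with \<open>a\<close> and
  \<open>w\<close> independent. After splitting its square by (P - q)^2 \<le> 2 P^2 + 2 q^2, the
  bound \<open>prod_weight_shift\<close> is integrated term by term: over \<open>w\<close> with the
  weights of the answers on \<open>B\<close>, then over \<open>a\<close> with those on
  \<open>A\<close>. The number \<open>m z\<close> is the mean that the answers give to coordinate
  \<open>z\<close> of \<open>w\<close>.\<close>

lemma ratio_ge_moments:
  assumes A: "A \<subseteq> cube n" and B: "B \<subseteq> cube n"
    and f: "\<And>x. x \<in> A \<Longrightarrow> \<bar>f x\<bar> = 1" and g: "\<And>y. y \<in> B \<Longrightarrow> \<bar>g y\<bar> = 1"
  defines "\<kappa> \<equiv> sqrt (2 / pi)" and "K \<equiv> kernel_on n A" and "m \<equiv> \<lambda>z. if z \<in> B then g z * gain else 0"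
  shows "ratio n A B f g \<ge> 1 +
      (\<Sum>y\<in>B. (\<kappa> * transform_on n A f y) * (g y * drift)
          - (\<Sum>z\<in>cube n. K y z * (if z = y then 0 else m z * (g y * drift))))
    - curv * (\<Sum>y\<in>B. 2 * ((\<kappa> * transform_on n A f y)\<^sup>2 + (\<Sum>x\<in>A. (had n x y)\<^sup>2 * (1 - (f x * \<kappa>)\<^sup>2)))
        + 2 * ((\<Sum>z\<in>cube n. K y z * m z)\<^sup>2 + (\<Sum>z\<in>cube n. (K y z)\<^sup>2 * (1 - (m z)\<^sup>2))))"
proof -
  have fin: "finite A" "finite B" using finite_subset[OF A] finite_subset[OF B] by auto
  define G where "G w = (\<Prod>y\<in>B. 1 + g y * \<psi> (w y))" for w
  define k where "k y w = g y * \<psi>' (w y) * (\<Prod>z\<in>B - {y}. 1 + g z * \<psi> (w z))" for y w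
  define q where "q y w = (\<Sum>z\<in>cube n. K y z * w z)" for y w
  define P where "P y a = (\<Sum>x\<in>A. had n x y * a x)" for y a
  define F where "F a = (\<Prod>x\<in>A. 1 + f x * sg (a x))" for a
  define p where "p z = (if z \<in> B then \<lambda>t. 1 + g z * \<psi> t else (\<lambda>_. 1))" for z
  have p: "normal_weight (p z) (m z)" for z
    using weight_psi normal_weight_one by (auto simp: p_def m_def)
  have prod_p: "(\<Prod>z\<in>cube n. p z (w z)) = G w" for w
  proof -
    have "(\<Prod>z\<in>cube n. p z (w z)) = (\<Prod>z\<in>B. p z (w z))"
      by (rule prod.mono_neutral_right) (use B in \<open>auto simp: p_def\<close>)
    thus ?thesis by (simp add: G_def p_def)
  qed
  define p' where "p' y = p(y := \<lambda>t. g y * \<psi>' t)" for y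
  have prod_p': "(\<Prod>z\<in>cube n. p' y z (w z)) = k y w" if "y \<in> B" for y w
  proof -
    have "(\<Prod>z\<in>cube n. p' y z (w z)) = (\<Prod>z\<in>B. p' y z (w z))"
      by (rule prod.mono_neutral_right) (use B that in \<open>auto simp: p'_def p_def\<close>)
    also have "\<dots> = p' y y (w y) * (\<Prod>z\<in>B - {y}. p' y z (w z))"
      using that fin by (simp add: prod.remove)
    also have "\<dots> = k y w" by (auto simp: k_def p'_def p_def intro!: prod.cong)
    finally show ?thesis .
  qed
  have p'_int: "has_bochner_integral std_normal (p' y z) (((\<lambda>_. 1)(y := g y * drift)) z)" for y z
    using weight_deriv(1) p[of z] by (simp add: p'_def normal_weight_def)
  have G1: "has_bochner_integral (gaussian (cube n)) G 1"
    using gaussian_prod[of "cube n" p "\<lambda>_. 1"] p by (simp add: prod_p normal_weight_def)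
  have k1: "has_bochner_integral (gaussian (cube n)) (k y) (g y * drift)" if "y \<in> B" for y
  proof -
    have "has_bochner_integral (gaussian (cube n)) (\<lambda>w. \<Prod>z\<in>cube n. p' y z (w z))
        (\<Prod>z\<in>cube n. ((\<lambda>_. 1)(y := g y * drift)) z)"
      by (rule gaussian_prod) (use p'_int in auto)
    moreover have "(\<Prod>z\<in>cube n. ((\<lambda>_. 1)(y := g y * drift)) z) = g y * drift"
      using that B by (subst prod.remove[of _ y]) auto
    ultimately show ?thesis by (simp only: prod_p'[OF that])
  qed
  \<comment> \<open>For \<open>z = y\<close> the factor is z \<psi>'(z), an odd function with mean
    0. This is the origin of the case distinction in the statement.\<close>
  have k2: "has_bochner_integral (gaussian (cube n)) (\<lambda>w. w z * k y w)
      (if z = y then 0 else m z * (g y * drift))" if "y \<in> B" "z \<in> cube n" for y z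
  proof -
    have "has_bochner_integral (gaussian (cube n)) (\<lambda>w. w z * (\<Prod>i\<in>cube n. p' y i (w i)))
        ((if z = y then 0 else m z) * (\<Prod>i\<in>cube n - {z}. ((\<lambda>_. 1)(y := g y * drift)) i))"
      by (rule gaussian_prod_linear)
         (use p'_int weight_deriv(2) p[of z] that in \<open>auto simp: p'_def normal_weight_def\<close>)
    moreover have "(\<Prod>i\<in>cube n - {z}. ((\<lambda>_. 1)(y := g y * drift)) i) = g y * drift" if "z \<noteq> y"
      using that \<open>y \<in> B\<close> B by (subst prod.remove[of _ y]) auto
    ultimately show ?thesis by (cases "z = y") (auto simp: prod_p'[OF that(1)])
  qed
  have k3: "has_bochner_integral (gaussian (cube n)) (\<lambda>w. q y w * k y w)
      (\<Sum>z\<in>cube n. K y z * (if z = y then 0 else m z * (g y * drift)))" if "y \<in> B" for y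
    unfolding q_def sum_distrib_right mult.assoc
    by (intro has_bochner_integral_sum has_bochner_integral_mult_right k2 that)
  have G2: "has_bochner_integral (gaussian (cube n)) (\<lambda>w. (q y w)\<^sup>2 * G w)
      ((\<Sum>z\<in>cube n. K y z * m z)\<^sup>2 + (\<Sum>z\<in>cube n. (K y z)\<^sup>2 * (1 - (m z)\<^sup>2)))" for y
    using gaussian_weight_square[of "cube n" p m "K y"] p by (simp add: prod_p q_def)
  define X where "X y = (\<Sum>z\<in>cube n. K y z * (if z = y then 0 else m z * (g y * drift)))" for y
  define Y where "Y y = (\<Sum>z\<in>cube n. K y z * m z)\<^sup>2 + (\<Sum>z\<in>cube n. (K y z)\<^sup>2 * (1 - (m z)\<^sup>2))" for y
  define Q where "Q a = 1 + (\<Sum>y\<in>B. P y a * (g y * drift) - X y)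
      - curv * (\<Sum>y\<in>B. 2 * (P y a)\<^sup>2 + 2 * Y y)" for a
  have res: "resample n A a w y = w y + (P y a - q y w)" if "y \<in> B" for a w y
  proof -
    have "(\<Sum>x\<in>A. had n x y * hadamard n w x) = (\<Sum>x\<in>A. \<Sum>z\<in>cube n. had n x y * (had n z x * w z))"
      using A by (intro sum.cong) (auto simp: hadamard_apply sum_distrib_left)
    also have "\<dots> = (\<Sum>z\<in>cube n. \<Sum>x\<in>A. had n x y * (had n z x * w z))" by (rule sum.swap)
    also have "\<dots> = q y w"
      unfolding q_def K_def kernel_on_def sum_distrib_right
      by (intro sum.cong refl) (simp add: had_commute mult_ac)
    finally show ?thesis
      by (simp add: resample_def P_def right_diff_distrib sum_subtractf)
  qed
  have inner: "Q a \<le> (\<integral>w. (\<Prod>y\<in>B. 1 + g y * \<psi> (resample n A a w y)) \<partial>gaussian (cube n))"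
    if a: "a \<in> space (gaussian A)" for a
  proof -
    define Low where "Low w = G w + (\<Sum>y\<in>B. P y a * k y w - q y w * k y w)
        - curv * (\<Sum>y\<in>B. 2 * (P y a)\<^sup>2 * G w + 2 * ((q y w)\<^sup>2 * G w))" for w
    have "has_bochner_integral (gaussian (cube n)) Low
       (1 + (\<Sum>y\<in>B. P y a * (g y * drift) - X y) - curv * (\<Sum>y\<in>B. 2 * (P y a)\<^sup>2 * 1 + 2 * Y y))"
      unfolding Low_def X_def Y_def
      by (intro has_bochner_integral_add has_bochner_integral_diff has_bochner_integral_sum
          has_bochner_integral_mult_right G1 k1 k3 G2)
    hence Low: "integrable (gaussian (cube n)) Low" "(\<integral>w. Low w \<partial>gaussian (cube n)) = Q a"
      by (auto simp: has_bochner_integral_iff Q_def)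
    have "Low w \<le> (\<Prod>y\<in>B. 1 + g y * \<psi> (resample n A a w y))" for w
    proof -
      have "(\<Prod>y\<in>B. 1 + g y * \<psi> (resample n A a w y)) = (\<Prod>y\<in>B. 1 + g y * \<psi> (w y + (P y a - q y w)))"
        by (intro prod.cong) (auto simp: res)
      moreover have "G w + (\<Sum>y\<in>B. (P y a - q y w) * k y w) - curv * (\<Sum>y\<in>B. (P y a - q y w)\<^sup>2) * G w \<le>
          (\<Prod>y\<in>B. 1 + g y * \<psi> (w y + (P y a - q y w)))"
        using prod_weight_shift[OF fin(2), of g w "\<lambda>y. P y a - q y w"] g unfolding G_def k_def .
      moreover have "curv * (\<Sum>y\<in>B. (P y a - q y w)\<^sup>2) * G w \<le>
          curv * (\<Sum>y\<in>B. 2 * (P y a)\<^sup>2 * G w + 2 * ((q y w)\<^sup>2 * G w))"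
      proof -
        have "G w \<ge> 0"
          unfolding G_def using weight_pos g \<rho> by (intro prod_nonneg) (smt (verit))
        moreover have "(P y a - q y w)\<^sup>2 \<le> 2 * (P y a)\<^sup>2 + 2 * (q y w)\<^sup>2" for y
          using zero_le_power2[of "P y a + q y w"] by (simp add: power2_eq_square algebra_simps)
        ultimately have "(\<Sum>y\<in>B. (P y a - q y w)\<^sup>2 * G w) \<le> (\<Sum>y\<in>B. (2 * (P y a)\<^sup>2 + 2 * (q y w)\<^sup>2) * G w)"
          by (intro sum_mono mult_right_mono) auto
        thus ?thesis
          using curv_nonneg by (simp add: mult.assoc sum_distrib_right distrib_right mult_left_mono)
      qed
      ultimately show ?thesis by (simp add: Low_def left_diff_distrib)
    qed
    thus ?thesis
      unfolding Low(2) [symmetric]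
      using ratio_resample(3)[OF A B f g a] Low(1) by (intro integral_mono) auto
  qed
  have wf: "normal_weight (\<lambda>z. 1 + f x * sg z) (f x * \<kappa>)" for x
    unfolding \<kappa>_def by (rule normal_weight_sg)
  have F1: "has_bochner_integral (gaussian A) F 1"
    using gaussian_prod[of A "\<lambda>x z. 1 + f x * sg z" "\<lambda>_. 1"] wf fin
    by (simp add: F_def [abs_def] normal_weight_def)
  have F2: "has_bochner_integral (gaussian A) (\<lambda>a. P y a * F a) (\<kappa> * transform_on n A f y)" for y
  proof -
    have "has_bochner_integral (gaussian A) (\<lambda>a. \<Sum>x\<in>A. had n x y * (a x * F a)) (\<Sum>x\<in>A. had n x y * (f x * \<kappa>))"
      unfolding F_def
      by (intro has_bochner_integral_sum has_bochner_integral_mult_right gaussian_weight_linear fin wf)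
    thus ?thesis
      by (simp add: P_def transform_on_def sum_distrib_left sum_distrib_right mult_ac)
  qed
  have F3: "has_bochner_integral (gaussian A) (\<lambda>a. (P y a)\<^sup>2 * F a)
     ((\<kappa> * transform_on n A f y)\<^sup>2 + (\<Sum>x\<in>A. (had n x y)\<^sup>2 * (1 - (f x * \<kappa>)\<^sup>2)))" for y
    using gaussian_weight_square[OF fin(1), of "\<lambda>x z. 1 + f x * sg z" "\<lambda>x. f x * \<kappa>" "\<lambda>x. had n x y"] wf
    by (simp add: P_def F_def transform_on_def sum_distrib_left mult_ac)
  define Z where "Z y = (\<kappa> * transform_on n A f y)\<^sup>2 + (\<Sum>x\<in>A. (had n x y)\<^sup>2 * (1 - (f x * \<kappa>)\<^sup>2))" for y
  have "has_bochner_integral (gaussian A) (\<lambda>a. F a + (\<Sum>y\<in>B. (g y * drift) * (P y a * F a) - X y * F a)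
      - curv * (\<Sum>y\<in>B. 2 * ((P y a)\<^sup>2 * F a) + 2 * Y y * F a))
     (1 + (\<Sum>y\<in>B. (g y * drift) * (\<kappa> * transform_on n A f y) - X y * 1) - curv * (\<Sum>y\<in>B. 2 * Z y + 2 * Y y * 1))"
    unfolding Z_def
    by (intro has_bochner_integral_add has_bochner_integral_diff has_bochner_integral_sum
          has_bochner_integral_mult_right F1 F2 F3)
  moreover have "F a + (\<Sum>y\<in>B. (g y * drift) * (P y a * F a) - X y * F a)
      - curv * (\<Sum>y\<in>B. 2 * ((P y a)\<^sup>2 * F a) + 2 * Y y * F a) = F a * Q a" for a
    unfolding Q_def right_diff_distrib distrib_left sum_distrib_left
    by (simp add: mult_ac sum_subtractf sum_distrib_left)
  ultimately have FQ: "has_bochner_integral (gaussian A) (\<lambda>a. F a * Q a)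
     (1 + (\<Sum>y\<in>B. (\<kappa> * transform_on n A f y) * (g y * drift) - X y) - curv * (\<Sum>y\<in>B. 2 * Z y + 2 * Y y))"
    by (simp add: mult_ac)
  have ratio: "ratio n A B f g = (\<integral>a. (\<Prod>x\<in>A. 1 + f x * sg (a x)) *
      (\<integral>w. (\<Prod>y\<in>B. 1 + g y * \<psi> (resample n A a w y)) \<partial>gaussian (cube n)) \<partial>gaussian A)"
    by (rule ratio_resample(1)) (use A B f g in auto)
  have "(\<integral>a. F a * Q a \<partial>gaussian A) \<le> ratio n A B f g"
    unfolding ratio F_def
  proof (intro integral_mono mult_left_mono inner)
    show "integrable (gaussian A) (\<lambda>a. (\<Prod>x\<in>A. 1 + f x * sg (a x)) * Q a)"
      using FQ unfolding F_def has_bochner_integral_iff by blast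
    show "0 \<le> (\<Prod>x\<in>A. 1 + f x * sg (a x))" for a
      using f by (intro prod_nonneg) (force simp: sg_def abs_if split: if_splits)
  qed (use ratio_resample(2)[OF A B f g] in auto)
  thus ?thesis
    using FQ unfolding has_bochner_integral_iff X_def Y_def Z_def by simp
qed

text \<open>Only quadratic statistics of the answers enter, so no good event has to be conditioned on.\<close>

lemma ratio_ge:
  assumes A: "A \<subseteq> cube n" and B: "B \<subseteq> cube n"
    and f: "\<And>x. x \<in> A \<Longrightarrow> \<bar>f x\<bar> = 1" and g: "\<And>y. y \<in> B \<Longrightarrow> \<bar>g y\<bar> = 1"
    and AB: "real (card A * card B) \<le> 2 ^ n"
  shows "ratio n A B f g \<ge> 1 - (D + 4 * curv) * (\<bar>corr n A B f g\<bar> + (\<Sum>y\<in>B. (transform_on n A f y)\<^sup>2)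
      + (\<Sum>x\<in>A. (transform_on n B g x)\<^sup>2) + real (card A * card B) / 2 ^ n)"
proof -
  define \<kappa> :: real where "\<kappa> = sqrt (2 / pi)"
  have \<kappa>: "0 \<le> \<kappa>" "\<kappa> \<le> 1" using pi_gt3 by (auto simp: \<kappa>_def)
  define K where "K = kernel_on n A"
  define m where "m z = (if z \<in> B then g z * gain else 0)" for z
  define s where "s y = transform_on n A f y" for y
  define t where "t x = transform_on n B g x" for x
  define S where "S = (\<Sum>y\<in>B. (s y)\<^sup>2)"
  define T where "T = (\<Sum>x\<in>A. (t x)\<^sup>2)"
  define R where "R = real (card A * card B) / 2 ^ n"
  have fin: "finite A" "finite B" using finite_subset[OF A] finite_subset[OF B] by auto
  have pos: "S \<ge> 0" "T \<ge> 0" "R \<ge> 0" "R \<le> 1"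
    using AB by (auto simp: S_def T_def R_def intro!: sum_nonneg)
  have g2: "g y * g y = 1" if "y \<in> B" for y
    using g[OF that] by (metis abs_mult_self_eq mult_1)
  have \<kappa>2: "\<kappa>\<^sup>2 \<le> 1" and gain2: "gain\<^sup>2 \<le> 1"
    using \<kappa> abs_gain_le by (auto simp: abs_square_le_1 power_le_one)
  have Km: "(\<Sum>z\<in>cube n. K y z * m z) = gain * (\<Sum>z\<in>B. K y z * g z)" for y
  proof -
    have "(\<Sum>z\<in>cube n. K y z * m z) = (\<Sum>z\<in>B. K y z * m z)"
      by (rule sum.mono_neutral_right) (use B in \<open>auto simp: m_def\<close>)
    thus ?thesis by (simp add: m_def sum_distrib_left mult_ac)
  qed
  define X where "X y = (\<Sum>z\<in>cube n. K y z * (if z = y then 0 else m z * (g y * drift)))" for y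
  \<comment> \<open>The excluded term z = y is added and subtracted; it equals the diagonal kernel
    entry card A / 2^n times \<open>drift * gain\<close>, because the square of a sign is 1.\<close>
  have X: "X y = drift * gain * (g y * (\<Sum>z\<in>B. K y z * g z) - card A / 2 ^ n)" if "y \<in> B" for y
  proof -
    have "X y = (\<Sum>z\<in>cube n. K y z * m z * (g y * drift) - (if z = y then K y y * m y * (g y * drift) else 0))"
      unfolding X_def by (intro sum.cong) auto
    also have "\<dots> = (\<Sum>z\<in>cube n. K y z * m z) * (g y * drift) - K y y * m y * (g y * drift)"
      using that B by (simp add: sum_subtractf sum_distrib_right subset_iff)
    also have "\<dots> = drift * gain * (g y * (\<Sum>z\<in>B. K y z * g z) - K y y * (g y * g y))"
      unfolding Km using that by (simp add: m_def algebra_simps)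
    finally show ?thesis using that by (simp add: g2 K_def kernel_on_diag)
  qed
  have sumX: "(\<Sum>y\<in>B. X y) = drift * gain * (T - R)"
  proof -
    have "(\<Sum>y\<in>B. X y) = drift * gain * ((\<Sum>y\<in>B. g y * (\<Sum>z\<in>B. K y z * g z)) - (\<Sum>y\<in>B. card A / 2 ^ n))"
      by (simp only: X sum_subtractf sum_distrib_left [symmetric] cong: sum.cong)
    thus ?thesis unfolding K_def kernel_on_form by (simp add: T_def t_def R_def mult.commute)
  qed
  define Y where "Y y = (\<Sum>z\<in>cube n. K y z * m z)\<^sup>2 + (\<Sum>z\<in>cube n. (K y z)\<^sup>2 * (1 - (m z)\<^sup>2))" for y
  have Y: "Y y \<le> card A / 2 ^ n * T + card A / 2 ^ n" for y
  proof -
    have "(\<Sum>z\<in>cube n. K y z * m z)\<^sup>2 \<le> 1 * (\<Sum>z\<in>B. K y z * g z)\<^sup>2"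
      unfolding Km power_mult_distrib by (intro mult_right_mono gain2) simp
    also have "\<dots> = (\<Sum>x\<in>A. had n x y * t x)\<^sup>2"
      by (simp add: K_def kernel_on_quadratic t_def)
    also have "\<dots> \<le> (\<Sum>x\<in>A. (had n x y)\<^sup>2) * (\<Sum>x\<in>A. (t x)\<^sup>2)"
      by (rule Cauchy_Schwarz_ineq_sum)
    also have "\<dots> = card A / 2 ^ n * T"
      by (simp add: power2_eq_square[of "had _ _ _"] had_sq T_def)
    finally have 1: "(\<Sum>z\<in>cube n. K y z * m z)\<^sup>2 \<le> card A / 2 ^ n * T" .
    have "(\<Sum>z\<in>cube n. (K y z)\<^sup>2 * (1 - (m z)\<^sup>2)) \<le> (\<Sum>z\<in>cube n. (K y z)\<^sup>2)"
      by (intro sum_mono mult_left_le) auto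
    thus ?thesis using 1 kernel_on_row[OF A, of y] unfolding Y_def K_def by linarith
  qed
  define Z where "Z y = (\<kappa> * s y)\<^sup>2 + (\<Sum>x\<in>A. (had n x y)\<^sup>2 * (1 - (f x * \<kappa>)\<^sup>2))" for y
  have Z: "Z y \<le> (s y)\<^sup>2 + card A / 2 ^ n" for y
  proof -
    have "(\<kappa> * s y)\<^sup>2 \<le> 1 * (s y)\<^sup>2"
      unfolding power_mult_distrib by (intro mult_right_mono \<kappa>2) simp
    moreover have "(\<Sum>x\<in>A. (had n x y)\<^sup>2 * (1 - (f x * \<kappa>)\<^sup>2)) \<le> (\<Sum>x\<in>A. (had n x y)\<^sup>2)"
      by (intro sum_mono mult_left_le) auto
    moreover have "(\<Sum>x\<in>A. (had n x y)\<^sup>2) = card A / 2 ^ n"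
      by (simp add: power2_eq_square[of "had _ _ _"] had_sq)
    ultimately show ?thesis unfolding Z_def by linarith
  qed
  have "(\<Sum>y\<in>B. 2 * Z y + 2 * Y y) \<le>
      (\<Sum>y\<in>B. 2 * ((s y)\<^sup>2 + card A / 2 ^ n) + 2 * (card A / 2 ^ n * T + card A / 2 ^ n))"
    by (intro sum_mono add_mono mult_left_mono Y Z) auto
  also have "\<dots> = 2 * S + 4 * R + 2 * (R * T)"
  proof -
    have "(\<Sum>y\<in>B. 2 * ((s y)\<^sup>2 + r) + 2 * (r * T + r)) = 2 * S + 4 * (card B * r) + 2 * (card B * r * T)" for r :: real
      by (simp add: S_def sum.distrib sum_distrib_left algebra_simps)
    from this[of "real (card A) / 2 ^ n"] show ?thesis by (simp add: R_def mult_ac)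
  qed
  \<comment> \<open>Here \<open>AB\<close> enters: Cauchy-Schwarz left the product of the two
    statistics \<open>R\<close> and \<open>T\<close>, which R \<le> 1 turns into a single
    one.\<close>
  also have "R * T \<le> 1 * T" by (intro mult_right_mono pos)
  finally have "(\<Sum>y\<in>B. 2 * Z y + 2 * Y y) \<le> 4 * (S + T + R)"
    using pos by simp
  from mult_left_mono[OF this curv_nonneg]
  have quad: "curv * (\<Sum>y\<in>B. 2 * Z y + 2 * Y y) \<le> 4 * curv * (S + T + R)" by (simp add: mult_ac)
  have lin: "(\<Sum>y\<in>B. (\<kappa> * s y) * (g y * drift) - X y) = \<kappa> * drift * corr n A B f g - drift * gain * (T - R)"
    by (simp add: sum_subtractf sumX corr_def s_def sum_distrib_left mult_ac)
  have "\<bar>\<kappa> * drift * corr n A B f g\<bar> \<le> 1 * D * \<bar>corr n A B f g\<bar>"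
    unfolding abs_mult using \<kappa> abs_drift_le by (intro mult_mono) auto
  moreover have "\<bar>drift * gain * (T - R)\<bar> \<le> D * 1 * (T + R)"
    unfolding abs_mult using abs_drift_le abs_gain_le D_nonneg pos by (intro mult_mono) auto
  ultimately have "(\<Sum>y\<in>B. (\<kappa> * s y) * (g y * drift) - X y) \<ge> - (D * (\<bar>corr n A B f g\<bar> + T + R))"
    unfolding lin by (simp add: abs_le_iff algebra_simps)
  moreover have "ratio n A B f g \<ge> 1 + (\<Sum>y\<in>B. (\<kappa> * s y) * (g y * drift) - X y)
      - curv * (\<Sum>y\<in>B. 2 * Z y + 2 * Y y)"
    unfolding \<kappa>_def s_def X_def Y_def Z_def K_def m_def by (rule ratio_ge_moments[OF A B f g])
  moreover have "(D + 4 * curv) * (\<bar>corr n A B f g\<bar> + S + T + R) \<ge>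
      D * (\<bar>corr n A B f g\<bar> + T + R) + 4 * curv * (S + T + R)"
    using pos D_nonneg curv_nonneg by (simp add: algebra_simps)
  ultimately show ?thesis using quad unfolding S_def T_def R_def s_def t_def by linarith
qed

end

section \<open>Decision trees\<close>

text \<open>The number of queries is bounded on promise inputs only, but the averages below run over
  all inputs, so depth has to be enforced. On an input where the tree makes at most \<open>k\<close>
  queries, the default answer \<open>False\<close> is never reached.\<close>

primrec trunc :: "query_tree \<Rightarrow> nat \<Rightarrow> query_tree" where
  "trunc (Answer b) k = Answer b"
| "trunc (Query_f x t u) k = (case k of 0 \<Rightarrow> Answer False | Suc k \<Rightarrow> Query_f x (trunc t k) (trunc u k))"
| "trunc (Query_g y t u) k = (case k of 0 \<Rightarrow> Answer False | Suc k \<Rightarrow> Query_g y (trunc t k) (trunc u k))"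

primrec depth :: "query_tree \<Rightarrow> nat" where
  "depth (Answer b) = 0"
| "depth (Query_f x t u) = Suc (max (depth t) (depth u))"
| "depth (Query_g y t u) = Suc (max (depth t) (depth u))"

primrec queried_f :: "query_tree \<Rightarrow> (bool list \<Rightarrow> real) \<Rightarrow> (bool list \<Rightarrow> real) \<Rightarrow> bool list set" where
  "queried_f (Answer b) f g = {}"
| "queried_f (Query_f x t u) f g = insert x (if f x = 1 then queried_f t f g else queried_f u f g)"
| "queried_f (Query_g y t u) f g = (if g y = 1 then queried_f t f g else queried_f u f g)"

primrec queried_g :: "query_tree \<Rightarrow> (bool list \<Rightarrow> real) \<Rightarrow> (bool list \<Rightarrow> real) \<Rightarrow> bool list set" where
  "queried_g (Answer b) f g = {}"
| "queried_g (Query_f x t u) f g = (if f x = 1 then queried_g t f g else queried_g u f g)"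
| "queried_g (Query_g y t u) f g = insert y (if g y = 1 then queried_g t f g else queried_g u f g)"

lemma depth_trunc: "depth (trunc t k) \<le> k"
  by (induction t arbitrary: k) (auto split: nat.split)

lemma wf_trunc: "wf_tree n t \<Longrightarrow> wf_tree n (trunc t k)"
  by (induction t arbitrary: k) (auto split: nat.split)

lemma tree_output_trunc: "num_queries t f g \<le> k \<Longrightarrow> tree_output (trunc t k) f g = tree_output t f g"
  by (induction t arbitrary: k) (auto split: nat.split if_splits)

lemma finite_queried: "finite (queried_f t f g)" "finite (queried_g t f g)"
  by (induction t) auto

lemma queried_subset:
  "wf_tree n t \<Longrightarrow> queried_f t f g \<subseteq> cube n" "wf_tree n t \<Longrightarrow> queried_g t f g \<subseteq> cube n"
  by (induction t) auto

lemma card_queried: "card (queried_f t f g) + card (queried_g t f g) \<le> depth t"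
proof (induction t)
  case (Query_f x t u)
  have "card (queried_f (Query_f x t u) f g) \<le> Suc (card (if f x = 1 then queried_f t f g else queried_f u f g))"
    by (simp add: card_insert_if finite_queried)
  thus ?case using Query_f by (auto split: if_splits)
next
  case (Query_g x t u)
  have "card (queried_g (Query_g x t u) f g) \<le> Suc (card (if g x = 1 then queried_g t f g else queried_g u f g))"
    by (simp add: card_insert_if finite_queried)
  thus ?case using Query_g by (auto split: if_splits)
qed simp

section \<open>Conditioning uniform inputs on answers\<close>

lemma finite_sign_funs [simp]: "finite (sign_funs n)"
  by (simp add: sign_funs_def finite_PiE)

lemma card_sign_funs: "card (sign_funs n) = 2 ^ 2 ^ n"
  by (simp add: sign_funs_def card_PiE card_cube card_insert_if numeral_2_eq_2)

lemma sign_funs_cases: "f \<in> sign_funs n \<Longrightarrow> x \<in> cube n \<Longrightarrow> f x = 1 \<or> f x = - 1"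
  by (auto simp: sign_funs_def)

lemma sign_funs_update: "f \<in> sign_funs n \<Longrightarrow> x \<in> cube n \<Longrightarrow> s = 1 \<or> s = - 1 \<Longrightarrow> f(x := s) \<in> sign_funs n"
  unfolding sign_funs_def by (rule PiE_I) (auto simp: PiE_iff extensional_def)

lemma abs_sign_funs: "f \<in> sign_funs n \<Longrightarrow> x \<in> cube n \<Longrightarrow> \<bar>f x\<bar> = 1"
  using sign_funs_cases by fastforce

text \<open>The inputs compatible with the answers received. Conditional expectations under uniform
  signs are written as sums over a cylinder compared with its cardinality, without any conditional
  measure.\<close>

definition cylinder :: "nat \<Rightarrow> bool list set \<Rightarrow> bool list set \<Rightarrow> (bool list \<Rightarrow> real) \<Rightarrow> (bool list \<Rightarrow> real) \<Rightarrow>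
    ((bool list \<Rightarrow> real) \<times> (bool list \<Rightarrow> real)) set" where
  "cylinder n A B f0 g0 = {(f, g). f \<in> sign_funs n \<and> g \<in> sign_funs n \<and>
     (\<forall>x\<in>A. f x = f0 x) \<and> (\<forall>y\<in>B. g y = g0 y)}"

lemma finite_cylinder [simp]: "finite (cylinder n A B f0 g0)"
  by (rule finite_subset[of _ "sign_funs n \<times> sign_funs n"]) (auto simp: cylinder_def)

text \<open>Flipping the value at the fresh point \<open>x\<close> is a bijection between the two
  halves, so under uniform inputs each answer has conditional probability 1/2.\<close>

lemma cylinder_split_f:
  assumes "x \<in> cube n" "x \<notin> A"
  shows "cylinder n A B f0 g0 = cylinder n (insert x A) B (f0(x := 1)) g0 \<union> cylinder n (insert x A) B (f0(x := - 1)) g0"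
    "cylinder n (insert x A) B (f0(x := 1)) g0 \<inter> cylinder n (insert x A) B (f0(x := - 1)) g0 = {}"
    "2 * card (cylinder n (insert x A) B (f0(x := 1)) g0) = card (cylinder n A B f0 g0)"
    "2 * card (cylinder n (insert x A) B (f0(x := - 1)) g0) = card (cylinder n A B f0 g0)"
proof -
  let ?C = "\<lambda>s. cylinder n (insert x A) B (f0(x := s)) g0"
  have upd: "z \<in> A \<Longrightarrow> z \<noteq> x" for z using assms by auto
  show 1: "cylinder n A B f0 g0 = ?C 1 \<union> ?C (- 1)"
    using assms sign_funs_cases[of _ n x] upd by (auto simp: cylinder_def)
  show 2: "?C 1 \<inter> ?C (- 1) = {}" by (auto simp: cylinder_def)
  have "bij_betw (\<lambda>(f, g). (f(x := - 1), g)) (?C 1) (?C (- 1))"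
    by (rule bij_betw_byWitness[where f' = "\<lambda>(f, g). (f(x := 1), g)"])
       (use assms in \<open>auto simp: cylinder_def sign_funs_update\<close>)
  hence "card (?C 1) = card (?C (- 1))" by (rule bij_betw_same_card)
  moreover have "card (cylinder n A B f0 g0) = card (?C 1) + card (?C (- 1))"
    unfolding 1 by (rule card_Un_disjoint) (use 2 in auto)
  ultimately show "2 * card (?C 1) = card (cylinder n A B f0 g0)" "2 * card (?C (- 1)) = card (cylinder n A B f0 g0)"
    by auto
qed

text \<open>Exchanging the roles of the two functions transfers the facts on queries to f to queries
  to g.\<close>

lemma cylinder_swap: "cylinder n A B f0 g0 = prod.swap ` cylinder n B A g0 f0"
  by (auto simp: cylinder_def image_iff)

lemma card_cylinder_swap: "card (cylinder n A B f0 g0) = card (cylinder n B A g0 f0)"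
proof -
  have "card (prod.swap ` cylinder n B A g0 f0) = card (cylinder n B A g0 f0)"
    by (rule card_image) simp
  thus ?thesis by (simp only: cylinder_swap[of n A B f0 g0])
qed

lemma cylinder_split_g:
  assumes "y \<in> cube n" "y \<notin> B"
  shows "cylinder n A B f0 g0 = cylinder n A (insert y B) f0 (g0(y := 1)) \<union> cylinder n A (insert y B) f0 (g0(y := - 1))"
    "cylinder n A (insert y B) f0 (g0(y := 1)) \<inter> cylinder n A (insert y B) f0 (g0(y := - 1)) = {}"
    "2 * card (cylinder n A (insert y B) f0 (g0(y := 1))) = card (cylinder n A B f0 g0)"
    "2 * card (cylinder n A (insert y B) f0 (g0(y := - 1))) = card (cylinder n A B f0 g0)"
proof -
  note s = cylinder_split_f[OF assms, of A g0 f0]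
  note swap = cylinder_swap[of n A "insert y B" f0 "g0(y := u)" for u]
  show "cylinder n A B f0 g0 = cylinder n A (insert y B) f0 (g0(y := 1)) \<union> cylinder n A (insert y B) f0 (g0(y := - 1))"
    by (simp only: cylinder_swap[of n A B f0 g0] swap s(1) image_Un)
  show "cylinder n A (insert y B) f0 (g0(y := 1)) \<inter> cylinder n A (insert y B) f0 (g0(y := - 1)) = {}"
    by (auto simp: cylinder_def)
  show "2 * card (cylinder n A (insert y B) f0 (g0(y := 1))) = card (cylinder n A B f0 g0)"
    "2 * card (cylinder n A (insert y B) f0 (g0(y := - 1))) = card (cylinder n A B f0 g0)"
    using s(3,4) by (simp_all only: card_cylinder_swap[of n A "insert y B" f0 "g0(y := u)" for u] card_cylinder_swap[of n A B f0 g0])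
qed

lemma sum_cylinder_split_f:
  fixes F :: "(bool list \<Rightarrow> real) \<times> (bool list \<Rightarrow> real) \<Rightarrow> real" and u v w :: real
  assumes "x \<in> cube n" "x \<notin> A"
    and "sum F (cylinder n (insert x A) B (f0(x := 1)) g0) \<le> card (cylinder n (insert x A) B (f0(x := 1)) g0) * u"
    and "sum F (cylinder n (insert x A) B (f0(x := - 1)) g0) \<le> card (cylinder n (insert x A) B (f0(x := - 1)) g0) * v"
    and "u + v \<le> 2 * w"
  shows "sum F (cylinder n A B f0 g0) \<le> card (cylinder n A B f0 g0) * w"
proof -
  note sp = cylinder_split_f[OF assms(1,2), of B f0 g0]
  define k where "k = real (card (cylinder n (insert x A) B (f0(x := 1)) g0))"
  have k: "real (card (cylinder n (insert x A) B (f0(x := - 1)) g0)) = k" "real (card (cylinder n A B f0 g0)) = 2 * k"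
    using sp(3,4) by (auto simp: k_def)
  have "sum F (cylinder n A B f0 g0) =
      sum F (cylinder n (insert x A) B (f0(x := 1)) g0) + sum F (cylinder n (insert x A) B (f0(x := - 1)) g0)"
    unfolding sp(1) by (rule sum.union_disjoint) (use sp(2) in auto)
  also have "\<dots> \<le> k * (u + v)" using assms(3,4) by (simp add: k k_def [symmetric] distrib_left)
  also have "\<dots> \<le> k * (2 * w)" using assms(5) by (rule mult_left_mono) (simp add: k_def)
  finally show ?thesis by (simp add: k)
qed

lemma sum_cylinder_split_g:
  fixes F :: "(bool list \<Rightarrow> real) \<times> (bool list \<Rightarrow> real) \<Rightarrow> real" and u v w :: real
  assumes "y \<in> cube n" "y \<notin> B"
    and "sum F (cylinder n A (insert y B) f0 (g0(y := 1))) \<le> card (cylinder n A (insert y B) f0 (g0(y := 1))) * u"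
    and "sum F (cylinder n A (insert y B) f0 (g0(y := - 1))) \<le> card (cylinder n A (insert y B) f0 (g0(y := - 1))) * v"
    and "u + v \<le> 2 * w"
  shows "sum F (cylinder n A B f0 g0) \<le> card (cylinder n A B f0 g0) * w"
proof -
  have swap: "sum F (cylinder n A B f0 g0) = sum (F \<circ> prod.swap) (cylinder n B A g0 f0)" for A B f0 g0
    unfolding cylinder_swap[of n A B f0 g0] by (rule sum.reindex) simp
  show ?thesis
    using assms unfolding swap card_cylinder_swap[of n A] by (rule sum_cylinder_split_f)
qed

text \<open>
  Optional stopping: \<open>W\<close> is evaluated at the leaf reached, \<open>V\<close> dominates its conditional expectation and decreases
  on average under every fresh query.
\<close>

lemma tree_supermartingale:
  fixes V :: "bool list set \<Rightarrow> bool list set \<Rightarrow> (bool list \<Rightarrow> real) \<Rightarrow> (bool list \<Rightarrow> real) \<Rightarrow> real"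
    and W :: "bool \<Rightarrow> bool list set \<Rightarrow> bool list set \<Rightarrow> (bool list \<Rightarrow> real) \<Rightarrow> (bool list \<Rightarrow> real) \<Rightarrow> real"
  assumes leaf: "\<And>b A B f0 g0. A \<subseteq> cube n \<Longrightarrow> B \<subseteq> cube n \<Longrightarrow>
      (\<Sum>(f, g)\<in>cylinder n A B f0 g0. W b A B f g) \<le> card (cylinder n A B f0 g0) * V A B f0 g0"
    and step_f: "\<And>A B f g x. A \<subseteq> cube n \<Longrightarrow> B \<subseteq> cube n \<Longrightarrow> x \<in> cube n - A \<Longrightarrow> card A + card B < T \<Longrightarrow>
      V (insert x A) B (f(x := 1)) g + V (insert x A) B (f(x := - 1)) g \<le> 2 * V A B f g"
    and step_g: "\<And>A B f g y. A \<subseteq> cube n \<Longrightarrow> B \<subseteq> cube n \<Longrightarrow> y \<in> cube n - B \<Longrightarrow> card A + card B < T \<Longrightarrow>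
      V A (insert y B) f (g(y := 1)) + V A (insert y B) f (g(y := - 1)) \<le> 2 * V A B f g"
  shows "wf_tree n t \<Longrightarrow> A \<subseteq> cube n \<Longrightarrow> B \<subseteq> cube n \<Longrightarrow> card A + card B + depth t \<le> T \<Longrightarrow>
    (\<Sum>(f, g)\<in>cylinder n A B f0 g0. W (tree_output t f g) (A \<union> queried_f t f g) (B \<union> queried_g t f g) f g)
      \<le> card (cylinder n A B f0 g0) * V A B f0 g0"
proof (induction t arbitrary: A B f0 g0)
  case (Answer b)
  thus ?case using leaf by simp
next
  case (Query_f x t u)
  have fin: "finite A" using finite_subset[OF Query_f.prems(2)] by simp
  let ?W = "\<lambda>A B r. \<lambda>(f, g). W (tree_output r f g) (A \<union> queried_f r f g) (B \<union> queried_g r f g) f g"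
  show ?case
  proof (cases "x \<in> A")
    case True
    \<comment> \<open>A repeated query has its answer fixed by the cylinder: the branch is
      determined and the queried set does not grow.\<close>
    let ?r = "if f0 x = 1 then t else u"
    have "sum (?W A B (Query_f x t u)) (cylinder n A B f0 g0) = sum (?W A B ?r) (cylinder n A B f0 g0)"
      using True by (intro sum.cong) (auto simp: cylinder_def insert_absorb)
    thus ?thesis using Query_f.IH[of A B f0 g0] Query_f.prems by auto
  next
    case False
    have x: "x \<in> cube n" using Query_f.prems by simp
    have IH: "sum (?W A B (Query_f x t u)) (cylinder n (insert x A) B (f0(x := s)) g0) \<le>
        card (cylinder n (insert x A) B (f0(x := s)) g0) * V (insert x A) B (f0(x := s)) g0" for s
    proof -
      have "sum (?W A B (Query_f x t u)) (cylinder n (insert x A) B (f0(x := s)) g0) =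
          sum (?W (insert x A) B (if s = 1 then t else u)) (cylinder n (insert x A) B (f0(x := s)) g0)"
        by (intro sum.cong) (auto simp: cylinder_def)
      moreover have "sum (?W (insert x A) B t) (cylinder n (insert x A) B (f0(x := s)) g0) \<le>
          card (cylinder n (insert x A) B (f0(x := s)) g0) * V (insert x A) B (f0(x := s)) g0"
        by (rule Query_f.IH(1)) (use Query_f.prems x False fin in auto)
      moreover have "sum (?W (insert x A) B u) (cylinder n (insert x A) B (f0(x := s)) g0) \<le>
          card (cylinder n (insert x A) B (f0(x := s)) g0) * V (insert x A) B (f0(x := s)) g0"
        by (rule Query_f.IH(2)) (use Query_f.prems x False fin in auto)
      ultimately show ?thesis by (cases "s = 1") (simp_all only: if_True if_False simp_thms)
    qed
    show ?thesis
      by (rule sum_cylinder_split_f[OF x False IH IH step_f]) (use Query_f.prems x False in auto)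
  qed
next
  case (Query_g y t u)
  have fin: "finite B" using finite_subset[OF Query_g.prems(3)] by simp
  let ?W = "\<lambda>A B r. \<lambda>(f, g). W (tree_output r f g) (A \<union> queried_f r f g) (B \<union> queried_g r f g) f g"
  show ?case
  proof (cases "y \<in> B")
    case True
    let ?r = "if g0 y = 1 then t else u"
    have "sum (?W A B (Query_g y t u)) (cylinder n A B f0 g0) = sum (?W A B ?r) (cylinder n A B f0 g0)"
      using True by (intro sum.cong) (auto simp: cylinder_def insert_absorb)
    thus ?thesis using Query_g.IH[of A B f0 g0] Query_g.prems by auto
  next
    case False
    have y: "y \<in> cube n" using Query_g.prems by simp
    have IH: "sum (?W A B (Query_g y t u)) (cylinder n A (insert y B) f0 (g0(y := s))) \<le>
        card (cylinder n A (insert y B) f0 (g0(y := s))) * V A (insert y B) f0 (g0(y := s))" for s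
    proof -
      have "sum (?W A B (Query_g y t u)) (cylinder n A (insert y B) f0 (g0(y := s))) =
          sum (?W A (insert y B) (if s = 1 then t else u)) (cylinder n A (insert y B) f0 (g0(y := s)))"
        by (intro sum.cong) (auto simp: cylinder_def)
      moreover have "sum (?W A (insert y B) t) (cylinder n A (insert y B) f0 (g0(y := s))) \<le>
          card (cylinder n A (insert y B) f0 (g0(y := s))) * V A (insert y B) f0 (g0(y := s))"
        by (rule Query_g.IH(1)) (use Query_g.prems y False fin in auto)
      moreover have "sum (?W A (insert y B) u) (cylinder n A (insert y B) f0 (g0(y := s))) \<le>
          card (cylinder n A (insert y B) f0 (g0(y := s))) * V A (insert y B) f0 (g0(y := s))"
        by (rule Query_g.IH(2)) (use Query_g.prems y False fin in auto)
      ultimately show ?thesis by (cases "s = 1") (simp_all only: if_True if_False simp_thms)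
    qed
    show ?thesis
      by (rule sum_cylinder_split_g[OF y False IH IH step_g]) (use Query_g.prems y False in auto)
  qed
qed

section \<open>An exponential potential for the increments\<close>

lemma cosh_le_exp: "cosh x \<le> exp (x\<^sup>2 / 2)" for x :: real
proof -
  \<comment> \<open>The derivative of ln cosh is tanh, and tanh y \<le> y because tanh has
    derivative at most 1. Integrating again bounds ln cosh, the logarithmic moment generating
    function of a random sign.\<close>
  have tanh_le: "tanh y \<le> y" if "y \<ge> 0" for y :: real
  proof -
    have "0 - tanh 0 \<le> y - tanh y"
    proof (rule DERIV_nonneg_imp_nondecreasing[OF that])
      fix z :: real
      have "((\<lambda>y. y - tanh y) has_real_derivative 1 - (1 - (tanh z)\<^sup>2)) (at z)"
        by (auto intro!: derivative_eq_intros)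
      thus "\<exists>d. ((\<lambda>y. y - tanh y) has_real_derivative d) (at z) \<and> 0 \<le> d"
        by (intro exI[of _ "1 - (1 - (tanh z)\<^sup>2)"]) auto
    qed
    thus ?thesis by simp
  qed
  have "cosh y \<le> exp (y\<^sup>2 / 2)" if "y \<ge> 0" for y :: real
  proof -
    have "0\<^sup>2 / 2 - ln (cosh 0) \<le> y\<^sup>2 / 2 - ln (cosh y)"
    proof (rule DERIV_nonneg_imp_nondecreasing[OF that])
      fix z :: real assume z: "0 \<le> z"
      have "((\<lambda>y. y\<^sup>2 / 2 - ln (cosh y)) has_real_derivative z - tanh z) (at z)"
        by (auto intro!: derivative_eq_intros simp: tanh_def cosh_real_pos)
      thus "\<exists>d. ((\<lambda>y. y\<^sup>2 / 2 - ln (cosh y)) has_real_derivative d) (at z) \<and> 0 \<le> d"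
        using tanh_le[OF z] by (intro exI[of _ "z - tanh z"]) auto
    qed
    hence "ln (cosh y) \<le> y\<^sup>2 / 2" by simp
    thus ?thesis by (metis cosh_real_pos exp_le_cancel_iff exp_ln)
  qed
  from this[of "\<bar>x\<bar>"] show ?thesis by simp
qed

text \<open>Up to \<open>m\<close> the first summand suffices; beyond it, with \<bar>u\<bar> = m +
  d, the exponential dominates d and d^2. With \<open>m = n\<close>, the factor exp (- n) pays for
  adding the second summand over all 2^n points, so that a simultaneous bound on all squares has
  leading term n^2.\<close>

lemma square_le_cosh:
  fixes u m :: real
  assumes "m \<ge> 0"
  shows "u\<^sup>2 \<le> m\<^sup>2 + (4 * m + 4) * exp (- m) * cosh u"
proof (cases "\<bar>u\<bar> \<le> m")
  case True
  hence "u\<^sup>2 \<le> m\<^sup>2" by (metis abs_ge_zero power2_abs power_mono)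
  moreover have "(4 * m + 4) * exp (- m) * cosh u \<ge> 0"
    using assms cosh_real_nonneg[of u] by (intro mult_nonneg_nonneg) auto
  ultimately show ?thesis by linarith
next
  case False
  define d where "d = \<bar>u\<bar> - m"
  have d: "d \<ge> 0" using False by (simp add: d_def)
  have e: "1 + d + d\<^sup>2 / 2 \<le> exp d" by (rule exp_lower_Taylor_quadratic[OF d])
  have e1: "d \<le> exp d" "d\<^sup>2 \<le> 2 * exp d" using e d zero_le_power2[of d] by linarith+
  have "u\<^sup>2 = (m + d)\<^sup>2" by (simp add: d_def)
  also have "\<dots> = m\<^sup>2 + 2 * m * d + d\<^sup>2" by (simp add: power2_sum)
  also have "\<dots> \<le> m\<^sup>2 + 2 * m * exp d + 2 * exp d"
    using assms e1 by (intro add_mono mult_left_mono) auto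
  also have "\<dots> = m\<^sup>2 + (2 * m + 2) * (exp (- m) * exp \<bar>u\<bar>)"
    by (simp add: d_def algebra_simps flip: exp_add)
  also have "\<dots> \<le> m\<^sup>2 + (2 * m + 2) * (exp (- m) * (2 * cosh u))"
    using assms by (intro add_left_mono mult_left_mono) (auto simp: cosh_def abs_if)
  finally show ?thesis by (simp add: algebra_simps)
qed

lemma transform_on_insert:
  assumes "finite A" "x \<notin> A"
  shows "transform_on n (insert x A) (f(x := s)) y = transform_on n A f y + s * had n x y"
proof -
  have "(\<Sum>z\<in>A. (f(x := s)) z * had n z y) = (\<Sum>z\<in>A. f z * had n z y)"
    using assms by (intro sum.cong) auto
  thus ?thesis using assms by (simp add: transform_on_def)
qed

lemma corr_insert_f:
  assumes "finite A" "x \<notin> A"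
  shows "corr n (insert x A) B (f(x := s)) g = corr n A B f g + s * transform_on n B g x"
  unfolding corr_def transform_on_insert[OF assms]
  by (simp add: transform_on_def sum.distrib sum_distrib_left algebra_simps had_commute)

lemma corr_insert_g:
  assumes "finite B" "y \<notin> B"
  shows "corr n A (insert y B) f (g(y := s)) = corr n A B f g + s * transform_on n A f y"
proof -
  have "(\<Sum>z\<in>B. (g(y := s)) z * transform_on n A f z) = (\<Sum>z\<in>B. g z * transform_on n A f z)"
    using assms by (intro sum.cong) auto
  thus ?thesis using assms by (simp add: corr_def)
qed

text \<open>The scale sqrt (2^n / T) makes one answer move each argument of cosh by 1 / sqrt T, so a
  fresh query multiplies every cosh by at most exp (1 / (2 T)) on average. The leading factor loses
  exactly this much per query; it starts at exp (1/2) and stays at least 1 up to \<open>T\<close>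
  queries. The sum over the cube is the union bound.\<close>

definition potential :: "nat \<Rightarrow> nat \<Rightarrow> bool list set \<Rightarrow> (bool list \<Rightarrow> real) \<Rightarrow> real" where
  "potential n T A f = exp ((real T - card A) / (2 * T)) *
     (\<Sum>y\<in>cube n. cosh (sqrt (2 ^ n) / sqrt T * transform_on n A f y))"

text \<open>The bound of \<open>square_le_cosh\<close> with \<open>m = n\<close>, rescaled by T /
  2^n: it dominates the squared transforms at all points simultaneously.\<close>

definition deviation :: "nat \<Rightarrow> nat \<Rightarrow> bool list set \<Rightarrow> (bool list \<Rightarrow> real) \<Rightarrow> real" where
  "deviation n T A f = T / 2 ^ n * ((real n)\<^sup>2 + (4 * real n + 4) * exp (- real n) * potential n T A f)"

text \<open>
  The second summand pays for the increments of the squared bilinear form in the remaining queries. The factor \<open>2\<close>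
  leaves \<open>T (deviation + deviation)\<close> unspent at a leaf, which bounds the two sums of squares there.
\<close>

definition leaf_stat :: "nat \<Rightarrow> nat \<Rightarrow> bool list set \<Rightarrow> bool list set \<Rightarrow> (bool list \<Rightarrow> real) \<Rightarrow> (bool list \<Rightarrow> real) \<Rightarrow> real" where
  "leaf_stat n T A B f g = (corr n A B f g)\<^sup>2 +
     (2 * real T - card A - card B) * (deviation n T A f + deviation n T B g)"

lemma potential_nonneg: "potential n T A f \<ge> 0"
  unfolding potential_def by (intro mult_nonneg_nonneg sum_nonneg cosh_real_nonneg) auto

lemma deviation_nonneg: "deviation n T A f \<ge> 0"
  unfolding deviation_def using potential_nonneg by (intro mult_nonneg_nonneg add_nonneg_nonneg) auto

text \<open>Averaging cosh (a + b) and cosh (a - b) gives cosh a cosh b, where b^2 = 1/T, and cosh b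
  \<le> exp (1 / (2 T)).\<close>

lemma potential_step:
  assumes "finite A" "x \<notin> A" "T > 0"
  shows "potential n T (insert x A) (f(x := 1)) + potential n T (insert x A) (f(x := - 1)) \<le> 2 * potential n T A f"
proof -
  define c where "c = sqrt (2 ^ n) / sqrt T"
  define e where "e k = exp ((real T - k) / (2 * T))" for k :: nat
  have e: "e (Suc k) * exp (1 / (2 * T)) = e k" for k
    using assms(3) by (simp add: e_def field_simps flip: exp_add)
  have "cosh (c * had n x y) \<le> exp (1 / (2 * T))" for y
  proof -
    have "(c * had n x y)\<^sup>2 = 1 / T"
    proof -
      have "(c * had n x y)\<^sup>2 = (sqrt (2 ^ n))\<^sup>2 / (sqrt T)\<^sup>2 * (had n x y * had n x y)"
        by (simp add: c_def power2_eq_square)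
      thus ?thesis by (simp add: had_sq)
    qed
    thus ?thesis using cosh_le_exp[of "c * had n x y"] by (simp add: mult.commute)
  qed
  hence cs: "cosh (c * (a + had n x y)) + cosh (c * (a - had n x y)) \<le> 2 * (cosh (c * a) * exp (1 / (2 * T)))" for a y
    using mult_left_mono[OF _ cosh_real_nonneg[of "c * a"]]
    by (simp add: distrib_left right_diff_distrib cosh_add cosh_diff)
  have "potential n T (insert x A) (f(x := 1)) + potential n T (insert x A) (f(x := - 1)) =
      e (Suc (card A)) * (\<Sum>y\<in>cube n. cosh (c * (transform_on n A f y + had n x y)) +
        cosh (c * (transform_on n A f y - had n x y)))"
    using assms by (simp add: potential_def transform_on_insert c_def [symmetric] e_def sum.distrib distrib_left)
  also have "\<dots> \<le> e (Suc (card A)) * (\<Sum>y\<in>cube n. 2 * (cosh (c * transform_on n A f y) * exp (1 / (2 * T))))"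
    by (intro mult_left_mono sum_mono cs) (simp add: e_def)
  also have "\<dots> = 2 * (e (Suc (card A)) * exp (1 / (2 * T))) * (\<Sum>y\<in>cube n. cosh (c * transform_on n A f y))"
    by (simp add: sum_distrib_left sum_distrib_right mult_ac)
  also have "\<dots> = 2 * potential n T A f"
    unfolding e by (simp add: potential_def c_def e_def)
  finally show ?thesis .
qed

lemma deviation_step:
  assumes "finite A" "x \<notin> A" "T > 0"
  shows "deviation n T (insert x A) (f(x := 1)) + deviation n T (insert x A) (f(x := - 1)) \<le> 2 * deviation n T A f"
proof -
  define a b where "a = T / 2 ^ n * (real n)\<^sup>2" and "b = T / 2 ^ n * ((4 * real n + 4) * exp (- real n))"
  have d: "deviation n T A f = a + b * potential n T A f" for A f
    by (simp add: deviation_def a_def b_def algebra_simps add_divide_distrib)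
  have "b \<ge> 0" by (simp add: b_def)
  from mult_left_mono[OF potential_step[OF assms, of n f] this]
  show ?thesis by (simp add: d algebra_simps)
qed

text \<open>A single cosh is at most the sum over the cube, whose prefactor is at least 1 because
  card A \<le> T.\<close>

lemma transform_on_le_deviation:
  assumes "y \<in> cube n" "card A \<le> T" "T > 0"
  shows "(transform_on n A f y)\<^sup>2 \<le> deviation n T A f"
proof -
  define u where "u = sqrt (2 ^ n) / sqrt T * transform_on n A f y"
  have "cosh u \<le> (\<Sum>y\<in>cube n. cosh (sqrt (2 ^ n) / sqrt T * transform_on n A f y))"
    unfolding u_def using assms(1) by (intro member_le_sum) auto
  also have "\<dots> = 1 * \<dots>" by simp
  also have "\<dots> \<le> potential n T A f"
    unfolding potential_def using assms by (intro mult_right_mono sum_nonneg) auto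
  finally have "cosh u \<le> potential n T A f" .
  hence "u\<^sup>2 \<le> (real n)\<^sup>2 + (4 * real n + 4) * exp (- real n) * potential n T A f"
    using square_le_cosh[of "real n" u] by (smt (verit) mult_left_mono mult_nonneg_nonneg exp_ge_zero of_nat_0_le_iff)
  hence "T / 2 ^ n * u\<^sup>2 \<le> deviation n T A f"
    unfolding deviation_def by (intro mult_left_mono) auto
  moreover have "T / 2 ^ n * u\<^sup>2 = (transform_on n A f y)\<^sup>2"
    using assms(3) by (simp add: u_def power_mult_distrib power_divide)
  ultimately show ?thesis by simp
qed

lemma local_transform_on: "\<forall>x\<in>A. f x = f' x \<Longrightarrow> transform_on n A f y = transform_on n A f' y"
  by (simp add: transform_on_def)

lemma local_leaf_stat:
  assumes "\<forall>x\<in>A. f x = f' x" "\<forall>y\<in>B. g y = g' y"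
  shows "leaf_stat n T A B f g = leaf_stat n T A B f' g'"
proof -
  have "transform_on n A f = transform_on n A f'" "transform_on n B g = transform_on n B g'"
    using assms local_transform_on by blast+
  thus ?thesis using assms(2) by (simp add: leaf_stat_def deviation_def potential_def corr_def)
qed

text \<open>The average of (c + t)^2 and (c - t)^2 exceeds c^2 by t^2 \<le> d'. The coefficient
  drops by one, which releases d + d' and covers this excess.\<close>

lemma leaf_stat_step:
  assumes T: "T > 0" and r: "card A + card B < T" and d: "d \<ge> 0" "d' \<ge> 0" "d1 + d2 \<le> 2 * d" "t\<^sup>2 \<le> d'"
  shows "((c + t)\<^sup>2 + (2 * real T - Suc (card A) - card B) * (d1 + d')) +
      ((c - t)\<^sup>2 + (2 * real T - Suc (card A) - card B) * (d2 + d')) \<le>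
      2 * (c\<^sup>2 + (2 * real T - card A - card B) * (d + d'))"
proof -
  define r where "r = 2 * real T - Suc (card A) - card B"
  have "r \<ge> 0" using assms(2) by (simp add: r_def)
  hence "r * (d1 + d2) \<le> r * (2 * d)" using d by (intro mult_left_mono) auto
  moreover have "2 * real T - card A - card B = r + 1" by (simp add: r_def)
  ultimately show ?thesis
    unfolding r_def [symmetric] using d by (simp add: power2_eq_square algebra_simps)
qed

lemma tree_leaf_stat:
  assumes t: "wf_tree n t" "depth t \<le> T" and T: "T > 0"
  shows "(\<Sum>(f, g)\<in>sign_funs n \<times> sign_funs n. leaf_stat n T (queried_f t f g) (queried_g t f g) f g)
    \<le> card (sign_funs n \<times> sign_funs n) * (4 * (real T)\<^sup>2 / 2 ^ n * ((real n)\<^sup>2 + 8 * real n + 8))"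
proof -
  have cyl: "cylinder n {} {} (\<lambda>_. 1) (\<lambda>_. 1) = sign_funs n \<times> sign_funs n"
    by (auto simp: cylinder_def)
  have opt: "(\<Sum>(f, g)\<in>cylinder n {} {} (\<lambda>_. 1) (\<lambda>_. 1). leaf_stat n T ({} \<union> queried_f t f g) ({} \<union> queried_g t f g) f g)
    \<le> card (cylinder n {} {} (\<lambda>_. 1) (\<lambda>_. 1)) * leaf_stat n T {} {} (\<lambda>_. 1) (\<lambda>_. 1)"
  proof (rule tree_supermartingale[where T = T and W = "\<lambda>_. leaf_stat n T" and V = "leaf_stat n T"])
    fix A B f0 g0
    have "(\<Sum>(f, g)\<in>cylinder n A B f0 g0. leaf_stat n T A B f g) = (\<Sum>(f, g)\<in>cylinder n A B f0 g0. leaf_stat n T A B f0 g0)"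
      by (intro sum.cong) (auto simp: cylinder_def intro!: local_leaf_stat)
    thus "(\<Sum>(f, g)\<in>cylinder n A B f0 g0. leaf_stat n T A B f g) \<le>
        card (cylinder n A B f0 g0) * leaf_stat n T A B f0 g0" by simp
  next
    fix A B x and f g :: "bool list \<Rightarrow> real"
    assume h: "A \<subseteq> cube n" "B \<subseteq> cube n" "x \<in> cube n - A" "card A + card B < T"
    have fin: "finite A" using finite_subset[OF h(1)] by simp
    show "leaf_stat n T (insert x A) B (f(x := 1)) g + leaf_stat n T (insert x A) B (f(x := - 1)) g
        \<le> 2 * leaf_stat n T A B f g"
      using leaf_stat_step[OF T h(4) deviation_nonneg deviation_nonneg deviation_step[OF fin _ T]
          transform_on_le_deviation[of x n B T g], of x "corr n A B f g"] h fin T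
      by (simp add: leaf_stat_def corr_insert_f)
  next
    fix A B y and f g :: "bool list \<Rightarrow> real"
    assume h: "A \<subseteq> cube n" "B \<subseteq> cube n" "y \<in> cube n - B" "card A + card B < T"
    have fin: "finite B" using finite_subset[OF h(2)] by simp
    show "leaf_stat n T A (insert y B) f (g(y := 1)) + leaf_stat n T A (insert y B) f (g(y := - 1))
        \<le> 2 * leaf_stat n T A B f g"
      using leaf_stat_step[OF T, of B A, OF _ deviation_nonneg deviation_nonneg deviation_step[OF fin _ T]
          transform_on_le_deviation[of y n A T f], of y "corr n A B f g"] h fin T
      by (simp add: leaf_stat_def corr_insert_g algebra_simps)
  qed (use t in auto)
  \<comment> \<open>At the root every cosh is 1, so the potential is exp (1/2) 2^n. From exp (1/2)
    \<le> 2 and exp (- n) 2^n \<le> 1 the second summand is at most 2 (4 n + 4).\<close>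
  have dev: "deviation n T {} f \<le> T / 2 ^ n * ((real n)\<^sup>2 + 8 * real n + 8)" for f
  proof -
    have "exp (1 / 2) \<le> (2 :: real)" using exp_half_le2 by simp
    moreover have "exp (- real n) * 2 ^ n \<le> 1"
    proof -
      have "(2 :: real) ^ n \<le> exp 1 ^ n" using exp_ge_add_one_self[of 1] by (intro power_mono) auto
      also have "\<dots> = exp (real n)" by (simp flip: exp_of_nat_mult)
      finally show ?thesis by (simp add: exp_minus field_simps)
    qed
    ultimately have "exp (1 / 2) * (exp (- real n) * 2 ^ n) \<le> 2 * 1"
      by (intro mult_mono) auto
    hence "(4 * real n + 4) * (exp (1 / 2) * (exp (- real n) * 2 ^ n)) \<le> (4 * real n + 4) * (2 * 1)"
      by (intro mult_left_mono) auto
    thus ?thesis using T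
      unfolding deviation_def potential_def
      by (intro mult_left_mono) (simp_all add: transform_on_def card_cube mult_ac)
  qed
  have "leaf_stat n T {} {} (\<lambda>_. 1) (\<lambda>_. 1) = 2 * real T * (deviation n T {} (\<lambda>_. 1) + deviation n T {} (\<lambda>_. 1))"
    by (simp add: leaf_stat_def corr_def)
  also have "\<dots> \<le> 2 * real T * (T / 2 ^ n * ((real n)\<^sup>2 + 8 * real n + 8) + T / 2 ^ n * ((real n)\<^sup>2 + 8 * real n + 8))"
    by (intro mult_left_mono add_mono dev) auto
  also have "\<dots> = 4 * (real T)\<^sup>2 / 2 ^ n * ((real n)\<^sup>2 + 8 * real n + 8)"
    by (simp add: power2_eq_square)
  finally have "leaf_stat n T {} {} (\<lambda>_. 1) (\<lambda>_. 1) \<le> 4 * (real T)\<^sup>2 / 2 ^ n * ((real n)\<^sup>2 + 8 * real n + 8)" .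
  from mult_left_mono[OF this, of "real (card (sign_funs n \<times> sign_funs n))"] show ?thesis
    using opt unfolding cyl by simp
qed

lemma leaf_stat_ge:
  assumes "A \<subseteq> cube n" "B \<subseteq> cube n" "card A + card B \<le> T" "T > 0"
  shows "(corr n A B f g)\<^sup>2 + (\<Sum>y\<in>B. (transform_on n A f y)\<^sup>2) + (\<Sum>x\<in>A. (transform_on n B g x)\<^sup>2)
    \<le> leaf_stat n T A B f g"
proof -
  have "(\<Sum>y\<in>B. (transform_on n A f y)\<^sup>2) \<le> (\<Sum>y\<in>B. deviation n T A f)"
    using assms by (intro sum_mono transform_on_le_deviation) auto
  also have "\<dots> \<le> T * deviation n T A f"
    using assms deviation_nonneg by (auto intro!: mult_right_mono)
  finally have 1: "(\<Sum>y\<in>B. (transform_on n A f y)\<^sup>2) \<le> T * deviation n T A f" .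
  have "(\<Sum>x\<in>A. (transform_on n B g x)\<^sup>2) \<le> (\<Sum>x\<in>A. deviation n T B g)"
    using assms by (intro sum_mono transform_on_le_deviation) auto
  also have "\<dots> \<le> T * deviation n T B g"
    using assms deviation_nonneg by (auto intro!: mult_right_mono)
  finally have 2: "(\<Sum>x\<in>A. (transform_on n B g x)\<^sup>2) \<le> T * deviation n T B g" .
  have "T * (deviation n T A f + deviation n T B g) \<le>
      (2 * real T - card A - card B) * (deviation n T A f + deviation n T B g)"
    using assms deviation_nonneg by (intro mult_right_mono add_nonneg_nonneg) auto
  thus ?thesis using 1 2 by (simp add: leaf_stat_def distrib_left)
qed

section \<open>Leaf ratios as conditional averages of the joint density\<close>

context rounding begin

definition joint_density :: "nat \<Rightarrow> (bool list \<Rightarrow> real) \<Rightarrow> (bool list \<Rightarrow> real) \<Rightarrow> real" where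
  "joint_density n f g = ratio n (cube n) (cube n) f g"

lemma lik_insert_f:
  assumes "finite A" "x \<notin> A"
  shows "lik n (insert x A) B (f(x := s)) g v = (1 + s * sg (v x)) * lik n A B f g v"
proof -
  have "(\<Prod>z\<in>A. 1 + (f(x := s)) z * sg (v z)) = (\<Prod>z\<in>A. 1 + f z * sg (v z))"
    using assms by (intro prod.cong) auto
  thus ?thesis using assms by (simp add: lik_def)
qed

lemma lik_insert_g:
  assumes "finite B" "y \<notin> B"
  shows "lik n A (insert y B) f (g(y := s)) v = (1 + s * \<psi> (hadamard n v y)) * lik n A B f g v"
proof -
  have "(\<Prod>z\<in>B. 1 + (g(y := s)) z * \<psi> (hadamard n v z)) = (\<Prod>z\<in>B. 1 + g z * \<psi> (hadamard n v z))"
    using assms by (intro prod.cong) auto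
  thus ?thesis using assms by (simp add: lik_def)
qed

lemma local_lik:
  assumes "\<forall>x\<in>A. f x = f' x" "\<forall>y\<in>B. g y = g' y"
  shows "lik n A B f g v = lik n A B f' g' v"
  using assms by (simp add: lik_def)

lemma local_ratio:
  assumes "\<forall>x\<in>A. f x = f' x" "\<forall>y\<in>B. g y = g' y"
  shows "ratio n A B f g = ratio n A B f' g'"
proof -
  have "lik n A B f g = lik n A B f' g'" by (rule ext) (rule local_lik[OF assms])
  thus ?thesis by (simp add: ratio_def)
qed

text \<open>Summing out an unqueried coordinate turns its two factors 1 + s and 1 - s into 2, the
  number of its values. The induction is on the number of unqueried coordinates.\<close>

lemma sum_cylinder_lik:
  assumes "A \<subseteq> cube n" "B \<subseteq> cube n"
  shows "(\<Sum>(f, g)\<in>cylinder n A B f0 g0. lik n (cube n) (cube n) f g v) =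
    card (cylinder n A B f0 g0) * lik n A B f0 g0 v"
  using assms
proof (induction "card (cube n - A) + card (cube n - B)" arbitrary: A B f0 g0 rule: less_induct)
  case less
  have fin: "finite A" "finite B" using less.prems finite_subset[of _ "cube n"] by auto
  consider "A = cube n" "B = cube n" | x where "x \<in> cube n" "x \<notin> A" | y where "y \<in> cube n" "y \<notin> B"
    using less.prems by blast
  thus ?case
  proof cases
    case 1
    have "(\<Sum>(f, g)\<in>cylinder n A B f0 g0. lik n (cube n) (cube n) f g v) =
        (\<Sum>(f, g)\<in>cylinder n A B f0 g0. lik n A B f0 g0 v)"
      unfolding 1 by (intro sum.cong) (auto simp: cylinder_def intro!: local_lik)
    thus ?thesis by simp
  next
    case (2 x)
    note sp = cylinder_split_f[OF 2, of B f0 g0]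
    have "cube n - insert x A \<subset> cube n - A" using 2 by blast
    hence lt: "card (cube n - insert x A) + card (cube n - B) < card (cube n - A) + card (cube n - B)"
      by (simp add: psubset_card_mono)
    have "(\<Sum>(f, g)\<in>cylinder n A B f0 g0. lik n (cube n) (cube n) f g v) =
      card (cylinder n (insert x A) B (f0(x := 1)) g0) * lik n (insert x A) B (f0(x := 1)) g0 v +
      card (cylinder n (insert x A) B (f0(x := - 1)) g0) * lik n (insert x A) B (f0(x := - 1)) g0 v"
      unfolding sp(1) sum.union_disjoint[OF finite_cylinder finite_cylinder sp(2)]
      using less.prems 2 by (intro arg_cong2[of _ _ _ _ "(+)"] less.hyps lt) auto
    thus ?thesis
      using sp(3,4) by (simp add: lik_insert_f fin 2 algebra_simps flip: sp(3))
  next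
    case (3 y)
    note sp = cylinder_split_g[OF 3, of A f0 g0]
    have "cube n - insert y B \<subset> cube n - B" using 3 by blast
    hence lt: "card (cube n - A) + card (cube n - insert y B) < card (cube n - A) + card (cube n - B)"
      by (simp add: psubset_card_mono)
    have "(\<Sum>(f, g)\<in>cylinder n A B f0 g0. lik n (cube n) (cube n) f g v) =
      card (cylinder n A (insert y B) f0 (g0(y := 1))) * lik n A (insert y B) f0 (g0(y := 1)) v +
      card (cylinder n A (insert y B) f0 (g0(y := - 1))) * lik n A (insert y B) f0 (g0(y := - 1)) v"
      unfolding sp(1) sum.union_disjoint[OF finite_cylinder finite_cylinder sp(2)]
      using less.prems 3 by (intro arg_cong2[of _ _ _ _ "(+)"] less.hyps lt) auto
    thus ?thesis
      using sp(3,4) by (simp add: lik_insert_g fin 3 algebra_simps flip: sp(3))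
  qed
qed

text \<open>This is what allows the full density, which is hard to estimate, to be replaced by the
  ratio of the leaf in any average over leaves.\<close>

lemma integral_sum_lik:
  assumes "A \<subseteq> cube n" "B \<subseteq> cube n"
  shows "(\<Sum>(f, g)\<in>cylinder n A B f0 g0. joint_density n f g) = card (cylinder n A B f0 g0) * ratio n A B f0 g0"
proof -
  have int: "integrable (gaussian (cube n)) (lik n (cube n) (cube n) f g)" if "(f, g) \<in> cylinder n A B f0 g0" for f g
    using that by (intro integrable_lik) (auto simp: cylinder_def abs_sign_funs)
  have "(\<Sum>(f, g)\<in>cylinder n A B f0 g0. joint_density n f g) =
      (\<integral>v. (\<Sum>(f, g)\<in>cylinder n A B f0 g0. lik n (cube n) (cube n) f g v) \<partial>gaussian (cube n))"
    unfolding joint_density_def ratio_def case_prod_beta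
    by (rule Bochner_Integration.integral_sum [symmetric]) (use int in auto)
  thus ?thesis unfolding sum_cylinder_lik[OF assms] by (simp add: ratio_def)
qed

lemma density_nonneg:
  assumes "f \<in> sign_funs n" "g \<in> sign_funs n"
  shows "joint_density n f g \<ge> 0"
proof -
  have "1 + f x * sg t \<ge> 0" "1 + g x * \<psi> t \<ge> 0" if "x \<in> cube n" for x t
    using abs_sign_funs[OF assms(1) that] weight_pos[OF abs_sign_funs[OF assms(2) that], of t] \<rho>
    by (auto simp: sg_def abs_if split: if_splits)
  thus ?thesis
    unfolding joint_density_def ratio_def lik_def by (intro Bochner_Integration.integral_nonneg mult_nonneg_nonneg prod_nonneg) auto
qed

end

section \<open>Forrelation of the hard distribution\<close>

definition sine_mean :: "real \<Rightarrow> real" where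
  "sine_mean c = (\<integral>z. sg z * sin (c * z) \<partial>std_normal)"

text \<open>The quotient of \<open>sine_mean c\<close> by the characteristic function exp (- c^2 /
  2). Once the characteristic function of the whole linear form is factored out, each sign in the
  integrand leaves one such quotient.\<close>

definition sine_slope :: "real \<Rightarrow> real" where
  "sine_slope c = sine_mean c * exp (c\<^sup>2 / 2)"

lemma has_bochner_integral_cis:
  "has_bochner_integral std_normal (\<lambda>z. cis (c * z)) (complex_of_real (exp (- c\<^sup>2 / 2)))"
proof -
  have "(\<integral>z. cis (c * z) \<partial>std_normal) = complex_of_real (exp (- c\<^sup>2 / 2))"
    using fun_cong[OF char_std_normal_distribution, of c] by (simp add: char_def cis_conv_exp)
  moreover have "integrable std_normal (\<lambda>z. cis (c * z))"
    by (rule integrable_std_normal_bounded[of _ 1]) (auto simp: cis_conv_exp)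
  ultimately show ?thesis by (simp add: has_bochner_integral_iff)
qed

lemma has_bochner_integral_sg_cis:
  "has_bochner_integral std_normal (\<lambda>z. of_real (sg z) * cis (c * z)) (\<i> * complex_of_real (sine_mean c))"
proof -
  have "(\<integral>z. sg z * cos (c * z) \<partial>std_normal) = 0"
  proof (rule std_normal_odd)
    show "AE z in std_normal. sg (- z) * cos (c * - z) = - (sg z * cos (c * z))"
      using AE_std_normal_neq[of 0] by eventually_elim (auto simp: sg_def)
  qed simp
  moreover have "integrable std_normal (\<lambda>z. sg z * cos (c * z))"
    "integrable std_normal (\<lambda>z. sg z * sin (c * z))"
    by (auto intro!: integrable_std_normal_bounded[of _ 1] simp: abs_mult)
  ultimately have "has_bochner_integral std_normal (\<lambda>z. sg z * cos (c * z)) 0"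
    "has_bochner_integral std_normal (\<lambda>z. sg z * sin (c * z)) (sine_mean c)"
    by (auto simp: has_bochner_integral_iff sine_mean_def)
  hence "has_bochner_integral std_normal
      (\<lambda>z. complex_of_real (sg z * cos (c * z)) + \<i> * complex_of_real (sg z * sin (c * z)))
      (complex_of_real 0 + \<i> * complex_of_real (sine_mean c))"
    by (intro has_bochner_integral_add has_bochner_integral_mult_right has_bochner_integral_of_real)
  moreover have "complex_of_real (sg z * cos (c * z)) + \<i> * complex_of_real (sg z * sin (c * z)) = of_real (sg z) * cis (c * z)" for z
    by (simp add: complex_eq_iff)
  ultimately show ?thesis by simp
qed

lemma abs_sin_diff_le: "\<bar>sin t - t\<bar> \<le> t\<^sup>2 / 2" for t :: real
  using Maclaurin_sin_bound[of t 2] by (simp add: numeral_2_eq_2 sin_coeff_def)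

text \<open>Replaces sin (c z) by c z with error at most (c z)^2 / 2, and uses E z^2 = 1.\<close>

lemma sine_mean_approx: "\<bar>sine_mean c - sqrt (2 / pi) * c\<bar> \<le> c\<^sup>2 / 2"
proof -
  have int: "integrable std_normal (\<lambda>z. z * sg z)"
    using integrable_moment_bounded[of sg 1 1] by simp
  have isin: "integrable std_normal (\<lambda>z. sg z * sin (c * z))"
    by (rule integrable_std_normal_bounded[of _ 1]) (auto simp: abs_mult)
  have i2: "integrable std_normal (\<lambda>z. c\<^sup>2 / 2 * z\<^sup>2)"
    using integrable_std_normal_distribution_moment[of 2] by simp
  have pw: "\<bar>sg z * sin (c * z) - c * (z * sg z)\<bar> \<le> c\<^sup>2 / 2 * z\<^sup>2" for z
  proof -
    have "sg z * sin (c * z) - c * (z * sg z) = sg z * (sin (c * z) - c * z)"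
      by (simp add: algebra_simps)
    hence "\<bar>sg z * sin (c * z) - c * (z * sg z)\<bar> = \<bar>sin (c * z) - c * z\<bar>"
      by (simp only: abs_mult abs_sg mult_1)
    thus ?thesis
      using abs_sin_diff_le[of "c * z"] by (simp add: power_mult_distrib)
  qed
  have id: "integrable std_normal (\<lambda>z. sg z * sin (c * z) - c * (z * sg z))"
    by (intro Bochner_Integration.integrable_diff isin integrable_mult_right int)
  have "(\<integral>z. sg z * sin (c * z) - c * (z * sg z) \<partial>std_normal) = sine_mean c - c * sqrt (2 / pi)"
    unfolding sine_mean_def mean_sg [symmetric]
    by (simp only: Bochner_Integration.integral_diff[OF isin integrable_mult_right[OF int]] integral_mult_right_zero)
  moreover have "\<bar>\<integral>z. sg z * sin (c * z) - c * (z * sg z) \<partial>std_normal\<bar> \<le>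
      (\<integral>z. \<bar>sg z * sin (c * z) - c * (z * sg z)\<bar> \<partial>std_normal)"
    by (rule integral_abs_bound)
  moreover have "\<dots> \<le> (\<integral>z. c\<^sup>2 / 2 * z\<^sup>2 \<partial>std_normal)"
    by (rule integral_mono[OF integrable_abs[OF id] i2 pw])
  moreover have "(\<integral>z. c\<^sup>2 / 2 * z\<^sup>2 \<partial>std_normal) = c\<^sup>2 / 2"
    using std_normal_distribution_even_moments(1)[of 1] by simp
  ultimately have "\<bar>sine_mean c - c * sqrt (2 / pi)\<bar> \<le> c\<^sup>2 / 2" by linarith
  thus ?thesis by (simp only: mult.commute)
qed

lemma sine_slope_approx:
  assumes R: "R \<ge> 0"
  obtains C where "C \<ge> 0" "\<And>c. \<bar>c\<bar> \<le> R \<Longrightarrow> \<bar>sine_slope c - sqrt (2 / pi) * c\<bar> \<le> C * c\<^sup>2"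
    "\<And>c. \<bar>c\<bar> \<le> R \<Longrightarrow> \<bar>sine_slope c\<bar> \<le> C * \<bar>c\<bar>"
proof -
  define \<kappa> :: real where "\<kappa> = sqrt (2 / pi)"
  have \<kappa>: "0 \<le> \<kappa>" "\<kappa> \<le> 1" using pi_gt3 by (auto simp: \<kappa>_def)
  define M where "M = exp (R\<^sup>2 / 2)"
  have M: "M \<ge> 1" by (simp add: M_def)
  have 1: "\<bar>sine_slope c - \<kappa> * c\<bar> \<le> (M + R * M) * c\<^sup>2" if c: "\<bar>c\<bar> \<le> R" for c
  proof -
    define e where "e = exp (c\<^sup>2 / 2)"
    have "c\<^sup>2 \<le> R\<^sup>2" using c by (metis abs_ge_zero power2_abs power_mono)
    hence e: "1 \<le> e" "e \<le> M" by (auto simp: e_def M_def)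
    have "exp (- (c\<^sup>2 / 2)) \<ge> 1 + - (c\<^sup>2 / 2)" by (rule exp_ge_add_one_self)
    hence "e * exp (- (c\<^sup>2 / 2)) \<ge> e * (1 - c\<^sup>2 / 2)" using e by (intro mult_left_mono) auto
    hence e1: "e - 1 \<le> e * (c\<^sup>2 / 2)" by (simp add: e_def algebra_simps flip: exp_add)
    have "sine_slope c - \<kappa> * c = (sine_mean c - \<kappa> * c) * e + \<kappa> * c * (e - 1)"
      by (simp add: sine_slope_def e_def algebra_simps)
    also have "\<bar>\<dots>\<bar> \<le> \<bar>sine_mean c - \<kappa> * c\<bar> * e + \<bar>\<kappa>\<bar> * \<bar>c\<bar> * (e - 1)"
      using e by (intro order_trans[OF abs_triangle_ineq]) (simp add: abs_mult)
    also have "\<dots> \<le> (c\<^sup>2 / 2) * M + 1 * R * (M * (c\<^sup>2 / 2))"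
    proof (intro add_mono mult_mono)
      show "e - 1 \<le> M * (c\<^sup>2 / 2)"
        using e e1 by (meson mult_right_mono order_trans zero_le_power2 divide_nonneg_nonneg zero_le_numeral)
    qed (use sine_mean_approx[of c] \<kappa> e c R M in \<open>auto simp: \<kappa>_def\<close>)
    also have "\<dots> \<le> (M + R * M) * c\<^sup>2"
    proof -
      have "0 \<le> (M + R * M) * c\<^sup>2" using M R by (intro mult_nonneg_nonneg add_nonneg_nonneg) auto
      thus ?thesis by (simp add: algebra_simps)
    qed
    finally show ?thesis .
  qed
  define C where "C = max (M + R * M) (1 + (M + R * M) * R)"
  have MR: "M + R * M \<ge> 0" using M R by (intro add_nonneg_nonneg mult_nonneg_nonneg) auto
  show ?thesis
  proof (rule that[of C])
    show "C \<ge> 0" using MR by (simp add: C_def le_max_iff_disj)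
    fix c assume c: "\<bar>c\<bar> \<le> R"
    have "(M + R * M) * c\<^sup>2 \<le> C * c\<^sup>2" by (intro mult_right_mono) (auto simp: C_def)
    thus "\<bar>sine_slope c - sqrt (2 / pi) * c\<bar> \<le> C * c\<^sup>2"
      using 1[OF c] by (simp add: \<kappa>_def)
    have "\<bar>sine_slope c\<bar> \<le> \<bar>\<kappa> * c\<bar> + \<bar>sine_slope c - \<kappa> * c\<bar>" by simp
    also have "\<dots> \<le> 1 * \<bar>c\<bar> + (M + R * M) * (R * \<bar>c\<bar>)"
    proof (intro add_mono)
      show "\<bar>\<kappa> * c\<bar> \<le> 1 * \<bar>c\<bar>" using \<kappa> unfolding abs_mult by (intro mult_right_mono) auto
      have "c\<^sup>2 = \<bar>c\<bar> * \<bar>c\<bar>" by (simp add: power2_eq_square)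
      also have "\<dots> \<le> R * \<bar>c\<bar>" using c by (intro mult_right_mono) auto
      finally have "(M + R * M) * c\<^sup>2 \<le> (M + R * M) * (R * \<bar>c\<bar>)" using MR by (rule mult_left_mono)
      thus "\<bar>sine_slope c - \<kappa> * c\<bar> \<le> (M + R * M) * (R * \<bar>c\<bar>)" using 1[OF c] by simp
    qed
    also have "\<dots> = (1 + (M + R * M) * R) * \<bar>c\<bar>" by (simp add: algebra_simps)
    also have "\<dots> \<le> C * \<bar>c\<bar>" by (intro mult_right_mono) (auto simp: C_def)
    finally show "\<bar>sine_slope c\<bar> \<le> C * \<bar>c\<bar>" .
  qed
qed

lemma cis_sum: "cis (\<Sum>x\<in>I. c x) = (\<Prod>x\<in>I. cis (c x))"
  by (induction I rule: infinite_finite_induct) (auto simp: cis_mult [symmetric])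

lemma gaussian_sg_cis:
  assumes "finite I" "a \<in> I"
  shows "has_bochner_integral (gaussian I) (\<lambda>v. of_real (sg (v a)) * cis (\<Sum>x\<in>I. c x * v x))
    (\<i> * complex_of_real (sine_slope (c a) * exp (- (\<Sum>x\<in>I. (c x)\<^sup>2) / 2)))"
proof -
  define p where "p x = (if x = a then \<lambda>z. of_real (sg z) * cis (c x * z) else (\<lambda>z. cis (c x * z)))" for x
  define e where "e x = (if x = a then \<i> * complex_of_real (sine_mean (c x)) else complex_of_real (exp (- (c x)\<^sup>2 / 2)))" for x
  have "has_bochner_integral (gaussian I) (\<lambda>v. \<Prod>x\<in>I. p x (v x)) (\<Prod>x\<in>I. e x)"
    by (rule gaussian_prod) (use assms has_bochner_integral_cis has_bochner_integral_sg_cis in \<open>auto simp: p_def e_def\<close>)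
  moreover have "(\<Prod>x\<in>I. p x (v x)) = of_real (sg (v a)) * cis (\<Sum>x\<in>I. c x * v x)" for v
  proof -
    have "(\<Prod>x\<in>I. p x (v x)) = p a (v a) * (\<Prod>x\<in>I - {a}. cis (c x * v x))"
      using assms by (subst prod.remove[of I a]) (auto simp: p_def intro!: prod.cong)
    also have "\<dots> = of_real (sg (v a)) * (\<Prod>x\<in>I. cis (c x * v x))"
      using assms by (simp add: p_def prod.remove[of I a "\<lambda>x. cis (c x * v x)"])
    finally show ?thesis by (simp add: cis_sum)
  qed
  moreover have "(\<Prod>x\<in>I. e x) = \<i> * complex_of_real (sine_slope (c a) * exp (- (\<Sum>x\<in>I. (c x)\<^sup>2) / 2))"
  proof -
    have "(\<Prod>x\<in>I. e x) = e a * (\<Prod>x\<in>I - {a}. complex_of_real (exp (- (c x)\<^sup>2 / 2)))"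
      using assms by (subst prod.remove[of I a]) (auto simp: e_def intro!: prod.cong)
    also have "\<dots> = e a * complex_of_real (exp (- (\<Sum>x\<in>I - {a}. (c x)\<^sup>2) / 2))"
      using assms by (simp add: exp_sum sum_negf [symmetric] sum_divide_distrib)
    also have "exp (- (\<Sum>x\<in>I - {a}. (c x)\<^sup>2) / 2) = exp ((c a)\<^sup>2 / 2) * exp (- (\<Sum>x\<in>I. (c x)\<^sup>2) / 2)"
      using assms by (simp add: sum.remove[of I a] field_simps flip: exp_add)
    finally show ?thesis by (simp add: e_def sine_slope_def)
  qed
  ultimately show ?thesis by simp
qed

lemma gaussian_cis:
  assumes "finite I"
  shows "has_bochner_integral (gaussian I) (\<lambda>v. cis (\<Sum>x\<in>I. c x * v x))
    (complex_of_real (exp (- (\<Sum>x\<in>I. (c x)\<^sup>2) / 2)))"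
proof -
  have "has_bochner_integral (gaussian I) (\<lambda>v. \<Prod>x\<in>I. cis (c x * v x)) (\<Prod>x\<in>I. complex_of_real (exp (- (c x)\<^sup>2 / 2)))"
    by (rule gaussian_prod) (use assms has_bochner_integral_cis in auto)
  thus ?thesis
    using assms by (simp add: cis_sum exp_sum sum_negf [symmetric] sum_divide_distrib)
qed

lemma gaussian_sg_sg_cis:
  assumes "finite I" "a \<in> I" "b \<in> I" "a \<noteq> b"
  shows "has_bochner_integral (gaussian I) (\<lambda>v. of_real (sg (v a) * sg (v b)) * cis (\<Sum>x\<in>I. c x * v x))
    (complex_of_real (- (sine_slope (c a) * sine_slope (c b) * exp (- (\<Sum>x\<in>I. (c x)\<^sup>2) / 2))))"
proof -
  define p where "p x = (if x = a \<or> x = b then \<lambda>z. of_real (sg z) * cis (c x * z) else (\<lambda>z. cis (c x * z)))" for x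
  define e where "e x = (if x = a \<or> x = b then \<i> * complex_of_real (sine_mean (c x)) else complex_of_real (exp (- (c x)\<^sup>2 / 2)))" for x
  have rem: "(\<Prod>x\<in>I. h x) = h a * (h b * (\<Prod>x\<in>I - {a, b}. h x))" for h :: "'a \<Rightarrow> complex"
    using assms by (simp add: prod.remove[of I a] prod.remove[of "I - {a}" b] Diff_insert2 [symmetric] insert_commute)
  have "has_bochner_integral (gaussian I) (\<lambda>v. \<Prod>x\<in>I. p x (v x)) (\<Prod>x\<in>I. e x)"
    by (rule gaussian_prod) (use assms has_bochner_integral_cis has_bochner_integral_sg_cis in \<open>auto simp: p_def e_def\<close>)
  moreover have "(\<Prod>x\<in>I. p x (v x)) = of_real (sg (v a) * sg (v b)) * cis (\<Sum>x\<in>I. c x * v x)" for v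
  proof -
    have "(\<Prod>x\<in>I - {a, b}. p x (v x)) = (\<Prod>x\<in>I - {a, b}. cis (c x * v x))"
      by (intro prod.cong) (auto simp: p_def)
    thus ?thesis by (simp add: cis_sum rem p_def)
  qed
  moreover have "(\<Prod>x\<in>I. e x) = complex_of_real (- (sine_slope (c a) * sine_slope (c b) * exp (- (\<Sum>x\<in>I. (c x)\<^sup>2) / 2)))"
  proof -
    have "(\<Prod>x\<in>I - {a, b}. e x) = (\<Prod>x\<in>I - {a, b}. complex_of_real (exp (- (c x)\<^sup>2 / 2)))"
      by (intro prod.cong) (auto simp: e_def)
    also have "\<dots> = complex_of_real (exp (- (\<Sum>x\<in>I - {a, b}. (c x)\<^sup>2) / 2))"
      using assms by (simp add: exp_sum sum_negf [symmetric] sum_divide_distrib)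
    also have "(\<Sum>x\<in>I - {a, b}. (c x)\<^sup>2) = (\<Sum>x\<in>I. (c x)\<^sup>2) - (c a)\<^sup>2 - (c b)\<^sup>2"
      using assms by (simp add: sum.remove[of I a] sum.remove[of "I - {a}" b] Diff_insert2 [symmetric] insert_commute)
    also have "exp (- ((\<Sum>x\<in>I. (c x)\<^sup>2) - (c a)\<^sup>2 - (c b)\<^sup>2) / 2) =
        exp ((c a)\<^sup>2 / 2) * exp ((c b)\<^sup>2 / 2) * exp (- (\<Sum>x\<in>I. (c x)\<^sup>2) / 2)"
      by (simp add: field_simps flip: exp_add)
    finally have "(\<Prod>x\<in>I. e x) = (\<i> * complex_of_real (sine_mean (c a))) * ((\<i> * complex_of_real (sine_mean (c b))) *
        complex_of_real (exp ((c a)\<^sup>2 / 2) * exp ((c b)\<^sup>2 / 2) * exp (- (\<Sum>x\<in>I. (c x)\<^sup>2) / 2)))"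
      by (simp only: rem) (simp add: e_def)
    thus ?thesis by (simp add: sine_slope_def complex_eq_iff)
  qed
  ultimately show ?thesis by simp
qed

lemma gaussian_linear_sin:
  assumes "finite I"
  shows "has_bochner_integral (gaussian I) (\<lambda>v. (\<Sum>x\<in>I. \<alpha> x * sg (v x)) * sin (\<Sum>x\<in>I. c x * v x))
    (exp (- (\<Sum>x\<in>I. (c x)\<^sup>2) / 2) * (\<Sum>x\<in>I. \<alpha> x * sine_slope (c x)))"
proof -
  have "has_bochner_integral (gaussian I) (\<lambda>v. \<alpha> a * (sg (v a) * sin (\<Sum>x\<in>I. c x * v x)))
      (\<alpha> a * (sine_slope (c a) * exp (- (\<Sum>x\<in>I. (c x)\<^sup>2) / 2)))" if "a \<in> I" for a
    using has_bochner_integral_Im[OF gaussian_sg_cis[OF assms that, of c]]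
    by (intro has_bochner_integral_mult_right) simp
  from has_bochner_integral_sum[OF this, of I "\<lambda>a. a"]
  show ?thesis by (simp add: sum_distrib_left sum_distrib_right mult_ac)
qed

text \<open>Equal indices give sg^2 = 1 and the bare characteristic function; distinct ones give
  minus the product of two slopes, the minus coming from the square of the imaginary unit.
  Completing the latter to a full product of sums adds the squared slope on the diagonal.\<close>

lemma gaussian_quadratic_cos:
  assumes "finite I"
  shows "has_bochner_integral (gaussian I)
     (\<lambda>v. (\<Sum>x\<in>I. \<alpha> x * sg (v x)) * (\<Sum>x\<in>I. \<beta> x * sg (v x)) * cos (\<Sum>x\<in>I. c x * v x))
    (exp (- (\<Sum>x\<in>I. (c x)\<^sup>2) / 2) * ((\<Sum>x\<in>I. \<alpha> x * \<beta> x * (1 + (sine_slope (c x))\<^sup>2)) -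
       (\<Sum>x\<in>I. \<alpha> x * sine_slope (c x)) * (\<Sum>x\<in>I. \<beta> x * sine_slope (c x))))"
proof -
  define E where "E = exp (- (\<Sum>x\<in>I. (c x)\<^sup>2) / 2)"
  define r where "r a b = (if a = b then E else - (sine_slope (c a) * sine_slope (c b) * E))" for a b
  have *: "has_bochner_integral (gaussian I) (\<lambda>v. sg (v a) * sg (v b) * cos (\<Sum>x\<in>I. c x * v x)) (r a b)"
    if "a \<in> I" "b \<in> I" for a b
  proof (cases "a = b")
    case True
    thus ?thesis
      using has_bochner_integral_Re[OF gaussian_cis[OF assms, of c]] by (simp add: r_def E_def)
  next
    case False
    thus ?thesis
      using has_bochner_integral_Re[OF gaussian_sg_sg_cis[OF assms that False, of c]] by (simp add: r_def E_def)
  qed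
  have "has_bochner_integral (gaussian I)
      (\<lambda>v. \<Sum>a\<in>I. \<Sum>b\<in>I. \<alpha> a * \<beta> b * (sg (v a) * sg (v b) * cos (\<Sum>x\<in>I. c x * v x)))
      (\<Sum>a\<in>I. \<Sum>b\<in>I. \<alpha> a * \<beta> b * r a b)"
    by (intro has_bochner_integral_sum has_bochner_integral_mult_right *)
  moreover have "(\<Sum>a\<in>I. \<Sum>b\<in>I. \<alpha> a * \<beta> b * (sg (v a) * sg (v b) * s)) =
      (\<Sum>x\<in>I. \<alpha> x * sg (v x)) * (\<Sum>x\<in>I. \<beta> x * sg (v x)) * s" for v s
    unfolding sum_product sum_distrib_right by (intro sum.cong refl) (simp add: sum_distrib_left mult_ac)
  moreover have "(\<Sum>a\<in>I. \<Sum>b\<in>I. \<alpha> a * \<beta> b * r a b) =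
      E * ((\<Sum>x\<in>I. \<alpha> x * \<beta> x * (1 + (sine_slope (c x))\<^sup>2)) -
       (\<Sum>x\<in>I. \<alpha> x * sine_slope (c x)) * (\<Sum>x\<in>I. \<beta> x * sine_slope (c x)))"
  proof -
    have "(\<Sum>b\<in>I. \<alpha> a * \<beta> b * r a b) = E * (\<alpha> a * \<beta> a * (1 + (sine_slope (c a))\<^sup>2)
        - \<alpha> a * sine_slope (c a) * (\<Sum>b\<in>I. \<beta> b * sine_slope (c b)))" if "a \<in> I" for a
    proof -
      have "(\<Sum>b\<in>I. \<alpha> a * \<beta> b * r a b) =
        (\<Sum>b\<in>I. (if b = a then E * (\<alpha> a * \<beta> a * (1 + (sine_slope (c a))\<^sup>2)) else 0)
          - E * (\<alpha> a * sine_slope (c a)) * (\<beta> b * sine_slope (c b)))"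
        by (intro sum.cong refl) (auto simp: r_def algebra_simps power2_eq_square)
      also have "\<dots> = E * (\<alpha> a * \<beta> a * (1 + (sine_slope (c a))\<^sup>2))
          - E * (\<alpha> a * sine_slope (c a)) * (\<Sum>b\<in>I. \<beta> b * sine_slope (c b))"
        using that assms by (simp add: sum_subtractf sum_distrib_left)
      finally show ?thesis by (simp add: algebra_simps)
    qed
    thus ?thesis by (simp add: sum_distrib_left [symmetric] sum_subtractf sum_distrib_right [symmetric])
  qed
  ultimately show ?thesis by (simp add: E_def)
qed

section \<open>Concentration of the conditional mean of the forrelation\<close>

definition sign_transform :: "nat \<Rightarrow> bool list \<Rightarrow> (bool list \<Rightarrow> real) \<Rightarrow> real" where
  "sign_transform n y v = (\<Sum>x\<in>cube n. had n x y * sg (v x))"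

definition sine_poly :: "nat \<Rightarrow> (nat \<Rightarrow> real) \<Rightarrow> (nat \<Rightarrow> real) \<Rightarrow> real \<Rightarrow> real" where
  "sine_poly K c a z = (\<Sum>k<K. c k * sin (a k * z))"

text \<open>The number E\<bar>z\<bar> E[z \<psi>(z)] for \<psi> = \<open>sine_poly K c a\<close>:
  E\<bar>z\<bar> = sqrt (2 / pi) and E[z sin (a z)] = a exp (- a^2 / 2).\<close>

definition sine_poly_gain :: "nat \<Rightarrow> (nat \<Rightarrow> real) \<Rightarrow> (nat \<Rightarrow> real) \<Rightarrow> real" where
  "sine_poly_gain K c a = sqrt (2 / pi) * (\<Sum>k<K. c k * a k * exp (- (a k)\<^sup>2 / 2))"

lemma measurable_coord: "x \<in> I \<Longrightarrow> (\<lambda>v. v x) \<in> borel_measurable (gaussian I)"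
  using measurable_component_singleton[of x I "\<lambda>_. std_normal"] by simp

lemma measurable_sign_transform [measurable]: "sign_transform n y \<in> borel_measurable (gaussian (cube n))"
  unfolding sign_transform_def [abs_def]
  by (intro borel_measurable_sum borel_measurable_times borel_measurable_const
      measurable_compose[OF measurable_coord sg_measurable])

lemma measurable_hadamard_coord [measurable]:
  "y \<in> cube n \<Longrightarrow> (\<lambda>v. hadamard n v y) \<in> borel_measurable (gaussian (cube n))"
  using measurable_compose[OF gaussian_hadamard(1) measurable_coord] .

text \<open>Passes from some value of the integral to the integral itself, so that values depending
  on several indices can be fixed by one definition instead of being chosen.\<close>

lemma has_bochner_integral_witness:
  "has_bochner_integral M h e \<Longrightarrow> P e \<Longrightarrow> has_bochner_integral M h (integral\<^sup>L M h) \<and> P (integral\<^sup>L M h)"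
  by (auto simp: has_bochner_integral_iff)

text \<open>The quadratic error of the slope suffices: 2^n terms, each of size C R^2 / 2^n times the
  entry 1 / sqrt (2^n), sum to C R^2 / sqrt (2^n).\<close>

lemma sum_had_slope_approx:
  assumes C: "C \<ge> 0" "\<And>c. \<bar>c\<bar> \<le> R \<Longrightarrow> \<bar>sine_slope c - sqrt (2 / pi) * c\<bar> \<le> C * c\<^sup>2"
    and R: "R \<ge> 0" and c: "\<And>x. x \<in> cube n \<Longrightarrow> \<bar>c x\<bar> \<le> R / sqrt (2 ^ n)"
  shows "\<bar>(\<Sum>x\<in>cube n. had n x y * sine_slope (c x)) - sqrt (2 / pi) * (\<Sum>x\<in>cube n. had n x y * c x)\<bar>
    \<le> C * R\<^sup>2 / sqrt (2 ^ n)"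
proof -
  have "(\<Sum>x\<in>cube n. had n x y * sine_slope (c x)) - sqrt (2 / pi) * (\<Sum>x\<in>cube n. had n x y * c x) =
      (\<Sum>x\<in>cube n. had n x y * (sine_slope (c x) - sqrt (2 / pi) * c x))"
    by (simp add: sum_distrib_left sum_subtractf algebra_simps)
  also have "\<bar>\<dots>\<bar> \<le> (\<Sum>x\<in>cube n. 1 / sqrt (2 ^ n) * (C * (R / sqrt (2 ^ n))\<^sup>2))"
  proof (intro order_trans[OF sum_abs] sum_mono)
    fix x assume x: "x \<in> cube n"
    have "R / sqrt (2 ^ n) \<le> R" using mult_left_mono[of 1 "sqrt (2 ^ n)" R] R by (simp add: divide_le_eq)
    hence "\<bar>c x\<bar> \<le> R" using c[OF x] by linarith
    hence "\<bar>sine_slope (c x) - sqrt (2 / pi) * c x\<bar> \<le> C * (c x)\<^sup>2" by (rule C(2))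
    also have "(c x)\<^sup>2 \<le> (R / sqrt (2 ^ n))\<^sup>2" using c[OF x] by (metis abs_ge_zero power2_abs power_mono)
    finally have "\<bar>sine_slope (c x) - sqrt (2 / pi) * c x\<bar> \<le> C * (R / sqrt (2 ^ n))\<^sup>2"
      using C(1) by (simp add: mult_left_mono)
    thus "\<bar>had n x y * (sine_slope (c x) - sqrt (2 / pi) * c x)\<bar> \<le> 1 / sqrt (2 ^ n) * (C * (R / sqrt (2 ^ n))\<^sup>2)"
      unfolding abs_mult abs_had by (intro mult_left_mono) auto
  qed
  also have "\<dots> = C * R\<^sup>2 / sqrt (2 ^ n)"
    by (simp add: card_cube power_divide)
  finally show ?thesis .
qed

lemma sign_transform_sin_approx:
  assumes C: "C \<ge> 0" "\<And>c. \<bar>c\<bar> \<le> R \<Longrightarrow> \<bar>sine_slope c - sqrt (2 / pi) * c\<bar> \<le> C * c\<^sup>2"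
    and a: "\<bar>a\<bar> \<le> R" and y: "y \<in> cube n"
  defines "h \<equiv> \<lambda>v. sign_transform n y v * sin (a * hadamard n v y)"
  shows "has_bochner_integral (gaussian (cube n)) h (integral\<^sup>L (gaussian (cube n)) h) \<and>
    \<bar>integral\<^sup>L (gaussian (cube n)) h - sqrt (2 / pi) * a * exp (- a\<^sup>2 / 2)\<bar> \<le> C * R\<^sup>2 / sqrt (2 ^ n)"
proof -
  define c where "c x = a * had n x y" for x
  have R: "R \<ge> 0" using a by linarith
  have c2: "(\<Sum>x\<in>cube n. (c x)\<^sup>2) = a\<^sup>2"
    using had_orthogonal[OF y y] by (simp add: c_def power_mult_distrib power2_eq_square[of "had _ _ _"] flip: sum_distrib_left)
  have cw: "(\<Sum>x\<in>cube n. c x * v x) = a * hadamard n v y" for v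
    using y by (simp add: c_def hadamard_apply sum_distrib_left mult.assoc)
  have hc: "(\<Sum>x\<in>cube n. had n x y * c x) = a"
    using had_orthogonal[OF y y] by (simp add: c_def mult.left_commute flip: sum_distrib_left)
  define X where "X = (\<Sum>x\<in>cube n. had n x y * sine_slope (c x))"
  have "\<bar>c x\<bar> \<le> R / sqrt (2 ^ n)" for x
    using a by (simp add: c_def abs_mult abs_had divide_right_mono)
  hence X: "\<bar>X - sqrt (2 / pi) * a\<bar> \<le> C * R\<^sup>2 / sqrt (2 ^ n)"
    using sum_had_slope_approx[OF C R, of n c y] unfolding hc X_def by simp
  show ?thesis
  proof (rule has_bochner_integral_witness[where P = "\<lambda>e. \<bar>e - sqrt (2 / pi) * a * exp (- a\<^sup>2 / 2)\<bar> \<le> C * R\<^sup>2 / sqrt (2 ^ n)"])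
    show "has_bochner_integral (gaussian (cube n)) h (exp (- a\<^sup>2 / 2) * X)"
      using gaussian_linear_sin[of "cube n" "\<lambda>x. had n x y" c] by (simp add: c2 cw X_def sign_transform_def h_def)
    have "exp (- a\<^sup>2 / 2) * X - sqrt (2 / pi) * a * exp (- a\<^sup>2 / 2) = exp (- a\<^sup>2 / 2) * (X - sqrt (2 / pi) * a)"
      by (simp add: algebra_simps)
    also have "\<bar>\<dots>\<bar> \<le> 1 * \<bar>X - sqrt (2 / pi) * a\<bar>"
      unfolding abs_mult by (intro mult_right_mono) auto
    also have "\<dots> \<le> C * R\<^sup>2 / sqrt (2 ^ n)" using X by simp
    finally show "\<bar>exp (- a\<^sup>2 / 2) * X - sqrt (2 / pi) * a * exp (- a\<^sup>2 / 2)\<bar> \<le> C * R\<^sup>2 / sqrt (2 ^ n)" .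
  qed
qed

text \<open>The coefficients of the linear form are p times column y plus q times column z of
  \<open>had\<close>. By orthogonality their squared norm is p^2 + q^2 and their inner products with
  the two columns are p and q. Orthogonality also removes the constant 1 from the diagonal sum
  \<open>Z\<close>, leaving only small squared slopes.\<close>

lemma sign_transform_cos_approx:
  assumes C: "C \<ge> 0" "\<And>c. \<bar>c\<bar> \<le> R \<Longrightarrow> \<bar>sine_slope c - sqrt (2 / pi) * c\<bar> \<le> C * c\<^sup>2"
      "\<And>c. \<bar>c\<bar> \<le> R \<Longrightarrow> \<bar>sine_slope c\<bar> \<le> C * \<bar>c\<bar>"
    and pq: "\<bar>p\<bar> + \<bar>q\<bar> \<le> R" and y: "y \<in> cube n" and z: "z \<in> cube n" and yz: "y \<noteq> z"
  defines "h \<equiv> \<lambda>v. sign_transform n y v * sign_transform n z v * cos (p * hadamard n v y + q * hadamard n v z)"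
  shows "has_bochner_integral (gaussian (cube n)) h (integral\<^sup>L (gaussian (cube n)) h) \<and>
    \<bar>integral\<^sup>L (gaussian (cube n)) h + 2 / pi * (p * q * exp (- (p\<^sup>2 + q\<^sup>2) / 2))\<bar> \<le> (C\<^sup>2 * R\<^sup>2 + C * R\<^sup>2 * (2 * R + C * R\<^sup>2)) / sqrt (2 ^ n)"
proof -
  define \<kappa> :: real where "\<kappa> = sqrt (2 / pi)"
  have \<kappa>: "0 \<le> \<kappa>" "\<kappa> \<le> 1" using pi_gt3 by (auto simp: \<kappa>_def)
  have \<kappa>2: "\<kappa> * \<kappa> = 2 / pi" using pi_gt_zero by (simp add: \<kappa>_def)
  define r where "r = 1 / sqrt (2 ^ n)"
  have r: "0 \<le> r" "r \<le> 1" by (auto simp: r_def)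
  have rr: "r * r = 1 / 2 ^ n" by (simp add: r_def)
  define c where "c x = p * had n x y + q * had n x z" for x
  have R: "R \<ge> 0" using pq by linarith
  note o = had_orthogonal[OF y y] had_orthogonal[OF z z] had_orthogonal[OF y z] had_orthogonal[OF z y]
  have hy: "(\<Sum>x\<in>cube n. had n x y * c x) = p"
  proof -
    have "(\<Sum>x\<in>cube n. had n x y * c x) =
        p * (\<Sum>x\<in>cube n. had n x y * had n x y) + q * (\<Sum>x\<in>cube n. had n x y * had n x z)"
      by (simp add: c_def sum_distrib_left sum.distrib algebra_simps)
    thus ?thesis using o yz by simp
  qed
  have hz: "(\<Sum>x\<in>cube n. had n x z * c x) = q"
  proof -
    have "(\<Sum>x\<in>cube n. had n x z * c x) =
        p * (\<Sum>x\<in>cube n. had n x z * had n x y) + q * (\<Sum>x\<in>cube n. had n x z * had n x z)"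
      by (simp add: c_def sum_distrib_left sum.distrib algebra_simps)
    thus ?thesis using o yz by simp
  qed
  have c2: "(\<Sum>x\<in>cube n. (c x)\<^sup>2) = p\<^sup>2 + q\<^sup>2"
  proof -
    have "(\<Sum>x\<in>cube n. (c x)\<^sup>2) = p * (\<Sum>x\<in>cube n. had n x y * c x) + q * (\<Sum>x\<in>cube n. had n x z * c x)"
      by (simp add: sum_distrib_left sum.distrib [symmetric] power2_eq_square)
         (simp add: c_def algebra_simps)
    thus ?thesis by (simp add: hy hz power2_eq_square)
  qed
  have cw: "(\<Sum>x\<in>cube n. c x * v x) = p * hadamard n v y + q * hadamard n v z" for v
    using y z by (simp add: c_def hadamard_apply sum_distrib_left sum.distrib algebra_simps)
  have cR: "\<bar>c x\<bar> \<le> R * r" for x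
  proof -
    have "\<bar>c x\<bar> \<le> \<bar>p * had n x y\<bar> + \<bar>q * had n x z\<bar>" unfolding c_def by (rule abs_triangle_ineq)
    also have "\<dots> = (\<bar>p\<bar> + \<bar>q\<bar>) * r" by (simp add: abs_mult abs_had r_def add_divide_distrib)
    also have "\<dots> \<le> R * r" using pq r by (intro mult_right_mono) auto
    finally show ?thesis .
  qed
  hence cR': "\<bar>c x\<bar> \<le> R / sqrt (2 ^ n)" for x by (simp add: r_def)
  define X where "X = (\<Sum>x\<in>cube n. had n x y * sine_slope (c x))"
  define Y where "Y = (\<Sum>x\<in>cube n. had n x z * sine_slope (c x))"
  define Z where "Z = (\<Sum>x\<in>cube n. had n x y * had n x z * (1 + (sine_slope (c x))\<^sup>2))"
  define \<delta> where "\<delta> = C * R\<^sup>2"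
  have \<delta>: "\<delta> \<ge> 0" using C(1) by (simp add: \<delta>_def)
  have X: "\<bar>X - \<kappa> * p\<bar> \<le> \<delta> * r"
    using sum_had_slope_approx[OF C(1,2) R, of n c y] cR' unfolding hy X_def \<kappa>_def r_def \<delta>_def by simp
  have Y: "\<bar>Y - \<kappa> * q\<bar> \<le> \<delta> * r"
    using sum_had_slope_approx[OF C(1,2) R, of n c z] cR' unfolding hz Y_def \<kappa>_def r_def \<delta>_def by simp
  have Z: "\<bar>Z\<bar> \<le> C\<^sup>2 * R\<^sup>2 * r"
  proof -
    have "Z = (\<Sum>x\<in>cube n. had n x y * had n x z * (sine_slope (c x))\<^sup>2)"
      using o yz by (simp add: Z_def distrib_left sum.distrib)
    also have "\<bar>\<dots>\<bar> \<le> (\<Sum>x\<in>cube n. r * r * (C\<^sup>2 * R\<^sup>2 * r))"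
    proof (intro order_trans[OF sum_abs] sum_mono)
      fix x
      have "R * r \<le> R * 1" using R r by (intro mult_left_mono) auto
      hence "\<bar>c x\<bar> \<le> R" using cR[of x] by simp
      hence "\<bar>sine_slope (c x)\<bar> \<le> C * \<bar>c x\<bar>" by (rule C(3))
      also have "\<dots> \<le> C * (R * r)" by (rule mult_left_mono[OF cR C(1)])
      finally have "(sine_slope (c x))\<^sup>2 \<le> (C * (R * r))\<^sup>2" by (metis abs_ge_zero power2_abs power_mono)
      also have "\<dots> = C\<^sup>2 * R\<^sup>2 * (r * r)" by (simp add: power2_eq_square)
      also have "\<dots> \<le> C\<^sup>2 * R\<^sup>2 * (r * 1)" using r by (intro mult_left_mono) auto
      finally show "\<bar>had n x y * had n x z * (sine_slope (c x))\<^sup>2\<bar> \<le> r * r * (C\<^sup>2 * R\<^sup>2 * r)"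
        unfolding abs_mult abs_had using r by (intro mult_mono) (auto simp: r_def)
    qed
    also have "\<dots> = C\<^sup>2 * R\<^sup>2 * r" by (simp add: card_cube rr)
    finally show ?thesis .
  qed
  define E where "E = exp (- (p\<^sup>2 + q\<^sup>2) / 2)"
  have E: "0 \<le> E" "E \<le> 1" by (auto simp: E_def)
  have "has_bochner_integral (gaussian (cube n)) h (E * (Z - X * Y))"
    using gaussian_quadratic_cos[of "cube n" "\<lambda>x. had n x y" "\<lambda>x. had n x z" c]
    by (simp add: c2 cw X_def Y_def Z_def E_def sign_transform_def h_def)
  moreover have "\<bar>E * (Z - X * Y) + 2 / pi * (p * q * E)\<bar> \<le> (C\<^sup>2 * R\<^sup>2 + C * R\<^sup>2 * (2 * R + C * R\<^sup>2)) * r"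
  proof -
    have pq': "\<bar>p\<bar> \<le> R" "\<bar>q\<bar> \<le> R" using pq by auto
    have "E * (Z - X * Y) + 2 / pi * (p * q * E) = E * (Z - ((X - \<kappa> * p) * Y + \<kappa> * p * (Y - \<kappa> * q)))"
      by (simp add: \<kappa>2 [symmetric] algebra_simps)
    also have "\<bar>\<dots>\<bar> \<le> 1 * \<bar>Z - ((X - \<kappa> * p) * Y + \<kappa> * p * (Y - \<kappa> * q))\<bar>"
      unfolding abs_mult using E by (intro mult_right_mono) auto
    also have "\<dots> \<le> \<bar>Z\<bar> + (\<bar>X - \<kappa> * p\<bar> * \<bar>Y\<bar> + \<bar>\<kappa> * p\<bar> * \<bar>Y - \<kappa> * q\<bar>)"
    proof -
      have "\<bar>s - (t + u)\<bar> \<le> \<bar>s\<bar> + (\<bar>t\<bar> + \<bar>u\<bar>)" for s t u :: real by linarith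
      thus ?thesis unfolding abs_mult [symmetric] mult_1 .
    qed
    also have "\<dots> \<le> C\<^sup>2 * R\<^sup>2 * r + (\<delta> * r * (R + \<delta>) + R * (\<delta> * r))"
    proof (intro add_mono mult_mono Z X Y)
      have "\<bar>\<kappa> * q\<bar> \<le> 1 * R" unfolding abs_mult using \<kappa> pq' by (intro mult_mono) auto
      moreover have "\<delta> * r \<le> \<delta> * 1" using \<delta> r by (intro mult_left_mono) auto
      ultimately show "\<bar>Y\<bar> \<le> R + \<delta>" using Y by linarith
      have "\<bar>\<kappa> * p\<bar> \<le> 1 * R" unfolding abs_mult using \<kappa> pq' by (intro mult_mono) auto
      thus "\<bar>\<kappa> * p\<bar> \<le> R" by simp
    qed (use \<delta> r R in auto)
    also have "\<dots> = (C\<^sup>2 * R\<^sup>2 + C * R\<^sup>2 * (2 * R + C * R\<^sup>2)) * r"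
      by (simp add: \<delta>_def algebra_simps)
    finally show ?thesis .
  qed
  ultimately show ?thesis
    using has_bochner_integral_witness[where P = "\<lambda>e. \<bar>e + 2 / pi * (p * q * E)\<bar> \<le> (C\<^sup>2 * R\<^sup>2 + C * R\<^sup>2 * (2 * R + C * R\<^sup>2)) * r"]
    by (simp add: E_def r_def)
qed

text \<open>The conditional mean of the forrelation given \<open>v\<close>, with f the signs of
  \<open>v\<close> and g averaged out.\<close>

definition mean_corr :: "(real \<Rightarrow> real) \<Rightarrow> nat \<Rightarrow> (bool list \<Rightarrow> real) \<Rightarrow> real" where
  "mean_corr \<psi> n v = (\<Sum>y\<in>cube n. sign_transform n y v * \<psi> (hadamard n v y)) / 2 ^ n"

lemma sign_transform_square:
  assumes y: "y \<in> cube n"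
  shows "has_bochner_integral (gaussian (cube n)) (\<lambda>v. (sign_transform n y v)\<^sup>2) 1"
proof -
  have "sine_slope 0 = 0" by (simp add: sine_slope_def sine_mean_def)
  thus ?thesis
    using gaussian_quadratic_cos[of "cube n" "\<lambda>x. had n x y" "\<lambda>x. had n x y" "\<lambda>_. 0"] had_orthogonal[OF y y]
    by (simp add: sign_transform_def power2_eq_square)
qed

text \<open>A second moment computation: \<open>mean_corr\<close> averages 2^n variables of mean
  nearly \<open>m\<close>, and distinct pairs have product mean at most m^2 up to O(1 / sqrt (2^n)).
  A diagonal term is at most E (sign_transform)^2 = 1, and there are only 2^n of them.\<close>

lemma mean_corr_concentrated:
  fixes c a :: "nat \<Rightarrow> real" and K :: nat
  defines "\<psi> \<equiv> sine_poly K c a" and "m \<equiv> sine_poly_gain K c a"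
  assumes bound: "\<And>z. \<bar>\<psi> z\<bar> \<le> 1"
  obtains C where "\<And>n. integrable (gaussian (cube n)) (\<lambda>v. (mean_corr \<psi> n v - m)\<^sup>2)"
    "\<And>n. (\<integral>v. (mean_corr \<psi> n v - m)\<^sup>2 \<partial>gaussian (cube n)) \<le> C / sqrt (2 ^ n)"
proof -
  define A where "A = (\<Sum>k<K. \<bar>a k\<bar>)"
  \<comment> \<open>Pair products involve two frequencies at once, whose absolute values add up to
    at most 2 A.\<close>
  define R where "R = 2 * A"
  have A: "\<bar>a k\<bar> \<le> A" if "k < K" for k
    unfolding A_def using that by (intro member_le_sum) auto
  have A0: "A \<ge> 0" by (simp add: A_def sum_nonneg)
  have R: "R \<ge> 0" using A0 by (simp add: R_def)
  obtain C where C: "C \<ge> 0" "\<And>c. \<bar>c\<bar> \<le> R \<Longrightarrow> \<bar>sine_slope c - sqrt (2 / pi) * c\<bar> \<le> C * c\<^sup>2"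
    "\<And>c. \<bar>c\<bar> \<le> R \<Longrightarrow> \<bar>sine_slope c\<bar> \<le> C * \<bar>c\<bar>"
    using sine_slope_approx[OF R] by blast
  define B1 where "B1 = C * R\<^sup>2"
  define B2 where "B2 = C\<^sup>2 * R\<^sup>2 + C * R\<^sup>2 * (2 * R + C * R\<^sup>2)"
  define S where "S = (\<Sum>k<K. \<bar>c k\<bar>)"
  \<comment> \<open>Contributions of the diagonal, of the off-diagonal pairs, and of the cross term
    - 2 m E[mean_corr].\<close>
  define B where "B = 1 + S * S * B2 + 2 * \<bar>m\<bar> * (S * B1)"
  have S0: "S \<ge> 0" by (simp add: S_def sum_nonneg)
  have B20: "B2 \<ge> 0" using C(1) R by (simp add: B2_def)
  have psi_meas: "\<psi> \<in> borel_measurable borel" unfolding \<psi>_def sine_poly_def [abs_def] by simp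
  have main: "\<exists>I. has_bochner_integral (gaussian (cube n)) (\<lambda>v. (mean_corr \<psi> n v - m)\<^sup>2) I \<and> I \<le> B / sqrt (2 ^ n)" for n
  proof -
    define r where "r = 1 / sqrt (2 ^ n)"
    have r: "0 \<le> r" "r \<le> 1" by (auto simp: r_def)
    define u where "u y v = sign_transform n y v * \<psi> (hadamard n v y)" for y v
    have first: "\<exists>e. has_bochner_integral (gaussian (cube n)) (u y) e \<and> \<bar>e - m\<bar> \<le> S * B1 * r" if y: "y \<in> cube n" for y
    proof -
      define e where "e k = (\<integral>v. sign_transform n y v * sin (a k * hadamard n v y) \<partial>gaussian (cube n))" for k
      have e: "has_bochner_integral (gaussian (cube n)) (\<lambda>v. sign_transform n y v * sin (a k * hadamard n v y)) (e k) \<and>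
          \<bar>e k - sqrt (2 / pi) * a k * exp (- (a k)\<^sup>2 / 2)\<bar> \<le> B1 * r" if "k < K" for k
      proof -
        have "\<bar>a k\<bar> \<le> R" using A[OF that] A0 by (simp add: R_def)
        hence "\<bar>e k - sqrt (2 / pi) * a k * exp (- (a k)\<^sup>2 / 2)\<bar> \<le> C * R\<^sup>2 / sqrt (2 ^ n)"
          "has_bochner_integral (gaussian (cube n)) (\<lambda>v. sign_transform n y v * sin (a k * hadamard n v y)) (e k)"
          using sign_transform_sin_approx[of C R "a k" y n] C y unfolding e_def by blast+
        thus ?thesis by (simp add: B1_def r_def)
      qed
      have "has_bochner_integral (gaussian (cube n)) (\<lambda>v. \<Sum>k<K. c k * (sign_transform n y v * sin (a k * hadamard n v y))) (\<Sum>k<K. c k * e k)"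
        by (intro has_bochner_integral_sum has_bochner_integral_mult_right) (use e in auto)
      moreover have "(\<Sum>k<K. c k * (sign_transform n y v * sin (a k * hadamard n v y))) = u y v" for v
        by (simp add: u_def \<psi>_def sine_poly_def sum_distrib_left mult_ac)
      moreover have "\<bar>(\<Sum>k<K. c k * e k) - m\<bar> \<le> S * B1 * r"
      proof -
        have "(\<Sum>k<K. c k * e k) - m = (\<Sum>k<K. c k * (e k - sqrt (2 / pi) * a k * exp (- (a k)\<^sup>2 / 2)))"
          by (simp add: m_def sine_poly_gain_def sum_distrib_left sum_subtractf algebra_simps)
        also have "\<bar>\<dots>\<bar> \<le> (\<Sum>k<K. \<bar>c k\<bar> * (B1 * r))"
          by (intro order_trans[OF sum_abs] sum_mono) (use e in \<open>auto simp: abs_mult intro!: mult_left_mono\<close>)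
        finally show ?thesis by (simp add: S_def sum_distrib_right mult.assoc)
      qed
      ultimately show ?thesis by auto
    qed
    have off: "\<exists>e. has_bochner_integral (gaussian (cube n)) (\<lambda>v. u y v * u z v) e \<and> e \<le> m\<^sup>2 + S * S * B2 * r"
      if y: "y \<in> cube n" and z: "z \<in> cube n" and yz: "y \<noteq> z" for y z
    proof -
      define e where "e k l s = (\<integral>v. sign_transform n y v * sign_transform n z v *
          cos (a k * hadamard n v y + s * a l * hadamard n v z) \<partial>gaussian (cube n))" for k l s
      have e: "has_bochner_integral (gaussian (cube n)) (\<lambda>v. sign_transform n y v * sign_transform n z v *
            cos (a k * hadamard n v y + s * a l * hadamard n v z)) (e k l s) \<and>
          \<bar>e k l s + 2 / pi * (a k * (s * a l) * exp (- ((a k)\<^sup>2 + (s * a l)\<^sup>2) / 2))\<bar> \<le> B2 * r"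
        if "k < K" "l < K" "s = 1 \<or> s = - 1" for k l s
      proof -
        have "\<bar>a k\<bar> + \<bar>s * a l\<bar> \<le> R" using A[OF that(1)] A[OF that(2)] that(3) by (auto simp: R_def)
        hence "\<bar>e k l s + 2 / pi * (a k * (s * a l) * exp (- ((a k)\<^sup>2 + (s * a l)\<^sup>2) / 2))\<bar> \<le>
             (C\<^sup>2 * R\<^sup>2 + C * R\<^sup>2 * (2 * R + C * R\<^sup>2)) / sqrt (2 ^ n)"
          "has_bochner_integral (gaussian (cube n)) (\<lambda>v. sign_transform n y v * sign_transform n z v *
            cos (a k * hadamard n v y + s * a l * hadamard n v z)) (e k l s)"
          using sign_transform_cos_approx[of C R "a k" "s * a l" y n z] C y z yz unfolding e_def by blast+
        thus ?thesis unfolding B2_def r_def by (simp only: times_divide_eq_right mult_1_right)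
      qed
      \<comment> \<open>From sin s sin t = (cos (s - t) - cos (s + t)) / 2; the third argument of
        \<open>e\<close> is the sign inside the cosine.\<close>
      define d where "d k l = (e k l (- 1) - e k l 1) / 2" for k l
      have "has_bochner_integral (gaussian (cube n)) (\<lambda>v. \<Sum>k<K. \<Sum>l<K. c k * c l *
          ((sign_transform n y v * sign_transform n z v * cos (a k * hadamard n v y + (- 1) * a l * hadamard n v z) -
            sign_transform n y v * sign_transform n z v * cos (a k * hadamard n v y + 1 * a l * hadamard n v z)) / 2))
          (\<Sum>k<K. \<Sum>l<K. c k * c l * d k l)"
        unfolding d_def
        by (intro has_bochner_integral_sum has_bochner_integral_mult_right has_bochner_integral_divide
            has_bochner_integral_diff e[THEN conjunct1]) auto
      moreover have "(\<Sum>k<K. \<Sum>l<K. c k * c l *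
          ((sign_transform n y v * sign_transform n z v * cos (a k * hadamard n v y + (- 1) * a l * hadamard n v z) -
            sign_transform n y v * sign_transform n z v * cos (a k * hadamard n v y + 1 * a l * hadamard n v z)) / 2)) = u y v * u z v" for v
      proof -
        have "(\<Sum>k<K. \<Sum>l<K. c k * c l *
          ((sign_transform n y v * sign_transform n z v * cos (a k * hadamard n v y + (- 1) * a l * hadamard n v z) -
            sign_transform n y v * sign_transform n z v * cos (a k * hadamard n v y + 1 * a l * hadamard n v z)) / 2)) =
          (\<Sum>k<K. \<Sum>l<K. sign_transform n y v * (c k * sin (a k * hadamard n v y)) * (sign_transform n z v * (c l * sin (a l * hadamard n v z))))"
          by (intro sum.cong refl) (simp add: cos_add cos_diff field_simps)
        also have "\<dots> = (\<Sum>k<K. sign_transform n y v * (c k * sin (a k * hadamard n v y))) *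
            (\<Sum>l<K. sign_transform n z v * (c l * sin (a l * hadamard n v z)))"
          by (rule sum_product [symmetric])
        also have "\<dots> = u y v * u z v"
          by (simp only: u_def \<psi>_def sine_poly_def sum_distrib_left)
        finally show ?thesis .
      qed
      moreover have "(\<Sum>k<K. \<Sum>l<K. c k * c l * d k l) \<le> m\<^sup>2 + S * S * B2 * r"
      proof -
        define h where "h k l = 2 / pi * (a k * a l * exp (- ((a k)\<^sup>2 + (a l)\<^sup>2) / 2))" for k l
        have d: "\<bar>d k l - h k l\<bar> \<le> B2 * r" if "k < K" "l < K" for k l
        proof -
          have "\<bar>e k l 1 + h k l\<bar> \<le> B2 * r" "\<bar>e k l (- 1) - h k l\<bar> \<le> B2 * r"
            using e[OF that, of 1, THEN conjunct2] e[OF that, of "- 1", THEN conjunct2] by (simp_all add: h_def)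
          moreover have "\<bar>p + t\<bar> \<le> b \<Longrightarrow> \<bar>q - t\<bar> \<le> b \<Longrightarrow> \<bar>(q - p) / 2 - t\<bar> \<le> b" for p q t b :: real
            by (auto simp: abs_le_iff field_simps)
          ultimately show ?thesis unfolding d_def by blast
        qed
        have m2: "m\<^sup>2 = (\<Sum>k<K. \<Sum>l<K. c k * c l * h k l)"
        proof -
          have "exp (- ((a k)\<^sup>2 + (a l)\<^sup>2) / 2) = exp (- (a k)\<^sup>2 / 2) * exp (- (a l)\<^sup>2 / 2)" for k l
            by (simp add: exp_add [symmetric] add_divide_distrib diff_divide_distrib)
          hence ccs: "sqrt (2 / pi) * (c k * a k * exp (- (a k)\<^sup>2 / 2)) * (sqrt (2 / pi) * (c l * a l * exp (- (a l)\<^sup>2 / 2))) =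
              (sqrt (2 / pi) * sqrt (2 / pi)) * (c k * c l * (a k * a l * exp (- ((a k)\<^sup>2 + (a l)\<^sup>2) / 2)))" for k l
            by (simp only: mult_ac)
          define G where "G k = sqrt (2 / pi) * (c k * a k * exp (- (a k)\<^sup>2 / 2))" for k
          have "m = (\<Sum>k<K. G k)" by (simp only: m_def sine_poly_gain_def sum_distrib_left G_def)
          hence "m\<^sup>2 = (\<Sum>k<K. \<Sum>l<K. G k * G l)" by (simp only: power2_eq_square sum_product)
          also have "\<dots> = (\<Sum>k<K. \<Sum>l<K. (sqrt (2 / pi) * sqrt (2 / pi)) *
              (c k * c l * (a k * a l * exp (- ((a k)\<^sup>2 + (a l)\<^sup>2) / 2))))"
            unfolding G_def ccs ..
          also have "sqrt (2 / pi) * sqrt (2 / pi) = 2 / pi" using pi_gt_zero by simp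
          finally show ?thesis by (simp only: h_def mult_ac)
        qed
        have "(\<Sum>k<K. \<Sum>l<K. c k * c l * d k l) - m\<^sup>2 = (\<Sum>k<K. \<Sum>l<K. c k * c l * (d k l - h k l))"
          unfolding m2 by (simp add: sum_subtractf right_diff_distrib)
        also have "\<dots> \<le> (\<Sum>k<K. \<Sum>l<K. \<bar>c k\<bar> * \<bar>c l\<bar> * (B2 * r))"
        proof (intro sum_mono)
          fix k l assume kl: "k \<in> {..<K}" "l \<in> {..<K}"
          have "c k * c l * (d k l - h k l) \<le> \<bar>c k * c l * (d k l - h k l)\<bar>" by simp
          also have "\<dots> \<le> \<bar>c k\<bar> * \<bar>c l\<bar> * (B2 * r)"
            unfolding abs_mult using d kl by (intro mult_left_mono) auto
          finally show "c k * c l * (d k l - h k l) \<le> \<bar>c k\<bar> * \<bar>c l\<bar> * (B2 * r)" .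
        qed
        also have "\<dots> = S * S * (B2 * r)" by (simp only: S_def sum_product sum_distrib_right [symmetric])
        finally show ?thesis by simp
      qed
      ultimately show ?thesis by auto
    qed
    have diag: "\<exists>e. has_bochner_integral (gaussian (cube n)) (\<lambda>v. u y v * u y v) e \<and> e \<le> 1" if y: "y \<in> cube n" for y
    proof -
      have le: "u y v * u y v \<le> (sign_transform n y v)\<^sup>2" for v
      proof -
        have "(\<psi> (hadamard n v y))\<^sup>2 \<le> 1" using bound[of "hadamard n v y"] by (simp add: abs_square_le_1)
        from mult_left_mono[OF this, of "(sign_transform n y v)\<^sup>2"] show ?thesis
          by (simp add: u_def power2_eq_square mult_ac)
      qed
      have sq: "integrable (gaussian (cube n)) (\<lambda>v. (sign_transform n y v)\<^sup>2)" "(\<integral>v. (sign_transform n y v)\<^sup>2 \<partial>gaussian (cube n)) = 1"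
        using sign_transform_square[OF y] by (auto simp: has_bochner_integral_iff)
      have [measurable]: "u y \<in> borel_measurable (gaussian (cube n))"
        unfolding u_def [abs_def]
        by (intro borel_measurable_times measurable_sign_transform measurable_compose[OF measurable_hadamard_coord[OF y] psi_meas])
      have int: "integrable (gaussian (cube n)) (\<lambda>v. u y v * u y v)"
        by (rule Bochner_Integration.integrable_bound[OF sq(1)]) (use le in auto)
      have "(\<integral>v. u y v * u y v \<partial>gaussian (cube n)) \<le> 1"
        using integral_mono[OF int sq(1) le] sq(2) by simp
      thus ?thesis using int by (auto simp: has_bochner_integral_iff)
    qed
    define w where "w y z = (if y = z then 1 else m\<^sup>2 + S * S * B2 * r)" for y z :: "bool list"
    define e2 where "e2 y z = (\<integral>v. u y v * u z v \<partial>gaussian (cube n))" for y z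
    have e2: "has_bochner_integral (gaussian (cube n)) (\<lambda>v. u y v * u z v) (e2 y z) \<and> e2 y z \<le> w y z"
      if "y \<in> cube n" "z \<in> cube n" for y z
    proof -
      have "\<exists>e. has_bochner_integral (gaussian (cube n)) (\<lambda>v. u y v * u z v) e \<and> e \<le> w y z"
      proof (cases "y = z")
        case True
        thus ?thesis using diag[OF that(1)] by (simp add: w_def)
      next
        case False
        thus ?thesis using off[OF that] by (simp add: w_def)
      qed
      then obtain e where e: "has_bochner_integral (gaussian (cube n)) (\<lambda>v. u y v * u z v) e" "e \<le> w y z" by blast
      show ?thesis
        unfolding e2_def by (rule has_bochner_integral_witness[OF e(1), where P = "\<lambda>e. e \<le> w y z", OF e(2)])
    qed
    define e1 where "e1 y = integral\<^sup>L (gaussian (cube n)) (u y)" for y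
    have e1: "has_bochner_integral (gaussian (cube n)) (u y) (e1 y) \<and> \<bar>e1 y - m\<bar> \<le> S * B1 * r" if y: "y \<in> cube n" for y
    proof -
      obtain e where e: "has_bochner_integral (gaussian (cube n)) (u y) e" "\<bar>e - m\<bar> \<le> S * B1 * r"
        using first[OF y] by blast
      show ?thesis
        unfolding e1_def by (rule has_bochner_integral_witness[OF e(1), where P = "\<lambda>e. \<bar>e - m\<bar> \<le> S * B1 * r", OF e(2)])
    qed
    interpret prob_space "gaussian (cube n)" by (rule prob_space_gaussian)
    define I where "I = (\<Sum>y\<in>cube n. \<Sum>z\<in>cube n. e2 y z) / (2 ^ n * 2 ^ n) - 2 * m / 2 ^ n * (\<Sum>y\<in>cube n. e1 y) + m\<^sup>2"
    have "has_bochner_integral (gaussian (cube n)) (\<lambda>v. m\<^sup>2) (m\<^sup>2)"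
      by (simp add: has_bochner_integral_iff prob_space)
    hence "has_bochner_integral (gaussian (cube n)) (\<lambda>v. (\<Sum>y\<in>cube n. \<Sum>z\<in>cube n. u y v * u z v) / (2 ^ n * 2 ^ n)
        - 2 * m / 2 ^ n * (\<Sum>y\<in>cube n. u y v) + m\<^sup>2) I"
      unfolding I_def
      by (intro has_bochner_integral_add has_bochner_integral_diff has_bochner_integral_mult_right
          has_bochner_integral_divide has_bochner_integral_sum) (use e1 e2 in auto)
    moreover have "(\<Sum>y\<in>cube n. \<Sum>z\<in>cube n. u y v * u z v) / (2 ^ n * 2 ^ n)
        - 2 * m / 2 ^ n * (\<Sum>y\<in>cube n. u y v) + m\<^sup>2 = (mean_corr \<psi> n v - m)\<^sup>2" for v
      by (simp add: mean_corr_def u_def [symmetric] sum_product [symmetric] power2_eq_square field_simps)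
    ultimately have "has_bochner_integral (gaussian (cube n)) (\<lambda>v. (mean_corr \<psi> n v - m)\<^sup>2) I" by simp
    moreover have "I \<le> B / sqrt (2 ^ n)"
    proof -
      have "(\<Sum>y\<in>cube n. \<Sum>z\<in>cube n. e2 y z) \<le> (\<Sum>y\<in>cube n. \<Sum>z\<in>cube n. w y z)"
        by (intro sum_mono) (use e2 in auto)
      also have "\<dots> \<le> (\<Sum>y\<in>cube n. \<Sum>z\<in>cube n. (if z = y then 1 else 0) + (m\<^sup>2 + S * S * B2 * r))"
        using S0 B20 r by (intro sum_mono) (auto simp: w_def)
      also have "\<dots> = 2 ^ n + 2 ^ n * 2 ^ n * (m\<^sup>2 + S * S * B2 * r)"
        by (simp add: sum.distrib card_cube distrib_left)
      finally have "(\<Sum>y\<in>cube n. \<Sum>z\<in>cube n. e2 y z) / (2 ^ n * 2 ^ n) \<le>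
          (2 ^ n + 2 ^ n * 2 ^ n * (m\<^sup>2 + S * S * B2 * r)) / (2 ^ n * 2 ^ n)"
        by (intro divide_right_mono) auto
      also have "\<dots> = r * r + (m\<^sup>2 + S * S * B2 * r)" by (simp add: r_def field_simps)
      also have "r * r \<le> 1 * r" using r by (intro mult_right_mono) auto
      finally have 1: "(\<Sum>y\<in>cube n. \<Sum>z\<in>cube n. e2 y z) / (2 ^ n * 2 ^ n) \<le> r + (m\<^sup>2 + S * S * B2 * r)" by simp
      have "\<bar>2 * m / 2 ^ n * (\<Sum>y\<in>cube n. e1 y - m)\<bar> \<le> 2 * \<bar>m\<bar> / 2 ^ n * (\<Sum>y\<in>cube n. S * B1 * r)"
        unfolding abs_mult using e1
        by (intro mult_mono order_trans[OF sum_abs] sum_mono sum_nonneg) auto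
      also have "\<dots> = 2 * \<bar>m\<bar> * (S * B1) * r" by (simp add: card_cube)
      finally have "- (2 * m / 2 ^ n * (\<Sum>y\<in>cube n. e1 y - m)) \<le> 2 * \<bar>m\<bar> * (S * B1) * r" by linarith
      moreover have "2 * m / 2 ^ n * (\<Sum>y\<in>cube n. e1 y - m) = 2 * m / 2 ^ n * (\<Sum>y\<in>cube n. e1 y) - 2 * m\<^sup>2"
        by (simp add: sum_subtractf card_cube field_simps power2_eq_square)
      ultimately have "I \<le> r + S * S * B2 * r + 2 * \<bar>m\<bar> * (S * B1) * r" using 1 unfolding I_def by linarith
      also have "\<dots> = B * r" by (simp add: B_def algebra_simps)
      finally show ?thesis by (simp add: r_def)
    qed
    ultimately show ?thesis by blast
  qed
  show ?thesis
    by (rule that[of B]) (use main in \<open>auto simp: has_bochner_integral_iff\<close>)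
qed

section \<open>Second moments of the forrelation under independent signs\<close>

lemma forrelation_eq_corr:
  "forrelation n f g = corr n (cube n) (cube n) f g / 2 ^ n"
proof -
  have "(2 :: real) powr (3 * real n / 2) = 2 powr (real n) * 2 powr (real n / 2)"
    by (simp flip: powr_add)
  also have "(2 :: real) powr (real n / 2) = sqrt (2 ^ n)"
    by (simp add: powr_half_sqrt [symmetric] powr_powr flip: powr_realpow)
  finally have "(2 :: real) powr (3 * real n / 2) = 2 ^ n * sqrt (2 ^ n)"
    by (simp add: powr_realpow)
  moreover have "(\<Sum>x\<in>cube n. \<Sum>y\<in>cube n. f x * (-1) ^ dot n x y * g y) =
      sqrt (2 ^ n) * corr n (cube n) (cube n) f g"
    unfolding corr_def transform_on_def sum_distrib_left
    by (subst sum.swap) (intro sum.cong refl, simp add: had_def mult_ac)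
  ultimately show ?thesis by (simp add: forrelation_def)
qed

lemma corr_zero_g: "corr n A B f (\<lambda>_. 0) = 0"
  by (simp add: corr_def)

lemma sum_sign_funs_prod:
  fixes p :: "bool list \<Rightarrow> real \<Rightarrow> real"
  shows "(\<Sum>g\<in>sign_funs n. \<Prod>y\<in>cube n. p y (g y)) = (\<Prod>y\<in>cube n. p y 1 + p y (- 1))"
proof -
  have "(\<Prod>y\<in>cube n. sum (p y) {- 1, 1}) = (\<Sum>g\<in>sign_funs n. \<Prod>y\<in>cube n. p y (g y))"
    unfolding sign_funs_def by (rule prod_sum_PiE) auto
  thus ?thesis by (simp add: add.commute)
qed

text \<open>For q between -1 and 1, \<open>W\<close> is the density, relative to uniform signs, of
  independent signs with means \<open>q y\<close>. Each factor g a is absorbed into the product at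
  its own coordinate.\<close>

lemma sum_sign_funs_moments:
  fixes q :: "bool list \<Rightarrow> real" and n :: nat
  defines "W \<equiv> \<lambda>g. \<Prod>y\<in>cube n. 1 + g y * q y" and "M \<equiv> real (card (sign_funs n))"
  shows "(\<Sum>g\<in>sign_funs n. W g) = M"
    and "a \<in> cube n \<Longrightarrow> (\<Sum>g\<in>sign_funs n. g a * W g) = M * q a"
    and "a \<in> cube n \<Longrightarrow> b \<in> cube n \<Longrightarrow> (\<Sum>g\<in>sign_funs n. g a * g b * W g) = M * (if a = b then 1 else q a * q b)"
proof -
  have M: "M = 2 ^ card (cube n)" by (simp add: M_def card_sign_funs card_cube)
  show W: "(\<Sum>g\<in>sign_funs n. W g) = M"
    unfolding W_def by (subst sum_sign_funs_prod[of "\<lambda>y s. 1 + s * q y" n]) (simp add: M)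
  show "(\<Sum>g\<in>sign_funs n. g a * W g) = M * q a" if a: "a \<in> cube n"
  proof -
    have "g a * W g = (\<Prod>y\<in>cube n. (if y = a then g y else 1) * (1 + g y * q y))" for g
      using a by (simp add: W_def prod.distrib)
    hence "(\<Sum>g\<in>sign_funs n. g a * W g) =
        (\<Prod>y\<in>cube n. (if y = a then 1 else 1) * (1 + 1 * q y) + (if y = a then - 1 else 1) * (1 + - 1 * q y))"
      by (simp only: sum_sign_funs_prod[of "\<lambda>y s. (if y = a then s else 1) * (1 + s * q y)" n])
    also have "\<dots> = (\<Prod>y\<in>cube n. 2 * (if y = a then q y else 1))"
      by (intro prod.cong) auto
    also have "\<dots> = M * q a" using a by (simp only: prod.distrib) (simp add: M)
    finally show ?thesis .
  qed
  show "(\<Sum>g\<in>sign_funs n. g a * g b * W g) = M * (if a = b then 1 else q a * q b)"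
    if a: "a \<in> cube n" and b: "b \<in> cube n"
  proof (cases "a = b")
    case True
    have "g a * g b * W g = W g" if "g \<in> sign_funs n" for g
      using sign_funs_cases[OF that b] True by auto
    hence "(\<Sum>g\<in>sign_funs n. g a * g b * W g) = (\<Sum>g\<in>sign_funs n. W g)"
      by (intro sum.cong) auto
    thus ?thesis using W True by simp
  next
    case False
    have "g a * g b * W g = (\<Prod>y\<in>cube n. (if y = a then g y else 1) * (if y = b then g y else 1) * (1 + g y * q y))" for g
      using a b by (simp add: W_def prod.distrib)
    hence "(\<Sum>g\<in>sign_funs n. g a * g b * W g) =
        (\<Prod>y\<in>cube n. (if y = a then 1 else 1) * (if y = b then 1 else 1) * (1 + 1 * q y) +
          (if y = a then - 1 else 1) * (if y = b then - 1 else 1) * (1 + - 1 * q y))"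
      by (simp only: sum_sign_funs_prod[of "\<lambda>y s. (if y = a then s else 1) * (if y = b then s else 1) * (1 + s * q y)" n])
    also have "\<dots> = (\<Prod>y\<in>cube n. 2 * ((if y = a then q y else 1) * (if y = b then q y else 1)))"
      using False by (intro prod.cong) auto
    also have "\<dots> = M * (q a * q b)" using a b by (simp only: prod.distrib) (simp add: M)
    finally show ?thesis using False by simp
  qed
qed

lemma sum_transform_sq:
  assumes "f \<in> sign_funs n"
  shows "(\<Sum>y\<in>cube n. (transform_on n (cube n) f y)\<^sup>2) = 2 ^ n"
proof -
  have "(\<Sum>y\<in>cube n. (transform_on n (cube n) f y)\<^sup>2) = (\<Sum>y\<in>cube n. (hadamard n f y)\<^sup>2)"
    by (intro sum.cong) (auto simp: hadamard_apply transform_on_def mult.commute)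
  also have "\<dots> = (\<Sum>x\<in>cube n. 1)"
    unfolding sum_hadamard_sq using sign_funs_cases[OF assms] by (intro sum.cong) (auto simp: power2_eq_1_iff)
  finally show ?thesis by (simp add: card_cube)
qed

text \<open>For fixed \<open>f\<close> the forrelation is linear in the signs g y. Its variance is
  at most the sum of squared coefficients, which is 1 / 2^n by Parseval.\<close>

lemma sum_forrelation_square:
  assumes f: "f \<in> sign_funs n" and q: "\<And>y. y \<in> cube n \<Longrightarrow> \<bar>q y\<bar> \<le> 1"
  shows "(\<Sum>g\<in>sign_funs n. (\<Prod>y\<in>cube n. 1 + g y * q y) * (forrelation n f g - m)\<^sup>2) \<le>
     card (sign_funs n) * ((corr n (cube n) (cube n) f q / 2 ^ n - m)\<^sup>2 + 1 / 2 ^ n)"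
proof -
  define W where "W g = (\<Prod>y\<in>cube n. 1 + g y * q y)" for g
  define M where "M = real (card (sign_funs n))"
  define c where "c y = transform_on n (cube n) f y / 2 ^ n" for y
  note mom = sum_sign_funs_moments[where q = q and n = n, folded W_def M_def]
  have phi: "forrelation n f g = (\<Sum>y\<in>cube n. c y * g y)" for g
    by (simp add: forrelation_eq_corr corr_def c_def sum_divide_distrib mult.commute)
  have lin: "(\<Sum>g\<in>sign_funs n. W g * (\<Sum>y\<in>cube n. c y * g y)) = M * (\<Sum>y\<in>cube n. c y * q y)"
  proof -
    have "(\<Sum>g\<in>sign_funs n. W g * (\<Sum>y\<in>cube n. c y * g y)) = (\<Sum>g\<in>sign_funs n. \<Sum>y\<in>cube n. c y * (g y * W g))"
      by (simp add: sum_distrib_left mult_ac)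
    also have "\<dots> = (\<Sum>y\<in>cube n. \<Sum>g\<in>sign_funs n. c y * (g y * W g))" by (rule sum.swap)
    also have "\<dots> = (\<Sum>y\<in>cube n. c y * (M * q y))"
      by (intro sum.cong refl) (simp add: mom(2) flip: sum_distrib_left)
    finally show ?thesis by (simp add: sum_distrib_left mult_ac)
  qed
  have quad: "(\<Sum>g\<in>sign_funs n. W g * (\<Sum>y\<in>cube n. c y * g y)\<^sup>2) =
      M * ((\<Sum>y\<in>cube n. c y * q y)\<^sup>2 + (\<Sum>y\<in>cube n. (c y)\<^sup>2 * (1 - (q y)\<^sup>2)))"
  proof -
    have "(\<Sum>g\<in>sign_funs n. W g * (\<Sum>y\<in>cube n. c y * g y)\<^sup>2) =
        (\<Sum>g\<in>sign_funs n. \<Sum>y\<in>cube n. \<Sum>z\<in>cube n. c y * c z * (g y * g z * W g))"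
      by (simp add: power2_eq_square sum_product sum_distrib_left mult_ac)
    also have "\<dots> = (\<Sum>y\<in>cube n. \<Sum>g\<in>sign_funs n. \<Sum>z\<in>cube n. c y * c z * (g y * g z * W g))"
      by (rule sum.swap)
    also have "\<dots> = (\<Sum>y\<in>cube n. \<Sum>z\<in>cube n. \<Sum>g\<in>sign_funs n. c y * c z * (g y * g z * W g))"
      by (intro sum.cong refl sum.swap)
    also have "\<dots> = (\<Sum>y\<in>cube n. \<Sum>z\<in>cube n. M * (c y * c z * (if y = z then 1 else q y * q z)))"
      by (intro sum.cong refl) (simp add: mom(3) flip: sum_distrib_left)
    also have "\<dots> = M * (\<Sum>y\<in>cube n. \<Sum>z\<in>cube n. c y * c z * (if y = z then 1 else q y * q z))"
      by (simp only: sum_distrib_left)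
    finally show ?thesis by (simp only: sum_pairwise_uncorrelated[OF finite_cube])
  qed
  have "(\<Sum>g\<in>sign_funs n. W g * (forrelation n f g - m)\<^sup>2) =
      (\<Sum>g\<in>sign_funs n. W g * (\<Sum>y\<in>cube n. c y * g y)\<^sup>2 - 2 * m * (W g * (\<Sum>y\<in>cube n. c y * g y)) + m\<^sup>2 * W g)"
    unfolding phi by (intro sum.cong refl) (simp add: power2_eq_square algebra_simps)
  also have "\<dots> = (\<Sum>g\<in>sign_funs n. W g * (\<Sum>y\<in>cube n. c y * g y)\<^sup>2)
      - 2 * m * (\<Sum>g\<in>sign_funs n. W g * (\<Sum>y\<in>cube n. c y * g y)) + m\<^sup>2 * (\<Sum>g\<in>sign_funs n. W g)"
    by (simp only: sum.distrib sum_subtractf sum_distrib_left)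
  also have "\<dots> = M * (((\<Sum>y\<in>cube n. c y * q y) - m)\<^sup>2 + (\<Sum>y\<in>cube n. (c y)\<^sup>2 * (1 - (q y)\<^sup>2)))"
    unfolding lin quad mom(1) by (simp add: power2_eq_square algebra_simps)
  also have "\<dots> \<le> M * (((\<Sum>y\<in>cube n. c y * q y) - m)\<^sup>2 + (\<Sum>y\<in>cube n. (c y)\<^sup>2))"
    by (intro mult_left_mono add_left_mono sum_mono mult_left_le) (auto simp: M_def)
  also have "(\<Sum>y\<in>cube n. (c y)\<^sup>2) = 1 / 2 ^ n"
    by (simp add: c_def power_divide sum_transform_sq[OF f] power2_eq_square[of "2 ^ n"] flip: sum_divide_distrib)
  also have "(\<Sum>y\<in>cube n. c y * q y) = corr n (cube n) (cube n) f q / 2 ^ n"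
    by (simp add: corr_def c_def sum_divide_distrib mult.commute)
  finally show ?thesis by (simp add: W_def M_def)
qed

lemma sum_forrelation_square_uniform:
  "(\<Sum>(f, g)\<in>sign_funs n \<times> sign_funs n. (forrelation n f g)\<^sup>2) \<le> card (sign_funs n \<times> sign_funs n) / 2 ^ n"
proof -
  have "(\<Sum>g\<in>sign_funs n. (forrelation n f g)\<^sup>2) \<le> card (sign_funs n) / 2 ^ n" if "f \<in> sign_funs n" for f
    using sum_forrelation_square[OF that, of "\<lambda>_. 0" 0] by (simp add: corr_zero_g)
  hence "(\<Sum>f\<in>sign_funs n. \<Sum>g\<in>sign_funs n. (forrelation n f g)\<^sup>2) \<le> (\<Sum>f\<in>sign_funs n. card (sign_funs n) / 2 ^ n)"
    by (intro sum_mono) auto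
  thus ?thesis by (simp add: sum.cartesian_product)
qed

lemma cylinder_empty: "cylinder n {} {} f0 g0 = sign_funs n \<times> sign_funs n"
  by (auto simp: cylinder_def)

context rounding begin

lemma sum_density: "(\<Sum>(f, g)\<in>sign_funs n \<times> sign_funs n. joint_density n f g) = card (sign_funs n \<times> sign_funs n)"
proof -
  interpret prob_space "gaussian (cube n)" by (rule prob_space_gaussian)
  have "ratio n {} {} f g = 1" for f g by (simp add: ratio_def lik_def prob_space)
  thus ?thesis
    using integral_sum_lik[of "{}" n "{}"] by (simp add: cylinder_empty)
qed

text \<open>For \<open>h\<close> the indicator of an output, the probability of this output
  decreases by at most \<delta> when uniform inputs are replaced by hard ones. The free parameter
  \<open>l\<close> is the price of passing from the absolute value of the bilinear form to its
  square.\<close>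

lemma tree_density_ge:
  fixes h :: "bool \<Rightarrow> real" and l \<delta> :: real and T :: nat
  assumes wf: "wf_tree n t" and dt: "depth t \<le> T" and T: "T > 0" "(real T)\<^sup>2 \<le> 2 ^ n" and l: "l > 0"
    and h: "\<And>b. 0 \<le> h b" "\<And>b. h b \<le> 1"
  defines "\<delta> \<equiv> (D + 4 * curv) * (l + (1 + 1 / l) * (4 * (real T)\<^sup>2 / 2 ^ n * ((real n)\<^sup>2 + 8 * real n + 8)) + (real T)\<^sup>2 / 2 ^ n)"
  shows "(\<Sum>(f, g)\<in>sign_funs n \<times> sign_funs n. h (tree_output t f g) * joint_density n f g) \<ge>
     (\<Sum>(f, g)\<in>sign_funs n \<times> sign_funs n. h (tree_output t f g)) - card (sign_funs n \<times> sign_funs n) * \<delta>"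
proof -
  let ?S = "sign_funs n \<times> sign_funs n"
  define C where "C = D + 4 * curv"
  have C: "C \<ge> 0" using D_nonneg curv_nonneg by (simp add: C_def)
  define V where "V f g = leaf_stat n T (queried_f t f g) (queried_g t f g) f g" for f g
  have leaf: "h (tree_output t f g) * ratio n (queried_f t f g) (queried_g t f g) f g \<ge>
      h (tree_output t f g) - C * (l + (1 + 1 / l) * V f g + (real T)\<^sup>2 / 2 ^ n)"
    if "f \<in> sign_funs n" "g \<in> sign_funs n" for f g
  proof -
    define A B where "A = queried_f t f g" and "B = queried_g t f g"
    have AB: "A \<subseteq> cube n" "B \<subseteq> cube n" using queried_subset[OF wf] by (auto simp: A_def B_def)
    have c: "card A + card B \<le> T" using card_queried[of t f g] dt by (simp add: A_def B_def)
    have "real (card A * card B) \<le> real T * real T"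
      unfolding of_nat_mult using c by (intro mult_mono) auto
    hence cc: "real (card A * card B) \<le> (real T)\<^sup>2" by (simp add: power2_eq_square)
    define r where "r = corr n A B f g"
    define s where "s = (\<Sum>y\<in>B. (transform_on n A f y)\<^sup>2)"
    define u where "u = (\<Sum>x\<in>A. (transform_on n B g x)\<^sup>2)"
    have su: "s \<ge> 0" "u \<ge> 0" by (auto simp: s_def u_def sum_nonneg)
    have V: "r\<^sup>2 + s + u \<le> V f g"
      using leaf_stat_ge[OF AB c T(1), of f g] unfolding r_def s_def u_def V_def A_def B_def .
    \<comment> \<open>Only the square of the form is controlled by \<open>leaf_stat\<close>: either
      \<bar>r\<bar> is at most \<open>l\<close>, or \<bar>r\<bar> \<le> r^2 / l.\<close>
    have "\<bar>r\<bar> \<le> l + r\<^sup>2 / l"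
    proof (cases "\<bar>r\<bar> \<le> l")
      case True
      thus ?thesis using l by (simp add: add_increasing2)
    next
      case False
      hence "l * \<bar>r\<bar> \<le> \<bar>r\<bar> * \<bar>r\<bar>" by (intro mult_right_mono) auto
      hence "\<bar>r\<bar> \<le> r\<^sup>2 / l" using l by (simp add: field_simps power2_eq_square)
      thus ?thesis using l by simp
    qed
    moreover have "r\<^sup>2 / l \<le> (1 / l) * V f g"
      using V su l by (simp add: divide_right_mono)
    moreover have "real (card A * card B) / 2 ^ n \<le> (real T)\<^sup>2 / 2 ^ n"
      using cc by (intro divide_right_mono) auto
    moreover have "(1 + 1 / l) * V f g = V f g + (1 / l) * V f g" by (simp add: algebra_simps)
    moreover have "s + u \<le> V f g" using V zero_le_power2[of r] by linarith
    ultimately have "\<bar>r\<bar> + s + u + real (card A * card B) / 2 ^ n \<le> l + (1 + 1 / l) * V f g + (real T)\<^sup>2 / 2 ^ n"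
      by linarith
    hence "C * (\<bar>r\<bar> + s + u + real (card A * card B) / 2 ^ n) \<le> C * (l + (1 + 1 / l) * V f g + (real T)\<^sup>2 / 2 ^ n)"
      using C by (rule mult_left_mono)
    moreover have "ratio n A B f g \<ge> 1 - C * (\<bar>r\<bar> + s + u + real (card A * card B) / 2 ^ n)"
      unfolding C_def r_def s_def u_def
      by (rule ratio_ge) (use AB cc T(2) abs_sign_funs[OF that(1)] abs_sign_funs[OF that(2)] in auto)
    ultimately have r: "1 - C * (l + (1 + 1 / l) * V f g + (real T)\<^sup>2 / 2 ^ n) \<le> ratio n A B f g" by linarith
    define Z where "Z = C * (l + (1 + 1 / l) * V f g + (real T)\<^sup>2 / 2 ^ n)"
    have "V f g \<ge> 0" using V su zero_le_power2[of r] by linarith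
    hence Z: "Z \<ge> 0"
      unfolding Z_def using C l by (intro mult_nonneg_nonneg add_nonneg_nonneg) auto
    have "h b - Z \<le> h b * ratio n A B f g" for b
    proof -
      have "h b * (1 - Z) \<le> h b * ratio n A B f g" using r h(1) unfolding Z_def by (rule mult_left_mono)
      moreover have "h b * (1 - Z) = h b - h b * Z" by (simp add: algebra_simps)
      moreover have "h b * Z \<le> Z" using h Z by (simp add: mult_left_le_one_le)
      ultimately show ?thesis by linarith
    qed
    thus ?thesis unfolding A_def B_def Z_def .
  qed
  have "(\<Sum>(f, g)\<in>cylinder n {} {} (\<lambda>_. 1) (\<lambda>_. 1). h (tree_output t f g) *
      (ratio n ({} \<union> queried_f t f g) ({} \<union> queried_g t f g) f g - joint_density n f g)) \<le>
      card (cylinder n {} {} (\<lambda>_. 1) (\<lambda>_. 1)) * (0 :: real)"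
  \<comment> \<open>The potential is identically 0: on the cylinder of a leaf the joint density sums
    to the leaf ratio times the number of inputs, so their difference cancels.\<close>
  proof (rule tree_supermartingale[where T = T and V = "\<lambda>_ _ _ _. 0" and
        W = "\<lambda>b A B f g. h b * (ratio n A B f g - joint_density n f g)"])
    fix b A B f0 g0 assume AB: "A \<subseteq> cube n" "B \<subseteq> cube n"
    have "(\<Sum>(f, g)\<in>cylinder n A B f0 g0. ratio n A B f g) = (\<Sum>(f, g)\<in>cylinder n A B f0 g0. ratio n A B f0 g0)"
      by (intro sum.cong) (auto simp: cylinder_def intro!: local_ratio)
    hence "(\<Sum>(f, g)\<in>cylinder n A B f0 g0. ratio n A B f g - joint_density n f g) = 0"
      using integral_sum_lik[OF AB, of f0 g0] by (simp add: case_prod_beta sum_subtractf)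
    hence "(\<Sum>(f, g)\<in>cylinder n A B f0 g0. h b * (ratio n A B f g - joint_density n f g)) = 0"
      by (simp add: case_prod_beta flip: sum_distrib_left)
    thus "(\<Sum>(f, g)\<in>cylinder n A B f0 g0. h b * (ratio n A B f g - joint_density n f g)) \<le> card (cylinder n A B f0 g0) * (0 :: real)"
      by simp
  qed (use wf dt in auto)
  hence avg: "(\<Sum>(f, g)\<in>?S. h (tree_output t f g) * ratio n (queried_f t f g) (queried_g t f g) f g) \<le>
      (\<Sum>(f, g)\<in>?S. h (tree_output t f g) * joint_density n f g)"
    by (simp add: cylinder_empty case_prod_beta right_diff_distrib sum_subtractf)
  have "(\<Sum>(f, g)\<in>?S. h (tree_output t f g)) - C * (card ?S * l + (1 + 1 / l) * (\<Sum>(f, g)\<in>?S. V f g) + card ?S * ((real T)\<^sup>2 / 2 ^ n)) =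
      (\<Sum>(f, g)\<in>?S. h (tree_output t f g) - C * (l + (1 + 1 / l) * V f g + (real T)\<^sup>2 / 2 ^ n))"
    by (simp add: case_prod_beta sum_subtractf sum.distrib flip: sum_distrib_left)
  also have "\<dots> \<le> (\<Sum>(f, g)\<in>?S. h (tree_output t f g) * ratio n (queried_f t f g) (queried_g t f g) f g)"
    by (intro sum_mono) (use leaf in auto)
  also note avg
  finally have 1: "(\<Sum>(f, g)\<in>?S. h (tree_output t f g)) - C * (card ?S * l + (1 + 1 / l) * (\<Sum>(f, g)\<in>?S. V f g) + card ?S * ((real T)\<^sup>2 / 2 ^ n))
      \<le> (\<Sum>(f, g)\<in>?S. h (tree_output t f g) * joint_density n f g)" .
  have "(\<Sum>(f, g)\<in>?S. V f g) \<le> card ?S * (4 * (real T)\<^sup>2 / 2 ^ n * ((real n)\<^sup>2 + 8 * real n + 8))"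
    unfolding V_def by (rule tree_leaf_stat[OF wf dt T(1)])
  hence "C * (card ?S * l + (1 + 1 / l) * (\<Sum>(f, g)\<in>?S. V f g) + card ?S * ((real T)\<^sup>2 / 2 ^ n)) \<le>
      C * (card ?S * l + (1 + 1 / l) * (card ?S * (4 * (real T)\<^sup>2 / 2 ^ n * ((real n)\<^sup>2 + 8 * real n + 8))) + card ?S * ((real T)\<^sup>2 / 2 ^ n))"
    using C l by (intro mult_left_mono add_mono order_refl) auto
  also have "\<dots> = card ?S * \<delta>" by (simp only: \<delta>_def C_def distrib_left mult_ac)
  finally show ?thesis using 1 by linarith
qed

text \<open>Given \<open>v\<close>, the factors of the likelihood belonging to f vanish unless f is
  the sign pattern of \<open>v\<close>; the sum collapses to one f and to independent signs g with
  means \<psi>(w).\<close>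

lemma sum_lik_forrelation:
  "(\<Sum>(f, g)\<in>sign_funs n \<times> sign_funs n. lik n (cube n) (cube n) f g v * (forrelation n f g - m)\<^sup>2) \<le>
    card (sign_funs n \<times> sign_funs n) * ((mean_corr \<psi> n v - m)\<^sup>2 + 1 / 2 ^ n)"
proof -
  define \<sigma> where "\<sigma> = (\<lambda>x\<in>cube n. sg (v x))"
  define q where "q y = \<psi> (hadamard n v y)" for y
  define M where "M = real (card (sign_funs n))"
  define W where "W g = (\<Prod>y\<in>cube n. 1 + g y * q y)" for g
  have \<sigma>: "\<sigma> \<in> sign_funs n" by (auto simp: \<sigma>_def sign_funs_def sg_def)
  have zero: "(\<Prod>x\<in>cube n. 1 + f x * sg (v x)) = (if f = \<sigma> then M else 0)" if f: "f \<in> sign_funs n" for f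
  proof (cases "f = \<sigma>")
    case True
    have "(\<Prod>x\<in>cube n. 1 + f x * sg (v x)) = (\<Prod>x\<in>cube n. 2)"
      using True by (intro prod.cong) (auto simp: \<sigma>_def)
    thus ?thesis using True by (simp add: M_def card_sign_funs card_cube)
  next
    case False
    then obtain x where x: "x \<in> cube n" "f x \<noteq> \<sigma> x"
      using f \<sigma> unfolding sign_funs_def by (metis PiE_ext)
    hence "1 + f x * sg (v x) = 0" using sign_funs_cases[OF f x(1)] by (auto simp: \<sigma>_def sg_def split: if_splits)
    thus ?thesis using x(1) False by (auto intro!: prod_zero)
  qed
  have "(\<Sum>(f, g)\<in>sign_funs n \<times> sign_funs n. lik n (cube n) (cube n) f g v * (forrelation n f g - m)\<^sup>2) =
      (\<Sum>f\<in>sign_funs n. \<Sum>g\<in>sign_funs n. (if f = \<sigma> then M else 0) * (W g * (forrelation n f g - m)\<^sup>2))"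
    by (simp add: sum.cartesian_product [symmetric] lik_def zero W_def q_def mult.assoc cong: sum.cong)
  also have "\<dots> = (\<Sum>f\<in>sign_funs n. if f = \<sigma> then M * (\<Sum>g\<in>sign_funs n. W g * (forrelation n f g - m)\<^sup>2) else 0)"
    by (intro sum.cong refl) (simp add: sum_distrib_left)
  also have "\<dots> = M * (\<Sum>g\<in>sign_funs n. W g * (forrelation n \<sigma> g - m)\<^sup>2)"
    using \<sigma> by simp
  also have "\<dots> \<le> M * (M * ((corr n (cube n) (cube n) \<sigma> q / 2 ^ n - m)\<^sup>2 + 1 / 2 ^ n))"
    unfolding W_def M_def using bound \<rho>
    by (intro mult_left_mono sum_forrelation_square \<sigma>) (auto simp: q_def intro: order_trans less_imp_le)
  also have "corr n (cube n) (cube n) \<sigma> q / 2 ^ n = mean_corr \<psi> n v"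
    by (simp add: corr_def mean_corr_def sign_transform_def transform_on_def \<sigma>_def q_def mult.commute)
  finally show ?thesis by (simp add: M_def mult.assoc)
qed

lemma sum_density_forrelation:
  assumes int: "integrable (gaussian (cube n)) (\<lambda>v. (mean_corr \<psi> n v - m)\<^sup>2)"
  shows "(\<Sum>(f, g)\<in>sign_funs n \<times> sign_funs n. joint_density n f g * (forrelation n f g - m)\<^sup>2) \<le>
    card (sign_funs n \<times> sign_funs n) * ((\<integral>v. (mean_corr \<psi> n v - m)\<^sup>2 \<partial>gaussian (cube n)) + 1 / 2 ^ n)"
proof -
  interpret prob_space "gaussian (cube n)" by (rule prob_space_gaussian)
  let ?S = "sign_funs n \<times> sign_funs n"
  have il: "integrable (gaussian (cube n)) (\<lambda>v. lik n (cube n) (cube n) (fst p) (snd p) v * (forrelation n (fst p) (snd p) - m)\<^sup>2)"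
    if "p \<in> ?S" for p
    using that by (intro integrable_mult_left integrable_lik) (auto simp: abs_sign_funs)
  have "(\<Sum>(f, g)\<in>?S. joint_density n f g * (forrelation n f g - m)\<^sup>2) =
      (\<Sum>p\<in>?S. \<integral>v. lik n (cube n) (cube n) (fst p) (snd p) v * (forrelation n (fst p) (snd p) - m)\<^sup>2 \<partial>gaussian (cube n))"
    by (simp add: joint_density_def ratio_def case_prod_beta)
  also have "\<dots> = (\<integral>v. (\<Sum>p\<in>?S. lik n (cube n) (cube n) (fst p) (snd p) v * (forrelation n (fst p) (snd p) - m)\<^sup>2) \<partial>gaussian (cube n))"
    by (rule Bochner_Integration.integral_sum [symmetric]) (rule il)
  also have "\<dots> \<le> (\<integral>v. card ?S * ((mean_corr \<psi> n v - m)\<^sup>2 + 1 / 2 ^ n) \<partial>gaussian (cube n))"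
  proof (rule integral_mono)
    show "integrable (gaussian (cube n)) (\<lambda>v. \<Sum>p\<in>?S. lik n (cube n) (cube n) (fst p) (snd p) v * (forrelation n (fst p) (snd p) - m)\<^sup>2)"
      by (rule Bochner_Integration.integrable_sum) (rule il)
    show "integrable (gaussian (cube n)) (\<lambda>v. card ?S * ((mean_corr \<psi> n v - m)\<^sup>2 + 1 / 2 ^ n))"
      by (intro integrable_mult_right Bochner_Integration.integrable_add int) simp
    show "(\<Sum>p\<in>?S. lik n (cube n) (cube n) (fst p) (snd p) v * (forrelation n (fst p) (snd p) - m)\<^sup>2) \<le>
        card ?S * ((mean_corr \<psi> n v - m)\<^sup>2 + 1 / 2 ^ n)" for v
      using sum_lik_forrelation[of n v m] by (simp add: case_prod_beta)
  qed
  also have "\<dots> = card ?S * ((\<integral>v. (mean_corr \<psi> n v - m)\<^sup>2 \<partial>gaussian (cube n)) + 1 / 2 ^ n)"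
    by (simp add: int prob_space)
  finally show ?thesis .
qed

end

section \<open>A flat sine polynomial\<close>

text \<open>
  The sine coefficients, scaled by \<open>199/200\<close>, of the odd polynomial \<open>P\<close> with \<open>P(1) = 1\<close> and
  \<open>P'(s) \<propto> ((1 - s\<^sup>2) (1 - 2 s\<^sup>2))\<^sup>2\<close>, evaluated at \<open>s = sin (9 z / 10)\<close>. The last factor was chosen to bring
  the gain above \<open>3/5\<close>; a single sine does not suffice.
\<close>

definition flat_coeff :: "nat \<Rightarrow> real" where
  "flat_coeff k = 199 / 200 * ([8190, 2100, 756, 225, 35] ! k / 6656)"

definition flat_freq :: "nat \<Rightarrow> real" where
  "flat_freq k = (2 * real k + 1) * (9 / 10)"

text \<open>All cases follow from the recurrence sin ((b + 2) u) = 2 cos (2 u) sin (b u) - sin ((b -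
  2) u).\<close>

lemma sin_odd_multiples:
  fixes u :: real
  defines "s \<equiv> sin u"
  shows "sin (3 * u) = 3 * s - 4 * s ^ 3"
    "sin (5 * u) = 5 * s - 20 * s ^ 3 + 16 * s ^ 5"
    "sin (7 * u) = 7 * s - 56 * s ^ 3 + 112 * s ^ 5 - 64 * s ^ 7"
    "sin (9 * u) = 9 * s - 120 * s ^ 3 + 432 * s ^ 5 - 576 * s ^ 7 + 256 * s ^ 9"
proof -
  have c2: "cos (2 * u) = 1 - 2 * s\<^sup>2" by (simp add: s_def cos_double_sin)
  have rec: "sin (a * u) = 2 * (1 - 2 * s\<^sup>2) * sin (b * u) - sin (d * u)" if "a = b + 2" "d = b - 2" for a b d
  proof -
    have "a * u = b * u + 2 * u" "d * u = b * u - 2 * u" unfolding that by (simp_all add: algebra_simps)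
    thus ?thesis by (simp add: sin_add sin_diff c2)
  qed
  have "sin (3 * u) = 2 * (1 - 2 * s\<^sup>2) * s + s"
    using rec[of 3 1 "- 1"] by (simp add: s_def)
  also have "\<dots> = 3 * s - 4 * s ^ 3" by algebra
  finally show 3: "sin (3 * u) = 3 * s - 4 * s ^ 3" .
  have "sin (5 * u) = 2 * (1 - 2 * s\<^sup>2) * sin (3 * u) - s"
    using rec[of 5 3 1] by (simp add: s_def)
  also have "\<dots> = 5 * s - 20 * s ^ 3 + 16 * s ^ 5" unfolding 3 by algebra
  finally show 5: "sin (5 * u) = 5 * s - 20 * s ^ 3 + 16 * s ^ 5" .
  have "sin (7 * u) = 2 * (1 - 2 * s\<^sup>2) * sin (5 * u) - sin (3 * u)"
    by (rule rec) auto
  also have "\<dots> = 7 * s - 56 * s ^ 3 + 112 * s ^ 5 - 64 * s ^ 7" unfolding 3 5 by algebra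
  finally show 7: "sin (7 * u) = 7 * s - 56 * s ^ 3 + 112 * s ^ 5 - 64 * s ^ 7" .
  have "sin (9 * u) = 2 * (1 - 2 * s\<^sup>2) * sin (7 * u) - sin (5 * u)"
    by (rule rec) auto
  also have "\<dots> = 9 * s - 120 * s ^ 3 + 432 * s ^ 5 - 576 * s ^ 7 + 256 * s ^ 9" unfolding 5 7 by algebra
  finally show "sin (9 * u) = 9 * s - 120 * s ^ 3 + 432 * s ^ 5 - 576 * s ^ 7 + 256 * s ^ 9" .
qed

text \<open>The derivative of the polynomial is \<open>20160 ((1 - s\<^sup>2) (1 - 2 s\<^sup>2))\<^sup>2\<close>, so it is monotone.\<close>

lemma flat_polynomial_bound:
  fixes s :: real
  assumes "\<bar>s\<bar> \<le> 1"
  shows "\<bar>20160 * s - 40320 * s ^ 3 + 52416 * s ^ 5 - 34560 * s ^ 7 + 8960 * s ^ 9\<bar> \<le> 6656"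
proof -
  define R where "R s = 20160 * s - 40320 * s ^ 3 + 52416 * s ^ 5 - 34560 * s ^ 7 + 8960 * s ^ 9" for s :: real
  have mono: "R a \<le> R b" if "a \<le> b" for a b
  proof (rule DERIV_nonneg_imp_nondecreasing[OF that])
    fix x :: real
    have "(R has_real_derivative 20160 - 120960 * x ^ 2 + 262080 * x ^ 4 - 241920 * x ^ 6 + 80640 * x ^ 8) (at x)"
      unfolding R_def [abs_def] by (auto intro!: derivative_eq_intros)
    moreover have "20160 - 120960 * x ^ 2 + 262080 * x ^ 4 - 241920 * x ^ 6 + 80640 * x ^ 8 =
        20160 * ((1 - x\<^sup>2) * (1 - 2 * x\<^sup>2))\<^sup>2"
      by (simp add: power_numeral_reduce algebra_simps)
    ultimately show "\<exists>d. (R has_real_derivative d) (at x) \<and> 0 \<le> d" by auto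
  qed
  \<comment> \<open>The value of \<open>R\<close> at 1 is 6656, the denominator in
    \<open>flat_coeff\<close>.\<close>
  have "R (- 1) \<le> R s" "R s \<le> R 1" using assms by (auto intro!: mono)
  thus ?thesis by (simp add: R_def abs_le_iff)
qed

lemma abs_flat_le: "\<bar>sine_poly 5 flat_coeff flat_freq z\<bar> \<le> 199 / 200"
proof -
  define u where "u = 9 / 10 * z"
  define s where "s = sin u"
  have freq: "flat_freq 0 * z = u" "flat_freq 1 * z = 3 * u" "flat_freq 2 * z = 5 * u" "flat_freq 3 * z = 7 * u" "flat_freq 4 * z = 9 * u"
    by (simp_all add: flat_freq_def u_def)
  have "sine_poly 5 flat_coeff flat_freq z = 199 / 200 *
      ((8190 * sin u + 2100 * sin (3 * u) + 756 * sin (5 * u) + 225 * sin (7 * u) + 35 * sin (9 * u)) / 6656)"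
    using freq by (simp add: sine_poly_def eval_nat_numeral flat_coeff_def)
  also have "8190 * sin u + 2100 * sin (3 * u) + 756 * sin (5 * u) + 225 * sin (7 * u) + 35 * sin (9 * u) =
      20160 * s - 40320 * s ^ 3 + 52416 * s ^ 5 - 34560 * s ^ 7 + 8960 * s ^ 9"
    unfolding sin_odd_multiples by (simp add: s_def)
  finally show ?thesis
    using flat_polynomial_bound[of s] by (simp add: s_def abs_mult abs_divide)
qed

text \<open>Otherwise sin (63/20) would be positive, but its Taylor polynomial of degree 13 plus the
  remainder bound is not.\<close>

lemma pi_le: "pi \<le> 63 / 20"
proof (rule ccontr)
  assume "\<not> pi \<le> 63 / 20"
  hence "sin (63 / 20 :: real) > 0" by (intro sin_gt_zero) auto
  moreover have "\<bar>sin (63 / 20) - (\<Sum>m<14. sin_coeff m * (63 / 20) ^ m)\<bar> \<le> inverse (fact 14) * \<bar>63 / 20 :: real\<bar> ^ 14"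
    by (rule Maclaurin_sin_bound)
  moreover have "(\<Sum>m<14. sin_coeff m * (63 / 20) ^ m) + inverse (fact 14) * \<bar>63 / 20 :: real\<bar> ^ 14 \<le> 0"
    by (simp add: sin_coeff_def lessThan_nat_numeral fact_numeral power_divide)
  ultimately show False by linarith
qed

text \<open>All terms are nonnegative and the two lowest frequencies suffice. With e = exp (-
  (9/10)^2 / 2), tripling the frequency gives the power 3^2 = 9 of \<open>e\<close>; the bound for
  \<open>e\<close> comes from (1 - x / 32)^32 \<le> exp (- x).\<close>

lemma flat_gain: "sine_poly_gain 5 flat_coeff flat_freq > 3 / 5"
proof -
  define e where "e = exp (- (81 / 200 :: real))"
  have "(1 + - (81 / 200) / real 32) ^ 32 \<le> e"
    unfolding e_def by (rule exp_ge_one_plus_x_over_n_power_n) auto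
  moreover have "(665 / 1000 :: real) \<le> (1 + - (81 / 200) / real 32) ^ 32" by (simp add: power_divide)
  ultimately have e: "665 / 1000 \<le> e" by linarith
  have e9: "exp (- (flat_freq 1)\<^sup>2 / 2) = e ^ 9" "exp (- (flat_freq 0)\<^sup>2 / 2) = e"
    unfolding e_def exp_of_nat_mult [symmetric] by (simp_all add: flat_freq_def power2_eq_square)
  define S where "S = (\<Sum>k<5. flat_coeff k * flat_freq k * exp (- (flat_freq k)\<^sup>2 / 2))"
  have pos: "flat_coeff k * flat_freq k * exp (- (flat_freq k)\<^sup>2 / 2) \<ge> 0" if "k < 5" for k
    using that by (auto simp: flat_coeff_def flat_freq_def less_Suc_eq eval_nat_numeral)
  have "(\<Sum>k<2. flat_coeff k * flat_freq k * exp (- (flat_freq k)\<^sup>2 / 2)) \<le> S"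
    unfolding S_def by (rule sum_mono2) (use pos in auto)
  moreover have "(\<Sum>k<2. flat_coeff k * flat_freq k * exp (- (flat_freq k)\<^sup>2 / 2)) =
      199 / 200 * (8190 * (9 / 10) * e + 2100 * (27 / 10) * e ^ 9) / 6656"
    using e9 by (simp add: numeral_2_eq_2 flat_coeff_def flat_freq_def)
  moreover have "254 / 10000 \<le> e ^ 9"
  proof -
    have "(254 / 10000 :: real) \<le> (665 / 1000) ^ 9" by (simp add: power_divide)
    also have "\<dots> \<le> e ^ 9" using e by (intro power_mono) auto
    finally show ?thesis .
  qed
  ultimately have S: "S \<ge> 754 / 1000" using e by (simp add: field_simps)
  have "(3 / 5)\<^sup>2 < 2 / pi * (754 / 1000)\<^sup>2"
    using pi_le pi_gt_zero by (simp add: field_simps power2_eq_square)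
  hence "3 / 5 < sqrt (2 / pi * (754 / 1000)\<^sup>2)" by (rule real_less_rsqrt)
  also have "\<dots> = sqrt (2 / pi) * (754 / 1000)"
    unfolding real_sqrt_mult real_sqrt_abs by simp
  also have "\<dots> \<le> sqrt (2 / pi) * S" using S by (intro mult_left_mono) auto
  finally show ?thesis by (simp add: sine_poly_gain_def S_def)
qed

lemma rounding_sine_poly:
  assumes "\<And>z. \<bar>sine_poly K c a z\<bar> \<le> \<rho>" "\<rho> < 1"
  shows "rounding (sine_poly K c a) (\<lambda>z. \<Sum>k<K. c k * a k * cos (a k * z)) (\<lambda>z. \<Sum>k<K. - (c k * (a k)\<^sup>2 * sin (a k * z)))
    \<rho> (\<Sum>k<K. \<bar>c k * a k\<bar> + \<bar>c k * (a k)\<^sup>2\<bar>)"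
proof
  fix z
  show "(sine_poly K c a has_real_derivative (\<Sum>k<K. c k * a k * cos (a k * z))) (at z)"
    unfolding sine_poly_def [abs_def] by (auto intro!: derivative_eq_intros sum.cong)
  show "((\<lambda>z. \<Sum>k<K. c k * a k * cos (a k * z)) has_real_derivative (\<Sum>k<K. - (c k * (a k)\<^sup>2 * sin (a k * z)))) (at z)"
    by (auto intro!: derivative_eq_intros sum.cong simp: power2_eq_square)
  have t: "\<bar>x * y\<bar> \<le> \<bar>x\<bar>" if "\<bar>y\<bar> \<le> 1" for x y :: real
    using that by (simp add: abs_mult mult_left_le)
  show "\<bar>\<Sum>k<K. c k * a k * cos (a k * z)\<bar> \<le> (\<Sum>k<K. \<bar>c k * a k\<bar> + \<bar>c k * (a k)\<^sup>2\<bar>)"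
    by (intro order_trans[OF sum_abs] sum_mono add_increasing2 t) auto
  show "\<bar>\<Sum>k<K. - (c k * (a k)\<^sup>2 * sin (a k * z))\<bar> \<le> (\<Sum>k<K. \<bar>c k * a k\<bar> + \<bar>c k * (a k)\<^sup>2\<bar>)"
    by (intro order_trans[OF sum_abs] sum_mono add_increasing) (auto intro: t)
  show "sine_poly K c a (- z) = - sine_poly K c a z"
    by (simp add: sine_poly_def sum_negf)
qed (use assms in auto)

section \<open>The lower bound\<close>

lemma forrelation_inputsI:
  "f \<in> sign_funs n \<Longrightarrow> g \<in> sign_funs n \<Longrightarrow> \<bar>forrelation n f g\<bar> \<le> 1/100 \<or> forrelation n f g \<ge> 3/5 \<Longrightarrow>
    (f, g) \<in> forrelation_inputs n"
  by (simp add: forrelation_inputs_def)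

lemma num_queries_le_max:
  assumes "max_queries n A = enat k" "t \<in> set_pmf A" "(f, g) \<in> forrelation_inputs n"
  shows "num_queries t f g \<le> k"
proof -
  have "enat (num_queries t f g) \<le> (SUP t\<in>set_pmf A. enat (num_queries t f g))"
    using assms(2) by (rule SUP_upper)
  also have "\<dots> \<le> (SUP (f, g)\<in>forrelation_inputs n. SUP t\<in>set_pmf A. enat (num_queries t f g))"
    using SUP_upper[OF assms(3), of "\<lambda>(f, g). SUP t\<in>set_pmf A. enat (num_queries t f g)"] by simp
  finally show ?thesis using assms(1) by (simp add: max_queries_def)
qed

text \<open>Rejecting means answering \<open>False\<close>. Truncation gives this a controlled depth
  on every input, while on promise inputs it agrees with the algorithm once \<open>T\<close> is at
  least the maximal number of queries.\<close>

definition reject_prob :: "randomized_algorithm \<Rightarrow> nat \<Rightarrow> (bool list \<Rightarrow> real) \<Rightarrow> (bool list \<Rightarrow> real) \<Rightarrow> real" where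
  "reject_prob A T f g = measure_pmf.expectation A (\<lambda>t. of_bool (\<not> tree_output (trunc t T) f g))"

lemma integrable_reject: "integrable (measure_pmf A) (\<lambda>t. of_bool (\<not> tree_output (trunc t T) f g) :: real)"
  by (rule measure_pmf.integrable_const_bound[of _ 1]) auto

lemma reject_prob_bounds: "0 \<le> reject_prob A T f g" "reject_prob A T f g \<le> 1"
proof -
  show "0 \<le> reject_prob A T f g" unfolding reject_prob_def by (rule Bochner_Integration.integral_nonneg) simp
  show "reject_prob A T f g \<le> 1"
    unfolding reject_prob_def by (rule measure_pmf.integral_le_const[OF integrable_reject]) auto
qed

lemma reject_prob_eq:
  assumes "\<And>t. t \<in> set_pmf A \<Longrightarrow> num_queries t f g \<le> T"
  shows "reject_prob A T f g = measure_pmf.prob A {t. \<not> tree_output t f g}"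
proof -
  have "reject_prob A T f g = measure_pmf.expectation A (indicator {t. \<not> tree_output t f g})"
    unfolding reject_prob_def
    by (intro integral_cong_AE) (auto simp: AE_measure_pmf_iff tree_output_trunc assms indicator_def)
  thus ?thesis by simp
qed

lemma reject_prob_valid:
  assumes sol: "solves_forrelation n (1/2 - \<epsilon>) A" and k: "max_queries n A = enat k" "k \<le> T"
    and fg: "f \<in> sign_funs n" "g \<in> sign_funs n"
  shows "forrelation n f g \<ge> 3/5 \<Longrightarrow> reject_prob A T f g \<le> 1/2 - \<epsilon>"
    and "\<bar>forrelation n f g\<bar> \<le> 1/100 \<Longrightarrow> reject_prob A T f g \<ge> 1/2 + \<epsilon>"
proof -
  have valid: "reject_prob A T f g = measure_pmf.prob A {t. \<not> tree_output t f g} \<and> error_prob n A f g \<le> 1/2 - \<epsilon>"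
    if "\<bar>forrelation n f g\<bar> \<le> 1/100 \<or> forrelation n f g \<ge> 3/5"
  proof -
    have inp: "(f, g) \<in> forrelation_inputs n" using fg that by (rule forrelation_inputsI)
    have "num_queries t f g \<le> T" if "t \<in> set_pmf A" for t
      using num_queries_le_max[OF k(1) that inp] k(2) by simp
    thus ?thesis using reject_prob_eq sol inp by (auto simp: solves_forrelation_def)
  qed
  show "reject_prob A T f g \<le> 1/2 - \<epsilon>" if "forrelation n f g \<ge> 3/5"
    using valid that by (simp add: error_prob_def)
  show "reject_prob A T f g \<ge> 1/2 + \<epsilon>" if h: "\<bar>forrelation n f g\<bar> \<le> 1/100"
  proof -
    have "\<not> forrelation n f g \<ge> 3/5" using h by linarith
    hence "measure_pmf.prob A {t. tree_output t f g} \<le> 1/2 - \<epsilon>"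
      using valid h by (simp add: error_prob_def)
    moreover have "measure_pmf.prob A {t. \<not> tree_output t f g} = 1 - measure_pmf.prob A {t. tree_output t f g}"
      using measure_pmf.prob_compl[of "{t. tree_output t f g}" A] by (simp add: Compl_eq_Diff_UNIV [symmetric] Collect_neg_eq)
    ultimately show ?thesis using valid h by simp
  qed
qed

context rounding begin

lemma reject_prob_density_ge:
  assumes wf: "\<And>t. t \<in> set_pmf A \<Longrightarrow> wf_tree n t" and T: "T > 0" "(real T)\<^sup>2 \<le> 2 ^ n" and l: "l > 0"
  shows "(\<Sum>(f, g)\<in>sign_funs n \<times> sign_funs n. reject_prob A T f g * joint_density n f g) \<ge>
     (\<Sum>(f, g)\<in>sign_funs n \<times> sign_funs n. reject_prob A T f g) - card (sign_funs n \<times> sign_funs n) *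
     ((D + 4 * curv) * (l + (1 + 1 / l) * (4 * (real T)\<^sup>2 / 2 ^ n * ((real n)\<^sup>2 + 8 * real n + 8)) + (real T)\<^sup>2 / 2 ^ n))"
proof -
  let ?S = "sign_funs n \<times> sign_funs n"
  define \<delta> where "\<delta> = card ?S * ((D + 4 * curv) * (l + (1 + 1 / l) * (4 * (real T)\<^sup>2 / 2 ^ n * ((real n)\<^sup>2 + 8 * real n + 8)) + (real T)\<^sup>2 / 2 ^ n))"
  define X where "X t = (\<Sum>p\<in>?S. of_bool (\<not> tree_output (trunc t T) (fst p) (snd p)) * (joint_density n (fst p) (snd p) - 1))" for t
  have "X t \<ge> - \<delta>" if "t \<in> set_pmf A" for t
    using tree_density_ge[OF wf_trunc[OF wf[OF that]] depth_trunc T l, where h = "\<lambda>b. of_bool (\<not> b)"]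
    by (simp add: X_def \<delta>_def case_prod_beta right_diff_distrib sum_subtractf)
  moreover have int: "integrable (measure_pmf A) (\<lambda>t. of_bool (\<not> tree_output (trunc t T) (fst p) (snd p)) * (joint_density n (fst p) (snd p) - 1))" for p
    by (rule integrable_mult_left[OF integrable_reject])
  hence "integrable (measure_pmf A) X" unfolding X_def [abs_def] by (intro Bochner_Integration.integrable_sum)
  ultimately have "- \<delta> \<le> measure_pmf.expectation A X"
    by (intro measure_pmf.integral_ge_const) (auto simp: AE_measure_pmf_iff)
  also have "measure_pmf.expectation A X = (\<Sum>p\<in>?S. reject_prob A T (fst p) (snd p) * (joint_density n (fst p) (snd p) - 1))"
    unfolding X_def reject_prob_def
    by (subst Bochner_Integration.integral_sum[OF int]) (simp add: integrable_reject)
  finally show ?thesis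
    by (simp add: \<delta>_def case_prod_beta right_diff_distrib sum_subtractf)
qed

text \<open>Chebyshev's inequality around \<open>m\<close>, which lies strictly above the threshold
  3/5.\<close>

lemma sum_density_below:
  assumes m: "m > 3/5" and int: "integrable (gaussian (cube n)) (\<lambda>v. (mean_corr \<psi> n v - m)\<^sup>2)"
  shows "(\<Sum>(f, g)\<in>sign_funs n \<times> sign_funs n. joint_density n f g * of_bool (forrelation n f g < 3/5)) \<le>
    card (sign_funs n \<times> sign_funs n) * (((\<integral>v. (mean_corr \<psi> n v - m)\<^sup>2 \<partial>gaussian (cube n)) + 1 / 2 ^ n) / (m - 3/5)\<^sup>2)"
proof -
  let ?S = "sign_funs n \<times> sign_funs n"
  have "of_bool (forrelation n f g < 3/5) \<le> (forrelation n f g - m)\<^sup>2 / (m - 3/5)\<^sup>2" for f g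
  proof (cases "forrelation n f g < 3/5")
    case True
    hence "(m - 3/5)\<^sup>2 \<le> (m - forrelation n f g)\<^sup>2" using m by (intro power_mono) auto
    thus ?thesis using m by (simp add: power2_commute)
  qed simp
  hence "(\<Sum>(f, g)\<in>?S. joint_density n f g * of_bool (forrelation n f g < 3/5)) \<le>
      (\<Sum>(f, g)\<in>?S. joint_density n f g * ((forrelation n f g - m)\<^sup>2 / (m - 3/5)\<^sup>2))"
    by (intro sum_mono, clarify) (intro mult_left_mono density_nonneg)
  also have "\<dots> = (\<Sum>(f, g)\<in>?S. joint_density n f g * (forrelation n f g - m)\<^sup>2) / (m - 3/5)\<^sup>2"
    by (simp add: sum_divide_distrib case_prod_beta)
  also have "\<dots> \<le> (card ?S * ((\<integral>v. (mean_corr \<psi> n v - m)\<^sup>2 \<partial>gaussian (cube n)) + 1 / 2 ^ n)) / (m - 3/5)\<^sup>2"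
    by (intro divide_right_mono sum_density_forrelation int) simp
  finally show ?thesis by simp
qed

text \<open>Compares two bounds for the rejection probability: nearly 1/2 + \<epsilon> from below on
  uniform inputs, nearly 1/2 - \<epsilon> from above on hard ones. The first summand on the right
  accounts for inputs outside the relevant half of the promise, the second for the change of
  distribution.\<close>

lemma solver_gap:
  assumes sol: "solves_forrelation n (1/2 - \<epsilon>) A" and k: "max_queries n A = enat k" "k \<le> T" and eps: "\<epsilon> > 0"
    and T: "T > 0" "(real T)\<^sup>2 \<le> 2 ^ n" and l: "l > 0"
    and m: "m > 3/5" and int: "integrable (gaussian (cube n)) (\<lambda>v. (mean_corr \<psi> n v - m)\<^sup>2)"
  shows "2 * \<epsilon> \<le> (1/2 + \<epsilon>) * (10000 / 2 ^ n + ((\<integral>v. (mean_corr \<psi> n v - m)\<^sup>2 \<partial>gaussian (cube n)) + 1 / 2 ^ n) / (m - 3/5)\<^sup>2)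
     + (D + 4 * curv) * (l + (1 + 1 / l) * (4 * (real T)\<^sup>2 / 2 ^ n * ((real n)\<^sup>2 + 8 * real n + 8)) + (real T)\<^sup>2 / 2 ^ n)"
proof -
  let ?S = "sign_funs n \<times> sign_funs n"
  define M where "M = real (card ?S)"
  have M: "M > 0" by (simp add: M_def card_sign_funs)
  define p1 where "p1 = ((\<integral>v. (mean_corr \<psi> n v - m)\<^sup>2 \<partial>gaussian (cube n)) + 1 / 2 ^ n) / (m - 3/5)\<^sup>2"
  define \<delta> where "\<delta> = (D + 4 * curv) * (l + (1 + 1 / l) * (4 * (real T)\<^sup>2 / 2 ^ n * ((real n)\<^sup>2 + 8 * real n + 8)) + (real T)\<^sup>2 / 2 ^ n)"
  have ge: "(\<Sum>(f, g)\<in>?S. reject_prob A T f g) - M * \<delta> \<le> (\<Sum>(f, g)\<in>?S. reject_prob A T f g * joint_density n f g)"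
    unfolding M_def \<delta>_def by (rule reject_prob_density_ge) (use sol T l in \<open>auto simp: solves_forrelation_def\<close>)
  have "(\<Sum>(f, g)\<in>?S. reject_prob A T f g * joint_density n f g) \<le>
      (\<Sum>(f, g)\<in>?S. (1/2 - \<epsilon>) * joint_density n f g + (1/2 + \<epsilon>) * (joint_density n f g * of_bool (forrelation n f g < 3/5)))"
  proof (intro sum_mono, clarify)
    fix f g assume fg: "f \<in> sign_funs n" "g \<in> sign_funs n"
    \<comment> \<open>Below the threshold only the trivial bound 1 = (1/2 - \<epsilon>) + (1/2 +
      \<epsilon>) is available.\<close>
    have "reject_prob A T f g \<le> (1/2 - \<epsilon>) + (1/2 + \<epsilon>) * of_bool (forrelation n f g < 3/5)"
      using reject_prob_valid(1)[OF sol k fg] reject_prob_bounds(2)[of A T f g] by (cases "forrelation n f g < 3/5") auto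
    hence "reject_prob A T f g * joint_density n f g \<le>
        ((1/2 - \<epsilon>) + (1/2 + \<epsilon>) * of_bool (forrelation n f g < 3/5)) * joint_density n f g"
      by (rule mult_right_mono) (rule density_nonneg[OF fg])
    thus "reject_prob A T f g * joint_density n f g \<le>
        (1/2 - \<epsilon>) * joint_density n f g + (1/2 + \<epsilon>) * (joint_density n f g * of_bool (forrelation n f g < 3/5))"
      by (simp only: distrib_right mult.assoc mult.commute[of "joint_density n f g"])
  qed
  also have "\<dots> = (1/2 - \<epsilon>) * (\<Sum>(f, g)\<in>?S. joint_density n f g) +
      (1/2 + \<epsilon>) * (\<Sum>(f, g)\<in>?S. joint_density n f g * of_bool (forrelation n f g < 3/5))"
    by (simp only: split_def sum.distrib sum_distrib_left)
  also have "\<dots> \<le> (1/2 - \<epsilon>) * M + (1/2 + \<epsilon>) * (M * p1)"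
    using sum_density_below[OF m int] eps unfolding sum_density M_def p1_def
    by (intro add_left_mono mult_left_mono) auto
  finally have up: "(\<Sum>(f, g)\<in>?S. reject_prob A T f g * joint_density n f g) \<le> (1/2 - \<epsilon>) * M + (1/2 + \<epsilon>) * (M * p1)" .
  \<comment> \<open>The factor 10000 = 100^2 is Chebyshev's constant for the threshold
    1/100.\<close>
  have "(1/2 + \<epsilon>) * (M - 10000 * (M / 2 ^ n)) \<le> (1/2 + \<epsilon>) * (M - 10000 * (\<Sum>(f, g)\<in>?S. (forrelation n f g)\<^sup>2))"
    using sum_forrelation_square_uniform[of n] eps unfolding M_def by (intro mult_left_mono) auto
  also have "\<dots> = (\<Sum>(f, g)\<in>?S. (1/2 + \<epsilon>) * (1 - 10000 * (forrelation n f g)\<^sup>2))"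
    by (simp add: case_prod_beta M_def sum_subtractf flip: sum_distrib_left)
  also have "\<dots> \<le> (\<Sum>(f, g)\<in>?S. reject_prob A T f g)"
  proof (intro sum_mono, clarify)
    fix f g assume fg: "f \<in> sign_funs n" "g \<in> sign_funs n"
    show "(1/2 + \<epsilon>) * (1 - 10000 * (forrelation n f g)\<^sup>2) \<le> reject_prob A T f g"
    proof (cases "\<bar>forrelation n f g\<bar> \<le> 1/100")
      case True
      have "(1/2 + \<epsilon>) * (1 - 10000 * (forrelation n f g)\<^sup>2) \<le> (1/2 + \<epsilon>) * 1"
        using eps by (intro mult_left_mono) auto
      thus ?thesis using reject_prob_valid(2)[OF sol k fg True] by simp
    next
      case False
      hence "(1/100)\<^sup>2 \<le> \<bar>forrelation n f g\<bar>\<^sup>2" by (intro power_mono) auto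
      hence "1 - 10000 * (forrelation n f g)\<^sup>2 \<le> 0" by (simp add: power2_eq_square)
      hence "(1/2 + \<epsilon>) * (1 - 10000 * (forrelation n f g)\<^sup>2) \<le> 0"
        using eps by (intro mult_nonneg_nonpos) auto
      thus ?thesis using reject_prob_bounds(1)[of A T f g] by linarith
    qed
  qed
  finally have lo: "(1/2 + \<epsilon>) * (M - 10000 * (M / 2 ^ n)) \<le> (\<Sum>(f, g)\<in>?S. reject_prob A T f g)" .
  have "(1/2 + \<epsilon>) * (M - 10000 * (M / 2 ^ n)) - M * \<delta> \<le> (1/2 - \<epsilon>) * M + (1/2 + \<epsilon>) * (M * p1)"
    using lo ge up by linarith
  hence "M * (2 * \<epsilon>) \<le> M * ((1/2 + \<epsilon>) * (10000 / 2 ^ n + p1) + \<delta>)"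
    by (simp add: algebra_simps)
  thus ?thesis using M unfolding p1_def \<delta>_def by (simp only: mult_le_cancel_left_pos)
qed

end

theorem theorem1:
  fixes \<epsilon> :: real
  assumes "\<epsilon> > 0"
  shows "\<exists>c>0. \<forall>\<^sub>F n in sequentially. \<forall>A :: randomized_algorithm.
           solves_forrelation n (1/2 - \<epsilon>) A \<longrightarrow>
           ereal (c * (sqrt (2 ^ n) / log 2 (2 ^ n))) \<le> ereal_of_enat (max_queries n A)"
proof -
  interpret rounding "sine_poly 5 flat_coeff flat_freq"
    "\<lambda>z. \<Sum>k<5. flat_coeff k * flat_freq k * cos (flat_freq k * z)"
    "\<lambda>z. \<Sum>k<5. - (flat_coeff k * (flat_freq k)\<^sup>2 * sin (flat_freq k * z))"
    "199/200" "\<Sum>k<5. \<bar>flat_coeff k * flat_freq k\<bar> + \<bar>flat_coeff k * (flat_freq k)\<^sup>2\<bar>"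
    by (rule rounding_sine_poly[OF abs_flat_le]) simp
  define D where "D = (\<Sum>k<5. \<bar>flat_coeff k * flat_freq k\<bar> + \<bar>flat_coeff k * (flat_freq k)\<^sup>2\<bar>)"
  define m where "m = sine_poly_gain 5 flat_coeff flat_freq"
  have m: "m > 3/5" unfolding m_def by (rule flat_gain)
  have "\<bar>sine_poly 5 flat_coeff flat_freq z\<bar> \<le> 1" for z using abs_flat_le[of z] by linarith
  from mean_corr_concentrated[OF this] obtain C where
    int: "\<And>n. integrable (gaussian (cube n)) (\<lambda>v. (mean_corr (sine_poly 5 flat_coeff flat_freq) n v - m)\<^sup>2)" and
    C: "\<And>n. (\<integral>v. (mean_corr (sine_poly 5 flat_coeff flat_freq) n v - m)\<^sup>2 \<partial>gaussian (cube n)) \<le> C / sqrt (2 ^ n)"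
    unfolding m_def by blast
  \<comment> \<open>The summand 1 makes \<open>K\<close> positive, so that \<open>l\<close> can be a
    quotient by it.\<close>
  define K where "K = D + 4 * curv + 1"
  have K: "K \<ge> 1" using D_nonneg curv_nonneg by (simp add: K_def D_def)
  define l where "l = \<epsilon> / (4 * K)"
  have l: "l > 0" using assms K by (simp add: l_def)
  \<comment> \<open>The number 69 is 4 * 17 + 1: n^2 + 8 n + 8 \<le> 17 n^2 for n \<ge> 1, and the
    separate term T^2 / 2^n contributes 1. The minimum with 1 ensures T^2 \<le> 2^n.\<close>
  define c where "c = min 1 (sqrt (\<epsilon> / (4 * K * (69 * (1 + 1 / l)))))"
  have c: "c > 0" using assms K l by (simp add: c_def add_pos_pos)
  have c1: "c \<le> 1" by (simp add: c_def)
  have c2: "c\<^sup>2 * (69 * (1 + 1 / l)) \<le> \<epsilon> / (4 * K)"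
  proof -
    have pos: "69 * (1 + 1 / l) > 0" using l by (simp add: add_pos_pos)
    have "c\<^sup>2 \<le> (sqrt (\<epsilon> / (4 * K * (69 * (1 + 1 / l)))))\<^sup>2"
      using c by (intro power_mono) (auto simp: c_def)
    also have "\<dots> = \<epsilon> / (4 * K * (69 * (1 + 1 / l)))"
      using assms K pos by simp
    finally show ?thesis using pos by (simp add: pos_le_divide_eq mult.assoc flip: divide_divide_eq_left)
  qed
  have "((\<lambda>n::nat. (1/2 + \<epsilon>) * (10000 / 2 ^ n + (C / sqrt (2 ^ n) + 1 / 2 ^ n) / (m - 3/5)\<^sup>2)) \<longlongrightarrow>
      (1/2 + \<epsilon>) * (0 + (0 + 0) / (m - 3/5)\<^sup>2)) sequentially"
    using m by (intro tendsto_intros) (real_asymp | simp)+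
  hence small: "\<forall>\<^sub>F n in sequentially. (1/2 + \<epsilon>) * (10000 / 2 ^ n + (C / sqrt (2 ^ n) + 1 / 2 ^ n) / (m - 3/5)\<^sup>2) < \<epsilon>"
    using assms by (intro order_tendstoD(2)) auto
  have large: "\<forall>\<^sub>F n::nat in sequentially. 1 \<le> c * (sqrt (2 ^ n) / real n)"
    using c by real_asymp
  show ?thesis
  proof (intro exI[of _ c] conjI c)
    show "\<forall>\<^sub>F n in sequentially. \<forall>A :: randomized_algorithm. solves_forrelation n (1/2 - \<epsilon>) A \<longrightarrow>
        ereal (c * (sqrt (2 ^ n) / log 2 (2 ^ n))) \<le> ereal_of_enat (max_queries n A)"
      using small large eventually_gt_at_top[of 0]
    proof eventually_elim
      case (elim n)
      show ?case
      proof (intro allI impI, rule ccontr)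
        fix A assume sol: "solves_forrelation n (1/2 - \<epsilon>) A"
          and "\<not> ereal (c * (sqrt (2 ^ n) / log 2 (2 ^ n))) \<le> ereal_of_enat (max_queries n A)"
        hence lt: "ereal_of_enat (max_queries n A) < ereal (c * (sqrt (2 ^ n) / real n))"
          by (simp add: log_nat_power not_le)
        then obtain k where k: "max_queries n A = enat k" by (cases "max_queries n A") auto
        hence kb: "real k < c * (sqrt (2 ^ n) / real n)" using lt by simp
        \<comment> \<open>An algorithm without queries still needs a positive budget, since the
          potential divides by \<open>T\<close>; the value 1 is below the claimed bound for large
          \<open>n\<close>.\<close>
        define T where "T = max k 1"
        have T: "T > 0" "k \<le> T" by (auto simp: T_def)
        have n: "real n \<ge> 1" using elim(3) by simp
        have "real T \<le> c * (sqrt (2 ^ n) / real n)" using kb elim(2) by (simp add: T_def)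
        hence "(real T)\<^sup>2 \<le> (c * (sqrt (2 ^ n) / real n))\<^sup>2" by (intro power_mono) auto
        also have "\<dots> = c\<^sup>2 / (real n)\<^sup>2 * 2 ^ n" by (simp add: power_mult_distrib power_divide)
        finally have T2: "(real T)\<^sup>2 / 2 ^ n \<le> c\<^sup>2 / (real n)\<^sup>2" by (simp add: field_simps)
        have n2: "(real n)\<^sup>2 \<ge> 1" using n by simp
        have "c\<^sup>2 / (real n)\<^sup>2 \<le> c\<^sup>2"
          using mult_left_mono[OF n2, of "c\<^sup>2"] n2 by (simp add: divide_le_eq)
        hence T3: "(real T)\<^sup>2 / 2 ^ n \<le> c\<^sup>2" using T2 by linarith
        moreover have "c\<^sup>2 \<le> 1" using c c1 by (simp add: power_le_one)
        ultimately have "(real T)\<^sup>2 / 2 ^ n \<le> 1" by linarith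
        hence T4: "(real T)\<^sup>2 \<le> 2 ^ n" by (simp add: divide_le_eq)
        have "real n \<le> (real n)\<^sup>2" using mult_left_mono[OF n, of "real n"] by (simp add: power2_eq_square)
        hence n17: "(real n)\<^sup>2 + 8 * real n + 8 \<le> 17 * (real n)\<^sup>2" using n2 by linarith
        have "(real T)\<^sup>2 / 2 ^ n * ((real n)\<^sup>2 + 8 * real n + 8) \<le> c\<^sup>2 / (real n)\<^sup>2 * (17 * (real n)\<^sup>2)"
          by (intro mult_mono T2 n17) auto
        also have "\<dots> = 17 * c\<^sup>2" using n by simp
        finally have "4 * (real T)\<^sup>2 / 2 ^ n * ((real n)\<^sup>2 + 8 * real n + 8) \<le> 68 * c\<^sup>2" by simp
        hence "(1 + 1 / l) * (4 * (real T)\<^sup>2 / 2 ^ n * ((real n)\<^sup>2 + 8 * real n + 8)) \<le> (1 + 1 / l) * (68 * c\<^sup>2)"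
          using l by (intro mult_left_mono) auto
        moreover have "(real T)\<^sup>2 / 2 ^ n \<le> (1 + 1 / l) * c\<^sup>2"
          using T3 l mult_right_mono[of 1 "1 + 1 / l" "c\<^sup>2"] by simp
        moreover have "(1 + 1 / l) * (68 * c\<^sup>2) + (1 + 1 / l) * c\<^sup>2 = c\<^sup>2 * (69 * (1 + 1 / l))"
          by (simp add: algebra_simps)
        ultimately have "l + (1 + 1 / l) * (4 * (real T)\<^sup>2 / 2 ^ n * ((real n)\<^sup>2 + 8 * real n + 8)) + (real T)\<^sup>2 / 2 ^ n
            \<le> l + \<epsilon> / (4 * K)" using c2 by linarith
        also have "\<dots> = \<epsilon> / (2 * K)" by (simp add: l_def)
        finally have "(D + 4 * curv) * (l + (1 + 1 / l) * (4 * (real T)\<^sup>2 / 2 ^ n * ((real n)\<^sup>2 + 8 * real n + 8)) + (real T)\<^sup>2 / 2 ^ n)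
            \<le> K * (\<epsilon> / (2 * K))"
          using l D_nonneg curv_nonneg by (intro mult_mono) (auto simp: K_def D_def)
        also have "\<dots> = \<epsilon> / 2" using K by simp
        finally have err: "(D + 4 * curv) * (l + (1 + 1 / l) * (4 * (real T)\<^sup>2 / 2 ^ n * ((real n)\<^sup>2 + 8 * real n + 8)) + (real T)\<^sup>2 / 2 ^ n)
            \<le> \<epsilon> / 2" .
        have "(1/2 + \<epsilon>) * (10000 / 2 ^ n + ((\<integral>v. (mean_corr (sine_poly 5 flat_coeff flat_freq) n v - m)\<^sup>2 \<partial>gaussian (cube n)) + 1 / 2 ^ n) / (m - 3/5)\<^sup>2)
            \<le> (1/2 + \<epsilon>) * (10000 / 2 ^ n + (C / sqrt (2 ^ n) + 1 / 2 ^ n) / (m - 3/5)\<^sup>2)"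
          using assms by (intro mult_left_mono add_left_mono divide_right_mono add_right_mono C) auto
        moreover have "2 * \<epsilon> \<le> (1/2 + \<epsilon>) * (10000 / 2 ^ n + ((\<integral>v. (mean_corr (sine_poly 5 flat_coeff flat_freq) n v - m)\<^sup>2 \<partial>gaussian (cube n)) + 1 / 2 ^ n) / (m - 3/5)\<^sup>2)
          + (D + 4 * curv) * (l + (1 + 1 / l) * (4 * (real T)\<^sup>2 / 2 ^ n * ((real n)\<^sup>2 + 8 * real n + 8)) + (real T)\<^sup>2 / 2 ^ n)"
          unfolding D_def by (rule solver_gap[OF sol k T(2) assms T(1) T4 l m int])
        \<comment> \<open>The gap 2 \<epsilon> would be less than \<epsilon> + \<epsilon> /
          2.\<close>
        ultimately show False using elim(1) err assms by linarith
      qed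
    qed
  qed
qed

end
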